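(* For every instance of DDP-SC in which all battery stations are swapping stations, Mod-Alg-DDP-SC (described in the context) runs in $\mathcal O(n^{2.273}+r)$ time, assigns every delivery to exactly one drone, every drone's assignment is feasible, and it uses at most $\big(3+\frac{\epsilon_{max}-\epsilon_{min}}{1-\epsilon_{max}}\big)OPT_{SC}$ drones; i.e. it is a $\big(3+\frac{\epsilon_{max}-\epsilon_{min}}{1-\epsilon_{max}}\big)$-approximation algorithm.
   Context: Model: $n$ deliveries with closed delivery time intervals $I_j=[t_j^L,t_j^R]$ and costs $cost(I_j)\in(0,B]$, $B>0$ the battery capacity of identical drones; intervals are compatible if disjoint, otherwise conflicting. $r$ swapping stations with swapping intervals $I_\ell^c=[t_\ell^A,t_\ell^D]$, $t_1^A<t_1^D<\dots<t_r^A<t_r^D$; no delivery interval is contained in a swapping interval and none intersects two of them. A drone swapping at station $\ell$ occupies all of $I_\ell^c$, ends with battery $B$, and cannot serve deliveries intersecting $I_\ell^c$; several drones may swap simultaneously. A drone starts with battery $B$; a feasible assignment is a set of delivery and swapping intervals, pairwise disjoint, such that in time order each delivery's cost is at most the remaining battery when taken. $OPT_{SC}$ is the minimum number of drones such that every delivery is assigned to exactly one drone and all assignments are feasible. $\omega$ is the maximum number of pairwise conflicting delivery intervals; $\epsilon_{min}=\frac1B\min_j cost(I_j)$, $\epsilon_{max}=\min\{\frac12,\frac1B\max_j cost(I_j)\}$. Mod-Alg-DDP-SC: (1) Build the interval graph $G$ (delivery intervals, adjacent iff conflicting) and compute $\omega$. (2) $\widetilde{\mathcal I}_1=\{I_j:t_j^L\le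 t_1^D\}$, $\widetilde{\mathcal I}_\ell=\{I_j: t_{\ell-1}^D<t_j^L\le t_\ell^D\}$ ($2\le\ell\le r$), $\widetilde{\mathcal I}_{r+1}=\{I_j:t_j^L>t_r^D\}$; $G_\ell$ is the subgraph of $G$ induced by $\widetilde{\mathcal I}_\ell$. For $\ell\le r$, $\mathcal I_\ell^{left}$ are the intervals of $\widetilde{\mathcal I}_\ell$ containing $t_\ell^A$ and $\mathcal I_\ell^{right}$ those containing $t_\ell^D$ but not in $\mathcal I_\ell^{left}$. (3) For $\ell\le r$, build the bipartite graph $G_\ell^b$ on $\mathcal I_\ell^{left}\cup\mathcal I_\ell^{right}$, with $u\in\mathcal I_\ell^{left}$, $v\in\mathcal I_\ell^{right}$ adjacent iff disjoint and $cost(u)+cost(v)\le B$. (4) Find a maximum matching $\mathcal M_\ell$ of $G_\ell^b$, of size $x_\ell$; set $z_\ell=|\mathcal I_\ell^{left}\cup\mathcal I_\ell^{right}|-x_\ell$, and $z_{r+1}=0$. (5) For $\ell\le r$, color $G_\ell$ with $\max\{\omega,z_\ell\}$ colors: both endpoints of each matching edge get a common color (distinct edges distinct colors), each unmatched vertex of $G_\ell^b$ gets a further distinct color, then the remaining vertices of $G_\ell$ are colored in non-increasing order of rendezvous time $t_j^R$, each receiving a color not used by its already colored neighbours; $G_{r+1}$ is properly colored with $\omega$ colors. (6) For each $\ell$, in each color class of $G_\ell$ process the intervals one by one, first the two intervals of the matched pair (if any) of that class, then the rest in arbitrary order, putting each interval into some already used drone of that class with remaining capacity at least its cost, else into a new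 drone (remaining capacity $B$ minus its cost); the resulting drone sets are the $\widetilde m_\ell$ blocks of $\widetilde{\mathcal I}_\ell$. (7) $z_{max}=\max_\ell z_\ell$, $\widetilde m_{max}=\max_\ell\widetilde m_\ell$; use $\widetilde m_{max}+z_{max}$ drones. (8) For $\ell=1,\dots,r+1$, assign the blocks of $\widetilde{\mathcal I}_\ell$ to distinct drones not in $\mathcal D_{\ell-1}^{ext}$, where $\mathcal D_\ell^{ext}$ is the set of drones assigned to intervals of $\mathcal I_\ell^{left}\cup\mathcal I_\ell^{right}$ ($\mathcal D_0^{ext}=\emptyset$); then, if $\ell\le r$, every used drone not in $\mathcal D_\ell^{ext}$ swaps its battery at station $\ell$. *)

theory Defs
  imports Complex_Main
begin

section \<open>The problem DDP-SC\<close>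

text \<open>Deliveries are numbered \<open>1, \<dots>, ndel\<close> and swapping stations \<open>1, \<dots>, nsta\<close>; values outside
  these ranges are irrelevant.\<close>

record inst =
  ndel :: nat
  nsta :: nat
  cap :: real
  tL :: "nat \<Rightarrow> real"
  tR :: "nat \<Rightarrow> real"
  cost :: "nat \<Rightarrow> real"
  tA :: "nat \<Rightarrow> real"
  tD :: "nat \<Rightarrow> real"

abbreviation dels :: "inst \<Rightarrow> nat set" where "dels I \<equiv> {1..ndel I}"
abbreviation stas :: "inst \<Rightarrow> nat set" where "stas I \<equiv> {1..nsta I}"

datatype event = Del nat | Swap nat

fun ivl :: "inst \<Rightarrow> event \<Rightarrow> real set" where
  "ivl I (Del j) = {tL I j..tR I j}"
| "ivl I (Swap l) = {tA I l..tD I l}"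

fun start :: "inst \<Rightarrow> event \<Rightarrow> real" where
  "start I (Del j) = tL I j"
| "start I (Swap l) = tA I l"

text \<open>\<open>ndel I \<ge> 1\<close> is needed for the extremal costs to exist.\<close>

definition ddp_sc :: "inst \<Rightarrow> bool" where
  "ddp_sc I \<longleftrightarrow>
     ndel I \<ge> 1 \<and> cap I > 0 \<and>
     (\<forall>j\<in>dels I. tL I j \<le> tR I j \<and> 0 < cost I j \<and> cost I j \<le> cap I) \<and>
     (\<forall>l\<in>stas I. tA I l < tD I l) \<and>
     (\<forall>l\<in>stas I. l + 1 \<in> stas I \<longrightarrow> tD I l < tA I (l + 1)) \<and>
     (\<forall>j\<in>dels I. \<forall>l\<in>stas I. \<not> ivl I (Del j) \<subseteq> ivl I (Swap l)) \<and>
     (\<forall>j\<in>dels I. \<forall>l\<in>stas I. \<forall>l'\<in>stas I.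
        \<not> disjnt (ivl I (Del j)) (ivl I (Swap l)) \<longrightarrow>
        \<not> disjnt (ivl I (Del j)) (ivl I (Swap l')) \<longrightarrow> l = l')"

text \<open>The second argument is the battery level before the events, taken in the order of the list.\<close>

fun battery_ok :: "inst \<Rightarrow> real \<Rightarrow> event list \<Rightarrow> bool" where
  "battery_ok I b [] \<longleftrightarrow> True"
| "battery_ok I b (Del j # es) \<longleftrightarrow> cost I j \<le> b \<and> battery_ok I (b - cost I j) es"
| "battery_ok I b (Swap l # es) \<longleftrightarrow> battery_ok I (cap I) es"

definition feasible :: "inst \<Rightarrow> event set \<Rightarrow> bool" where
  "feasible I A \<longleftrightarrow>
     A \<subseteq> Del ` dels I \<union> Swap ` stas I \<and>
     pairwise (\<lambda>e e'. disjnt (ivl I e) (ivl I e')) A \<and>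
     (\<exists>es. set es = A \<and> sorted_wrt (\<lambda>e e'. start I e < start I e') es \<and>
           battery_ok I (cap I) es)"

text \<open>A schedule for \<open>m\<close> drones \<open>1, \<dots>, m\<close> maps each drone to its assignment.\<close>

definition feasible_schedule :: "inst \<Rightarrow> nat \<Rightarrow> (nat \<Rightarrow> event set) \<Rightarrow> bool" where
  "feasible_schedule I m A \<longleftrightarrow>
     (\<forall>j\<in>dels I. \<exists>!d. d \<in> {1..m} \<and> Del j \<in> A d) \<and> (\<forall>d\<in>{1..m}. feasible I (A d))"

definition OPT_SC :: "inst \<Rightarrow> nat" where
  "OPT_SC I = (LEAST m. \<exists>A. feasible_schedule I m A)"

definition eps_min :: "inst \<Rightarrow> real" where
  "eps_min I = Min (cost I ` dels I) / cap I"

definition eps_max :: "inst \<Rightarrow> real" where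
  "eps_max I = min (1/2) (Max (cost I ` dels I) / cap I)"


section \<open>Nondeterministic computations\<close>

text \<open>A nondeterministic computation is the set of its possible outcomes, where \<open>None\<close> is the outcome
  of a computation that gets stuck. A choice without any admissible candidate gets stuck, hence
  no computation below has an empty set of outcomes.\<close>

type_synonym 'a nd = "'a option set"

definition ret :: "'a \<Rightarrow> 'a nd" where
  "ret x = {Some x}"

definition pick :: "('a \<Rightarrow> bool) \<Rightarrow> 'a nd" where
  "pick P = (if \<exists>x. P x then Some ` {x. P x} else {None})"

definition bind :: "'a nd \<Rightarrow> ('a \<Rightarrow> 'b nd) \<Rightarrow> 'b nd"  (infixl \<open>\<triangleright>\<close> 54) where
  "C \<triangleright> f = (\<Union>x\<in>C. case x of None \<Rightarrow> {None} | Some y \<Rightarrow> f y)"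

primrec for_each :: "'x list \<Rightarrow> ('x \<Rightarrow> 's \<Rightarrow> 's nd) \<Rightarrow> 's \<Rightarrow> 's nd" where
  "for_each [] f s = ret s"
| "for_each (x # xs) f s = f x s \<triangleright> for_each xs f"


section \<open>Mod-Alg-DDP-SC\<close>

subsection \<open>Interval graph and batches\<close>

definition adj :: "inst \<Rightarrow> nat \<Rightarrow> nat \<Rightarrow> bool" where
  "adj I i j \<longleftrightarrow> i \<noteq> j \<and> \<not> disjnt (ivl I (Del i)) (ivl I (Del j))"

definition omega :: "inst \<Rightarrow> nat" where
  "omega I = Max (card ` {S. S \<subseteq> dels I \<and> pairwise (adj I) S})"

text \<open>For \<open>nsta I = 0\<close> the only batch, number 1, consists of all deliveries.\<close>

definition batch :: "inst \<Rightarrow> nat \<Rightarrow> nat set" where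
  "batch I l = {j \<in> dels I. (l \<ge> 2 \<longrightarrow> tD I (l - 1) < tL I j) \<and> (l \<le> nsta I \<longrightarrow> tL I j \<le> tD I l)}"

definition lefts :: "inst \<Rightarrow> nat \<Rightarrow> nat set" where
  "lefts I l = (if l \<le> nsta I then {j \<in> batch I l. tA I l \<in> ivl I (Del j)} else {})"

definition rights :: "inst \<Rightarrow> nat \<Rightarrow> nat set" where
  "rights I l = (if l \<le> nsta I then {j \<in> batch I l. tD I l \<in> ivl I (Del j)} - lefts I l else {})"

abbreviation ext :: "inst \<Rightarrow> nat \<Rightarrow> nat set" where
  "ext I l \<equiv> lefts I l \<union> rights I l"

subsection \<open>Matching\<close>

definition bip_edges :: "inst \<Rightarrow> nat \<Rightarrow> (nat \<times> nat) set" where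
  "bip_edges I l = {(u, v). u \<in> lefts I l \<and> v \<in> rights I l \<and>
     disjnt (ivl I (Del u)) (ivl I (Del v)) \<and> cost I u + cost I v \<le> cap I}"

definition matching :: "inst \<Rightarrow> nat \<Rightarrow> (nat \<times> nat) set \<Rightarrow> bool" where
  "matching I l M \<longleftrightarrow> M \<subseteq> bip_edges I l \<and> inj_on fst M \<and> inj_on snd M"

definition max_matching :: "inst \<Rightarrow> nat \<Rightarrow> (nat \<times> nat) set \<Rightarrow> bool" where
  "max_matching I l M \<longleftrightarrow> matching I l M \<and> (\<forall>M'. matching I l M' \<longrightarrow> card M' \<le> card M)"

text \<open>For the last batch \<open>ext\<close> and the matching are empty, so this is 0 there.\<close>

definition zval :: "inst \<Rightarrow> nat \<Rightarrow> (nat \<times> nat) set \<Rightarrow> nat" where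
  "zval I l M = card (ext I l) - card M"

subsection \<open>Coloring\<close>

definition ext_coloring :: "inst \<Rightarrow> nat \<Rightarrow> (nat \<times> nat) set \<Rightarrow> nat \<Rightarrow> (nat \<rightharpoonup> nat) \<Rightarrow> bool" where
  "ext_coloring I l M k col \<longleftrightarrow>
     dom col = ext I l \<and> ran col \<subseteq> {1..k} \<and>
     (\<forall>u\<in>ext I l. \<forall>v\<in>ext I l. col u = col v \<longleftrightarrow> u = v \<or> (u, v) \<in> M \<or> (v, u) \<in> M)"

definition color_vertex ::
    "inst \<Rightarrow> nat \<Rightarrow> nat \<Rightarrow> nat \<Rightarrow> (nat \<rightharpoonup> nat) \<Rightarrow> (nat \<rightharpoonup> nat) nd" where
  "color_vertex I l k v col =
     pick (\<lambda>c. c \<in> {1..k} \<and> (\<forall>u\<in>batch I l. adj I u v \<longrightarrow> col u \<noteq> Some c)) \<triangleright>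
     (\<lambda>c. ret (col(v \<mapsto> c)))"

definition rest_order :: "inst \<Rightarrow> nat \<Rightarrow> nat list \<Rightarrow> bool" where
  "rest_order I l vs \<longleftrightarrow> distinct vs \<and> set vs = batch I l - ext I l \<and>
     sorted_wrt (\<lambda>i j. tR I i \<ge> tR I j) vs"

definition proper_coloring :: "inst \<Rightarrow> nat \<Rightarrow> nat \<Rightarrow> (nat \<rightharpoonup> nat) \<Rightarrow> bool" where
  "proper_coloring I l k col \<longleftrightarrow>
     dom col = batch I l \<and> ran col \<subseteq> {1..k} \<and>
     (\<forall>u\<in>batch I l. \<forall>v\<in>batch I l. adj I u v \<longrightarrow> col u \<noteq> col v)"

definition ncolors :: "inst \<Rightarrow> nat \<Rightarrow> (nat \<times> nat) set \<Rightarrow> nat" where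
  "ncolors I l M = (if l \<le> nsta I then max (omega I) (zval I l M) else omega I)"

definition color_batch :: "inst \<Rightarrow> nat \<Rightarrow> (nat \<times> nat) set \<Rightarrow> (nat \<rightharpoonup> nat) nd" where
  "color_batch I l M =
     (if l \<le> nsta I
      then pick (ext_coloring I l M (ncolors I l M)) \<triangleright>
           (\<lambda>col. pick (rest_order I l) \<triangleright>
           (\<lambda>vs. for_each vs (color_vertex I l (ncolors I l M)) col))
      else pick (proper_coloring I l (ncolors I l M)))"

subsection \<open>Packing the color classes\<close>

text \<open>A block is the set of deliveries that one drone serves in a batch.\<close>

definition pack :: "inst \<Rightarrow> nat \<Rightarrow> nat set set \<Rightarrow> nat set set nd" where
  "pack I j Bs =
     (if \<exists>X\<in>Bs. cost I j \<le> cap I - (\<Sum>i\<in>X. cost I i)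
      then pick (\<lambda>X. X \<in> Bs \<and> cost I j \<le> cap I - (\<Sum>i\<in>X. cost I i)) \<triangleright>
           (\<lambda>X. ret (insert (insert j X) (Bs - {X})))
      else ret (insert {j} Bs))"

definition pack_order :: "(nat \<times> nat) set \<Rightarrow> nat set \<Rightarrow> nat list \<Rightarrow> bool" where
  "pack_order M C xs \<longleftrightarrow> distinct xs \<and> set xs = C \<and>
     (\<forall>(u, v)\<in>M. u \<in> C \<longrightarrow> set (take 2 xs) = {u, v})"

definition pack_batch ::
    "inst \<Rightarrow> nat \<Rightarrow> (nat \<times> nat) set \<Rightarrow> (nat \<rightharpoonup> nat) \<Rightarrow> nat set set nd" where
  "pack_batch I l M col =
     for_each [1..<ncolors I l M + 1]
       (\<lambda>c Bs. pick (pack_order M {j \<in> batch I l. col j = Some c}) \<triangleright>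
               (\<lambda>xs. for_each xs (pack I) {}) \<triangleright>
               (\<lambda>Bs'. ret (Bs \<union> Bs')))
       {}"

text \<open>The result for a batch consists of its blocks and of \<open>zval\<close>.\<close>

definition process_batch :: "inst \<Rightarrow> nat \<Rightarrow> (nat set set \<times> nat) nd" where
  "process_batch I l =
     pick (max_matching I l) \<triangleright>
     (\<lambda>M. color_batch I l M \<triangleright>
     (\<lambda>col. pack_batch I l M col \<triangleright>
     (\<lambda>Bs. ret (Bs, zval I l M))))"

subsection \<open>Assigning the blocks to drones\<close>

text \<open>The state consists of the assignments so far and of the set of drones serving the deliveries in
  \<open>ext\<close> of the preceding batch.\<close>

definition assign_batch ::
    "inst \<Rightarrow> nat \<Rightarrow> (nat \<Rightarrow> nat set set) \<Rightarrow> nat \<Rightarrow>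
     (nat \<Rightarrow> event set) \<times> nat set \<Rightarrow> ((nat \<Rightarrow> event set) \<times> nat set) nd" where
  "assign_batch I m blocks l = (\<lambda>(A, D).
     pick (\<lambda>f. inj_on f (blocks l) \<and> f ` blocks l \<subseteq> {1..m} - D) \<triangleright>
     (\<lambda>f. let D' = f ` {X \<in> blocks l. X \<inter> ext I l \<noteq> {}} in
       ret (\<lambda>d. A d \<union> Del ` \<Union>{X \<in> blocks l. f X = d} \<union>
                (if l \<le> nsta I \<and> d \<in> {1..m} - D' then {Swap l} else {}),
            D')))"

definition mod_alg :: "inst \<Rightarrow> (nat \<times> (nat \<Rightarrow> event set)) nd" where
  "mod_alg I =
     for_each [1..<nsta I + 2] (\<lambda>l P. process_batch I l \<triangleright> (\<lambda>q. ret (P(l := q)))) (\<lambda>_. ({}, 0)) \<triangleright>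
     (\<lambda>P. let blocks = (\<lambda>l. fst (P l)); z = (\<lambda>l. snd (P l));
              m = Max ((\<lambda>l. card (blocks l)) ` {1..nsta I + 1}) + Max (z ` {1..nsta I + 1})
          in for_each [1..<nsta I + 2] (assign_batch I m blocks) (\<lambda>_. {}, {}) \<triangleright>
             (\<lambda>(A, D). ret (m, A)))"


section \<open>A cost model\<close>

text \<open>
  Running times are measured on a real RAM, presented as a structured imperative language over
  finitely many scalar variables and unbounded arrays, which hold either natural numbers or reals.
  The only operations are addition, subtraction, comparison and indexing; there is no
  multiplication or rounding that would allow many values to be packed into one. Every
  assignment and every evaluation of a guard takes one step: the size of the expressions in a
  fixed program is bounded by a constant.
\<close>

type_synonym vname = string

datatype nexp =
    NConst nat
  | NVar vname
  | NArr vname nexp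
  | NAdd nexp nexp
  | NSub nexp nexp

datatype rexp =
    RVar vname
  | RArr vname nexp
  | RAdd rexp rexp
  | RSub rexp rexp

datatype bexp =
    NLe nexp nexp
  | RLe rexp rexp
  | BNot bexp
  | BAnd bexp bexp

datatype com =
    Skip
  | NAssign vname nexp
  | NStore vname nexp nexp
  | RAssign vname rexp
  | RStore vname nexp rexp
  | Seq com com
  | Cond bexp com com
  | While bexp com

record state =
  nvar :: "vname \<Rightarrow> nat"
  narr :: "vname \<Rightarrow> nat \<Rightarrow> nat"
  rvar :: "vname \<Rightarrow> real"
  rarr :: "vname \<Rightarrow> nat \<Rightarrow> real"

fun nval :: "nexp \<Rightarrow> state \<Rightarrow> nat" where
  "nval (NConst k) s = k"
| "nval (NVar x) s = nvar s x"
| "nval (NArr a e) s = narr s a (nval e s)"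
| "nval (NAdd e e') s = nval e s + nval e' s"
| "nval (NSub e e') s = nval e s - nval e' s"

fun rval :: "rexp \<Rightarrow> state \<Rightarrow> real" where
  "rval (RVar x) s = rvar s x"
| "rval (RArr a e) s = rarr s a (nval e s)"
| "rval (RAdd e e') s = rval e s + rval e' s"
| "rval (RSub e e') s = rval e s - rval e' s"

fun bval :: "bexp \<Rightarrow> state \<Rightarrow> bool" where
  "bval (NLe e e') s \<longleftrightarrow> nval e s \<le> nval e' s"
| "bval (RLe e e') s \<longleftrightarrow> rval e s \<le> rval e' s"
| "bval (BNot b) s \<longleftrightarrow> \<not> bval b s"
| "bval (BAnd b b') s \<longleftrightarrow> bval b s \<and> bval b' s"

text \<open>\<open>exec c s t s'\<close>: started in \<open>s\<close>, the program \<open>c\<close> terminates in \<open>s'\<close> after \<open>t\<close> steps.\<close>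

inductive exec :: "com \<Rightarrow> state \<Rightarrow> nat \<Rightarrow> state \<Rightarrow> bool" where
  Skip: "exec Skip s 1 s"
| NAssign: "exec (NAssign x e) s 1 (s\<lparr>nvar := (nvar s)(x := nval e s)\<rparr>)"
| NStore: "exec (NStore a i e) s 1
    (s\<lparr>narr := (narr s)(a := (narr s a)(nval i s := nval e s))\<rparr>)"
| RAssign: "exec (RAssign x e) s 1 (s\<lparr>rvar := (rvar s)(x := rval e s)\<rparr>)"
| RStore: "exec (RStore a i e) s 1
    (s\<lparr>rarr := (rarr s)(a := (rarr s a)(nval i s := rval e s))\<rparr>)"
| Seq: "exec c s t s' \<Longrightarrow> exec c' s' t' s'' \<Longrightarrow> exec (Seq c c') s (t + t') s''"
| CondTrue: "bval b s \<Longrightarrow> exec c s t s' \<Longrightarrow> exec (Cond b c c') s (1 + t) s'"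
| CondFalse: "\<not> bval b s \<Longrightarrow> exec c' s t s' \<Longrightarrow> exec (Cond b c c') s (1 + t) s'"
| WhileFalse: "\<not> bval b s \<Longrightarrow> exec (While b c) s 1 s"
| WhileTrue: "bval b s \<Longrightarrow> exec c s t s' \<Longrightarrow> exec (While b c) s' t' s'' \<Longrightarrow>
    exec (While b c) s (1 + t + t') s''"

text \<open>The memory initially contains the instance and is 0 everywhere else.\<close>

definition initial :: "inst \<Rightarrow> state" where
  "initial I =
     \<lparr>nvar = (\<lambda>_. 0)(''n'' := ndel I, ''r'' := nsta I),
      narr = (\<lambda>_ _. 0),
      rvar = (\<lambda>_. 0)(''B'' := cap I),
      rarr = (\<lambda>_ _. 0)
        (''tL'' := (\<lambda>j. if j \<in> dels I then tL I j else 0),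
         ''tR'' := (\<lambda>j. if j \<in> dels I then tR I j else 0),
         ''cost'' := (\<lambda>j. if j \<in> dels I then cost I j else 0),
         ''tA'' := (\<lambda>l. if l \<in> stas I then tA I l else 0),
         ''tD'' := (\<lambda>l. if l \<in> stas I then tD I l else 0))\<rparr>"

text \<open>
  Listing all battery swaps explicitly can take space proportional to \<open>nsta\<close> times the number of
  drones, which is not within the time bound. The output therefore consists of the number \<open>m\<close> of
  drones and, for each delivery \<open>j\<close>, of its drone and of the station at which this drone does not
  swap on account of \<open>j\<close> (0 if there is none); at all other stations the drones do swap.
\<close>

definition solution :: "inst \<Rightarrow> state \<Rightarrow> nat \<times> (nat \<Rightarrow> event set)" where
  "solution I s =
     (let m = nvar s ''m''; drone = narr s ''drone''; skip = narr s ''skip'' in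
      (m, \<lambda>d. if d \<in> {1..m}
              then Del ` {j \<in> dels I. drone j = d} \<union>
                   Swap ` {l \<in> stas I. \<forall>j\<in>dels I. drone j = d \<longrightarrow> skip j \<noteq> l}
              else {}))"

end

theory Submission
  imports Defs
begin

text \<open>
  A feasible drone never swaps between two deliveries of one batch, so in an optimal schedule it takes
  at most \<open>cap\<close> of the cost of each batch, and its deliveries in \<open>ext I l\<close> form a matched pair or a
  single delivery. Hence \<open>OPT_SC\<close> is at least the clique number, each \<open>zval I l\<close>, and the load of each
  batch divided by \<open>cap\<close>. An any-fit packing fills all but one block of a color class beyond the
  fraction \<open>1 - eps_max\<close> of the capacity, and a batch has at most \<open>max \<omega> z\<close> classes;
  this bounds the number of blocks.

  The running time does not need fast matrix multiplication. Compatibility of a left and a right delivery is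
  dominance with respect to two linear orders (time and cost), so a greedy matching is maximum. With
  the deliveries sorted by non-increasing end, the coloring only has to remember the earliest delivery
  of each class, and every phase takes quadratic time.
\<close>

section \<open>Nondeterministic computations\<close>

text \<open>The two halves of the theorem read nondeterminism in opposite ways: the guarantee is
  about all outcomes and excludes getting stuck (\<open>always\<close>), whereas the program has to
  reach just one outcome (\<open>Some _ \<in> _\<close>). The program does not imitate the algorithm
  batch by batch; matching, coloring and packing are single passes over all deliveries by
  non-increasing end. In each batch \<open>ext\<close> is an initial segment of this order, and a
  matched pair heads its color class, so one order is legal for all three passes. The result is
  recognised as an outcome of \<open>mod_alg\<close> only afterwards. The constant: let a =
  \<open>eps_max I\<close>, e = \<open>eps_min I\<close>, and let a batch have k blocks in q
  nonempty classes. In units of \<open>cap I\<close>, all but one block of a class weigh at least 1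
  - a and the remaining one at least e, so (k - q)(1 - a) + q e is at most OPT. As q is at most OPT
  too, k is at most (2 + (a - e)/(1 - a)) OPT if e <= 1 - a; otherwise all deliveries cost more than
  half the capacity and a separate estimate gives the same bound. The third OPT pays for
  \<open>zval\<close>.\<close>

definition always :: "('a \<Rightarrow> bool) \<Rightarrow> 'a nd \<Rightarrow> bool" where
  "always P C \<longleftrightarrow> (\<forall>x\<in>C. \<exists>y. x = Some y \<and> P y)"

lemma always_ret [simp]: "always P (ret x) \<longleftrightarrow> P x"
  by (auto simp: always_def ret_def)

lemma always_pick: "\<exists>x. P x \<Longrightarrow> (\<And>x. P x \<Longrightarrow> Q x) \<Longrightarrow> always Q (pick P)"
  by (auto simp: always_def pick_def)

lemma always_bind:
  "always P C \<Longrightarrow> (\<And>x. P x \<Longrightarrow> always Q (f x)) \<Longrightarrow> always Q (C \<triangleright> f)"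
  unfolding always_def bind_def by (fastforce split: option.splits)

lemma always_bind_pick:
  "\<exists>x. P x \<Longrightarrow> (\<And>x. P x \<Longrightarrow> always Q (f x)) \<Longrightarrow> always Q (pick P \<triangleright> f)"
  by (rule always_bind[OF always_pick])

lemma always_mono: "always P C \<Longrightarrow> (\<And>x. P x \<Longrightarrow> Q x) \<Longrightarrow> always Q C"
  unfolding always_def by blast

text \<open>The invariant depends on the processed prefix as well as on the state, because the
  invariants below speak of the set of elements handled so far. The induction generalises
  \<open>P\<close>, shifting it by the head of the list.\<close>

lemma always_for_each:
  assumes "P [] s"
    and "\<And>ys x zs s. xs = ys @ x # zs \<Longrightarrow> P ys s \<Longrightarrow> always (P (ys @ [x])) (f x s)"
  shows "always (P xs) (for_each xs f s)"
  using assms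
proof (induction xs arbitrary: P s)
  case Nil
  then show ?case by simp
next
  case (Cons a xs)
  have "always (P [a]) (f a s)"
    using Cons.prems(2)[of "[]" a xs s] Cons.prems(1) by simp
  moreover have "always (P (a # xs)) (for_each xs f s')" if "P [a] s'" for s'
  proof (rule Cons.IH[of "\<lambda>ys. P (a # ys)"])
    show "P [a] s'" by fact
    show "always (P (a # (ys @ [x]))) (f x s)" if "xs = ys @ x # zs" "P (a # ys) s" for ys x zs s
      using Cons.prems(2)[of "a # ys" x zs s] that by simp
  qed
  ultimately show ?case by (auto intro: always_bind)
qed

section \<open>Reachability of one particular outcome\<close>

lemma Some_in_ret [simp]: "Some y \<in> ret x \<longleftrightarrow> y = x"
  by (auto simp: ret_def)

lemma Some_in_pick [simp]: "Some y \<in> pick P \<longleftrightarrow> P y"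
  by (auto simp: pick_def)

lemma Some_in_bind: "Some y \<in> C \<triangleright> f \<longleftrightarrow> (\<exists>x. Some x \<in> C \<and> Some y \<in> f x)"
proof
  assume "Some y \<in> C \<triangleright> f"
  then obtain x where "x \<in> C" "Some y \<in> (case x of None \<Rightarrow> {None} | Some z \<Rightarrow> f z)"
    by (auto simp: bind_def)
  then show "\<exists>x. Some x \<in> C \<and> Some y \<in> f x" by (cases x) auto
qed (force simp: bind_def)

lemma Some_in_for_each_append:
  "Some s' \<in> for_each xs f s \<Longrightarrow> Some s'' \<in> for_each ys f s' \<Longrightarrow> Some s'' \<in> for_each (xs @ ys) f s"
  by (induction xs arbitrary: s) (auto simp: Some_in_bind)

lemma Some_in_for_each_snoc:
  "Some s' \<in> for_each xs f s \<Longrightarrow> Some s'' \<in> f x s' \<Longrightarrow> Some s'' \<in> for_each (xs @ [x]) f s"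
  by (rule Some_in_for_each_append) (auto simp: Some_in_bind)

text \<open>The invariant relates each prefix of the list to one particular state reachable after it.\<close>

lemma Some_in_for_each:
  assumes "\<And>ys x zs. xs = ys @ x # zs \<Longrightarrow> Some (g (ys @ [x])) \<in> f x (g ys)"
  shows "Some (g xs) \<in> for_each xs f (g [])"
proof -
  have "\<exists>zs. xs = ys @ zs \<Longrightarrow> Some (g ys) \<in> for_each ys f (g [])" for ys
  proof (induction ys rule: rev_induct)
    case (snoc x ys)
    then show ?case using assms by (auto intro!: Some_in_for_each_snoc)
  qed simp
  then show ?thesis by blast
qed

lemma bind_nonempty:
  assumes "C \<noteq> {}" "\<And>x. f x \<noteq> {}"
  shows "C \<triangleright> f \<noteq> {}"
proof -
  obtain x where "x \<in> C" using assms(1) by blast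
  moreover have "(case x of None \<Rightarrow> {None} | Some y \<Rightarrow> f y) \<noteq> {}"
    using assms(2) by (cases x) auto
  ultimately show ?thesis unfolding bind_def by blast
qed

lemma pick_nonempty: "pick P \<noteq> {}"
  by (simp add: pick_def)

lemma for_each_nonempty: "(\<And>x s. f x s \<noteq> {}) \<Longrightarrow> for_each xs f s \<noteq> {}"
proof (induction xs arbitrary: s)
  case (Cons x xs)
  then show ?case by (simp add: bind_nonempty)
qed (simp add: ret_def)

text \<open>\<open>always\<close> holds vacuously of an empty set of outcomes, so nonemptiness is a
  separate premise. With it, a guarantee about a procedure becomes an existence proof for the object
  that the procedure constructs.\<close>

lemma always_nonempty:
  assumes "always P C" "C \<noteq> {}"
  obtains x where "P x" "Some x \<in> C"
proof -
  obtain c where c: "c \<in> C" using assms(2) by auto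
  with assms(1) obtain x where "c = Some x" "P x" unfolding always_def by auto
  with c show ?thesis by (intro that) auto
qed


section \<open>Deliveries, stations and batches\<close>

lemma disjnt_atLeastAtMost_iff:
  fixes a b c d :: "'a :: linorder"
  assumes "a \<le> b" "c \<le> d"
  shows "disjnt {a..b} {c..d} \<longleftrightarrow> b < c \<or> d < a"
proof -
  have "disjnt {a..b} {c..d} \<longleftrightarrow> \<not> max a c \<le> min b d"
    unfolding disjnt_def Int_atLeastAtMost by simp
  also have "\<dots> \<longleftrightarrow> b < c \<or> d < a"
    using assms unfolding max.bounded_iff min.bounded_iff by (meson le_less_trans not_le order.asym)
  finally show ?thesis .
qed

locale ddp =
  fixes I :: inst
  assumes valid: "ddp_sc I"
begin

abbreviation nums :: "nat set" where "nums \<equiv> {1..nsta I + 1}"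

lemma ndel_pos: "ndel I \<ge> 1" and cap_pos: "cap I > 0"
  using valid unfolding ddp_sc_def by - (elim conjE, assumption)+

lemma tL_le_tR: "j \<in> dels I \<Longrightarrow> tL I j \<le> tR I j"
  and cost_pos: "j \<in> dels I \<Longrightarrow> 0 < cost I j"
  and cost_le_cap: "j \<in> dels I \<Longrightarrow> cost I j \<le> cap I"
proof -
  have "\<forall>j\<in>dels I. tL I j \<le> tR I j \<and> 0 < cost I j \<and> cost I j \<le> cap I"
    using valid unfolding ddp_sc_def by (elim conjE)
  then show "j \<in> dels I \<Longrightarrow> tL I j \<le> tR I j" "j \<in> dels I \<Longrightarrow> 0 < cost I j"
    "j \<in> dels I \<Longrightarrow> cost I j \<le> cap I" by blast+
qed

lemma tA_less_tD: "l \<in> stas I \<Longrightarrow> tA I l < tD I l"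
proof -
  have "\<forall>l\<in>stas I. tA I l < tD I l"
    using valid unfolding ddp_sc_def by (elim conjE)
  then show "l \<in> stas I \<Longrightarrow> tA I l < tD I l" by blast
qed

lemma station_step: "l \<in> stas I \<Longrightarrow> l + 1 \<in> stas I \<Longrightarrow> tD I l < tA I (l + 1)"
proof -
  have "\<forall>l\<in>stas I. l + 1 \<in> stas I \<longrightarrow> tD I l < tA I (l + 1)"
    using valid unfolding ddp_sc_def by (elim conjE)
  then show "l \<in> stas I \<Longrightarrow> l + 1 \<in> stas I \<Longrightarrow> tD I l < tA I (l + 1)" by blast
qed

lemma station_less: "1 \<le> l \<Longrightarrow> l < k \<Longrightarrow> k \<le> nsta I \<Longrightarrow> tD I l < tA I k"
proof (induction k)
  case (Suc k)
  show ?case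
  proof (cases "l = k")
    case True
    then show ?thesis using Suc station_step[of k] by simp
  next
    case False
    then have "tD I l < tA I k" using Suc by simp
    moreover have "tA I k < tD I k" "tD I k < tA I (k + 1)"
      using Suc.prems False tA_less_tD[of k] station_step[of k] by auto
    ultimately show ?thesis by simp
  qed
qed simp

lemma tD_mono: "1 \<le> l \<Longrightarrow> l \<le> k \<Longrightarrow> k \<le> nsta I \<Longrightarrow> tD I l \<le> tD I k"
  using station_less[of l k] tA_less_tD[of k] by (cases "l = k") auto

lemma disjnt_deliveries:
  "i \<in> dels I \<Longrightarrow> j \<in> dels I \<Longrightarrow>
    disjnt (ivl I (Del i)) (ivl I (Del j)) \<longleftrightarrow> tR I i < tL I j \<or> tR I j < tL I i"
  by (simp add: disjnt_atLeastAtMost_iff tL_le_tR)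

lemma adj_iff:
  "i \<in> dels I \<Longrightarrow> j \<in> dels I \<Longrightarrow>
    adj I i j \<longleftrightarrow> i \<noteq> j \<and> tL I j \<le> tR I i \<and> tL I i \<le> tR I j"
  unfolding adj_def by (simp only: disjnt_deliveries) linarith

lemma adj_sym: "adj I i j \<longleftrightarrow> adj I j i"
  unfolding adj_def by (metis disjnt_sym)

lemma disjnt_delivery_swap:
  "j \<in> dels I \<Longrightarrow> l \<in> stas I \<Longrightarrow>
    disjnt (ivl I (Del j)) (ivl I (Swap l)) \<longleftrightarrow> tR I j < tA I l \<or> tD I l < tL I j"
  using tA_less_tD[of l] by (simp add: disjnt_atLeastAtMost_iff tL_le_tR)

text \<open>The exclusion of deliveries inside a swapping interval enters here. It allows membership
  in \<open>rights\<close> and \<open>ext\<close> to be read off from a single comparison with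
  \<open>tA\<close>.\<close>

lemma not_inside:
  assumes "j \<in> dels I" "l \<in> stas I" "tA I l \<le> tL I j"
  shows "tD I l < tR I j"
proof -
  have "\<forall>j\<in>dels I. \<forall>l\<in>stas I. \<not> ivl I (Del j) \<subseteq> ivl I (Swap l)"
    using valid unfolding ddp_sc_def by (elim conjE)
  then have "\<not> ivl I (Del j) \<subseteq> ivl I (Swap l)" using assms by blast
  then show ?thesis using assms by auto
qed

lemma one_station:
  assumes "j \<in> dels I" "l \<in> stas I" "k \<in> stas I"
    and "tL I j \<le> tD I l" "tA I l \<le> tR I j" "tL I j \<le> tD I k" "tA I k \<le> tR I j"
  shows "l = k"
proof -
  have "\<forall>j\<in>dels I. \<forall>l\<in>stas I. \<forall>l'\<in>stas I.
        \<not> disjnt (ivl I (Del j)) (ivl I (Swap l)) \<longrightarrow>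
        \<not> disjnt (ivl I (Del j)) (ivl I (Swap l')) \<longrightarrow> l = l'"
    using valid unfolding ddp_sc_def by (elim conjE)
  moreover have "\<not> disjnt (ivl I (Del j)) (ivl I (Swap l))"
    "\<not> disjnt (ivl I (Del j)) (ivl I (Swap k))"
    using assms disjnt_delivery_swap by auto
  ultimately show ?thesis using assms by blast
qed

lemma finite_batch [simp]: "finite (batch I l)"
  unfolding batch_def by (rule finite_subset[of _ "dels I"]) auto

lemma batch_subset: "batch I l \<subseteq> dels I"
  by (auto simp: batch_def)

lemma batch_dels: "j \<in> batch I l \<Longrightarrow> j \<in> dels I"
  using batch_subset by blast

lemma batch_start:
  assumes "j \<in> batch I l" "1 \<le> k" "k < l" "l \<in> nums"
  shows "tD I k < tL I j"
proof -
  have "tD I k \<le> tD I (l - 1)" "2 \<le> l" using assms by (auto intro!: tD_mono)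
  then show ?thesis using assms by (auto simp: batch_def)
qed

lemma batch_le: "j \<in> batch I l \<Longrightarrow> l \<le> nsta I \<Longrightarrow> tL I j \<le> tD I l"
  by (auto simp: batch_def)

lemma batch_unique:
  assumes "j \<in> batch I l" "j \<in> batch I k" "l \<in> nums" "k \<in> nums"
  shows "l = k"
proof -
  have "\<not> l < k" if "j \<in> batch I l" "j \<in> batch I k" "l \<in> nums" "k \<in> nums" for l k
    using that batch_start[of j k l] batch_le[of j l] by auto
  from this[of l k] this[of k l] show ?thesis using assms by (meson linorder_neqE_nat)
qed

lemma batch_exists:
  assumes "j \<in> dels I"
  shows "\<exists>l\<in>nums. j \<in> batch I l"
proof -
  \<comment> \<open>The number \<open>nsta I + 1\<close> satisfies \<open>P\<close> vacuously, so a
    least index exists; minimality supplies the strict lower bound on \<open>tL I j\<close> that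
    \<open>batch\<close> asks for.\<close>
  define P where "P l \<longleftrightarrow> l \<ge> 1 \<and> (l \<le> nsta I \<longrightarrow> tL I j \<le> tD I l)" for l
  have "P (nsta I + 1)" by (simp add: P_def)
  then obtain l where P: "P l" and le: "l \<le> nsta I + 1" and least: "\<And>k. k < l \<Longrightarrow> \<not> P k"
    by (metis LeastI Least_le not_less_Least)
  have "tD I (l - 1) < tL I j" if "2 \<le> l" using least[of "l - 1"] that by (auto simp: P_def)
  then show ?thesis using P le assms
    by (intro bexI[of _ l]) (auto simp: P_def batch_def)
qed

text \<open>A delivery that starts by \<open>tD I l\<close> and still runs at \<open>tA I k\<close>
  would meet the swapping intervals of both \<open>l\<close> and \<open>k\<close>. Hence a batch
  never interferes with a station after its own.\<close>

lemma batch_end: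
  assumes "j \<in> batch I l" "1 \<le> l" "l < k" "k \<le> nsta I"
  shows "tR I j < tA I k"
proof (rule ccontr)
  assume neg: "\<not> tR I j < tA I k"
  have "tL I j \<le> tD I l" "j \<in> dels I" using assms by (auto simp: batch_def)
  moreover have "tD I l < tA I k" "tA I l < tD I l" "tA I k < tD I k"
    using station_less[of l k] tA_less_tD[of l] tA_less_tD[of k] assms by auto
  ultimately have "l = k" using assms neg by (intro one_station[of j l k]) auto
  then show False using assms by simp
qed

lemma lefts_iff:
  "j \<in> lefts I l \<longleftrightarrow> l \<le> nsta I \<and> j \<in> batch I l \<and> tL I j \<le> tA I l \<and> tA I l \<le> tR I j"
  by (auto simp: lefts_def)

lemma rights_iff:
  "1 \<le> l \<Longrightarrow> j \<in> rights I l \<longleftrightarrow> l \<le> nsta I \<and> j \<in> batch I l \<and> tA I l < tL I j"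
  using not_inside[of j l] batch_dels[of j l] tA_less_tD[of l] batch_le[of j l]
  by (auto simp: rights_def lefts_iff)

text \<open>A delivery of the batch starts by \<open>tD I l\<close>, so reaching
  \<open>tA I l\<close> already means blocking station \<open>l\<close>. Being a lower bound on the
  end, this criterion passes to every delivery of the batch that ends later.\<close>

lemma ext_iff:
  "1 \<le> l \<Longrightarrow> j \<in> ext I l \<longleftrightarrow> l \<le> nsta I \<and> j \<in> batch I l \<and> tA I l \<le> tR I j"
  using not_inside[of j l] batch_dels[of j l] tA_less_tD[of l] batch_le[of j l] tL_le_tR[of j]
  by (auto simp: rights_iff lefts_iff)

lemma ext_subset: "ext I l \<subseteq> batch I l"
  by (auto simp: lefts_def rights_def)

lemma finite_ext [simp]: "finite (lefts I l)" "finite (rights I l)"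
  using finite_subset[OF ext_subset finite_batch, of l] by auto

lemma ext_empty: "l > nsta I \<Longrightarrow> ext I l = {}"
  by (simp add: lefts_def rights_def)

lemma lefts_rights_disjoint: "lefts I l \<inter> rights I l = {}"
  by (auto simp: rights_def)

text \<open>Earlier stations close before the batch begins and later ones open after its deliveries
  have ended, so only the batch's own station can clash. This is why checking \<open>ext\<close> is
  enough before a swap.\<close>

lemma disjnt_swap_iff:
  assumes "j \<in> batch I k" "k \<in> nums" "l \<in> stas I"
  shows "disjnt (ivl I (Del j)) (ivl I (Swap l)) \<longleftrightarrow> \<not> (k = l \<and> j \<in> ext I l)"
proof -
  consider "k < l" | "l < k" | "k = l" by linarith
  then show ?thesis
  proof cases
    case 1
    then show ?thesis
      using batch_end[of j k l] assms batch_dels[of j k] by (subst disjnt_delivery_swap) auto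
  next
    case 2
    then show ?thesis
      using batch_start[of j k l] assms batch_dels[of j k] by (subst disjnt_delivery_swap) auto
  next
    case 3
    then have "disjnt (ivl I (Del j)) (ivl I (Swap l)) \<longleftrightarrow> tR I j < tA I l"
      using assms batch_dels[of j k] batch_le[of j k] by (subst disjnt_delivery_swap) auto
    moreover have "j \<in> ext I l \<longleftrightarrow> tA I l \<le> tR I j"
      using assms 3 ext_iff[of l j] by auto
    ultimately show ?thesis using 3 by auto
  qed
qed

lemma bip_edges_iff:
  assumes "1 \<le> l"
  shows "(u, v) \<in> bip_edges I l \<longleftrightarrow>
    u \<in> lefts I l \<and> v \<in> rights I l \<and> tR I u < tL I v \<and> cost I u + cost I v \<le> cap I"
proof (cases "u \<in> lefts I l \<and> v \<in> rights I l")
  case True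
  then have "disjnt (ivl I (Del u)) (ivl I (Del v)) \<longleftrightarrow> tR I u < tL I v"
    using assms batch_dels tL_le_tR[of v] by (subst disjnt_deliveries) (auto simp: lefts_iff rights_iff)
  then show ?thesis using True by (auto simp: bip_edges_def)
qed (auto simp: bip_edges_def)

text \<open>All lefts share the point \<open>tA I l\<close>, just as all rights share
  \<open>tD I l\<close>. A drone therefore takes at most one of each kind, which turns sharing a
  drone within \<open>ext\<close> into a bipartite matching.\<close>

lemma lefts_conflict: "u \<in> lefts I l \<Longrightarrow> v \<in> lefts I l \<Longrightarrow> u \<noteq> v \<Longrightarrow> adj I u v"
  using batch_dels by (subst adj_iff) (auto simp: lefts_iff)

lemma rights_conflict:
  assumes "u \<in> rights I l" "v \<in> rights I l" "u \<noteq> v"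
  shows "adj I u v"
proof -
  have "tD I l \<in> ivl I (Del u)" "tD I l \<in> ivl I (Del v)"
    using assms by (auto simp: rights_def split: if_splits)
  then show ?thesis using assms unfolding adj_def disjnt_def by blast
qed

lemma clique_le_omega:
  assumes "S \<subseteq> dels I" "pairwise (adj I) S"
  shows "card S \<le> omega I"
  unfolding omega_def
proof (rule Max_ge)
  show "finite (card ` {S. S \<subseteq> dels I \<and> pairwise (adj I) S})"
    by (rule finite_imageI, rule finite_subset[of _ "Pow (dels I)"]) auto
qed (use assms in auto)

lemma omega_attained: "\<exists>S. S \<subseteq> dels I \<and> pairwise (adj I) S \<and> card S = omega I"
proof -
  have "omega I \<in> card ` {S. S \<subseteq> dels I \<and> pairwise (adj I) S}"
    unfolding omega_def
  proof (rule Max_in)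
    show "finite (card ` {S. S \<subseteq> dels I \<and> pairwise (adj I) S})"
      by (rule finite_imageI, rule finite_subset[of _ "Pow (dels I)"]) auto
    have "{} \<in> {S. S \<subseteq> dels I \<and> pairwise (adj I) S}" by simp
    then show "card ` {S. S \<subseteq> dels I \<and> pairwise (adj I) S} \<noteq> {}" by blast
  qed
  then show ?thesis by auto
qed

end

section \<open>Lower bounds on the number of drones\<close>

context ddp
begin

text \<open>Every listed delivery of \<open>J\<close> precedes all swaps, so nothing recharges the
  battery before the last of them; deliveries outside \<open>J\<close> only lower the level
  further.\<close>

lemma battery_sum_le_level:
  assumes "battery_ok I b es" "sorted_wrt (\<lambda>e e'. start I e < start I e') es" "0 \<le> b" "finite J"
    and "\<And>j. Del j \<in> set es \<Longrightarrow> 0 \<le> cost I j"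
    and "\<And>l j. Swap l \<in> set es \<Longrightarrow> j \<in> J \<Longrightarrow> Del j \<in> set es \<Longrightarrow> tL I j < tA I l"
  shows "(\<Sum>j\<in>{j\<in>J. Del j \<in> set es}. cost I j) \<le> b"
  using assms
proof (induction es arbitrary: b)
  case (Cons e es)
  show ?case
  proof (cases e)
    case (Del j)
    have j: "Del j \<notin> set es" using Cons.prems(2) Del by auto
    have IH: "(\<Sum>j\<in>{j\<in>J. Del j \<in> set es}. cost I j) \<le> b - cost I j"
      using Cons.prems Del by (intro Cons.IH) auto
    show ?thesis
    proof (cases "j \<in> J")
      case True
      then have "{i\<in>J. Del i \<in> set (e # es)} = insert j {i\<in>J. Del i \<in> set es}"
        using Del by auto
      then show ?thesis using IH j \<open>finite J\<close> by simp
    next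
      case False
      then have "{i\<in>J. Del i \<in> set (e # es)} = {i\<in>J. Del i \<in> set es}" using Del by auto
      then show ?thesis using IH Cons.prems(5)[of j] Del by simp
    qed
  next
    case (Swap l)
    have "Del j \<notin> set es" if "j \<in> J" for j
      using Cons.prems(2) Cons.prems(6)[of l j] that Swap by force
    then have "{j\<in>J. Del j \<in> set (e # es)} = {}" using Swap by auto
    then show ?thesis using Cons.prems(3) by (simp only: sum.empty)
  qed
qed auto

text \<open>Events are skipped until the first delivery of \<open>J\<close>. The swaps behind it
  cannot precede all of \<open>J\<close>, so they follow all of it, and the preceding lemma applies
  with the level reached, which is at most \<open>cap I\<close>.\<close>

lemma battery_sum_le_cap:
  assumes "battery_ok I b es" "sorted_wrt (\<lambda>e e'. start I e < start I e') es"
    and "0 \<le> b" "b \<le> cap I" "finite J"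
    and "\<And>j. Del j \<in> set es \<Longrightarrow> 0 \<le> cost I j"
    and "\<And>l. Swap l \<in> set es \<Longrightarrow>
      (\<forall>j\<in>J. Del j \<in> set es \<longrightarrow> tL I j < tA I l) \<or> (\<forall>j\<in>J. tA I l < tL I j)"
  shows "(\<Sum>j\<in>{j\<in>J. Del j \<in> set es}. cost I j) \<le> cap I"
  using assms
proof (induction es arbitrary: b)
  case Nil
  then show ?case by simp
next
  case (Cons e es)
  show ?case
  proof (cases "\<exists>j\<in>J. e = Del j")
    case True
    then obtain j where j: "j \<in> J" "e = Del j" by blast
    \<comment> \<open>A swap still in the list starts after \<open>j\<close>, hence not before all
      of \<open>J\<close>; the alternative in the hypothesis then puts it after every listed
      delivery of \<open>J\<close>.\<close>
    have "tL I i < tA I l" if "Swap l \<in> set (e # es)" "i \<in> J" "Del i \<in> set (e # es)" for l i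
    proof -
      have "Swap l \<in> set es" using that j by auto
      then have "tL I j < tA I l" using Cons.prems(2) j by fastforce
      moreover have "\<not> (\<forall>i\<in>J. tA I l < tL I i)" using calculation j by (meson less_asym)
      ultimately show ?thesis using Cons.prems(7)[of l] that by blast
    qed
    then have "(\<Sum>j\<in>{j\<in>J. Del j \<in> set (e # es)}. cost I j) \<le> b"
      using Cons.prems by (intro battery_sum_le_level) auto
    then show ?thesis using Cons.prems by simp
  next
    case False
    then have eq: "{j\<in>J. Del j \<in> set (e # es)} = {j\<in>J. Del j \<in> set es}" by auto
    obtain b' where "battery_ok I b' es" "0 \<le> b'" "b' \<le> cap I"
    proof (cases e)
      case (Del j)
      then show ?thesis
        using Cons.prems(1,4) Cons.prems(6)[of j] by (intro that[of "b - cost I j"]) auto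
    next
      case (Swap l)
      then show ?thesis using Cons.prems(1) cap_pos by (intro that[of "cap I"]) auto
    qed
    then have "(\<Sum>j\<in>{j\<in>J. Del j \<in> set es}. cost I j) \<le> cap I"
      using Cons.prems(2,5-7) by (intro Cons.IH) auto
    then show ?thesis unfolding eq .
  qed
qed

text \<open>A drone never swaps its battery between two deliveries of the same batch.\<close>

lemma feasible_batch_cost:
  assumes "feasible I A" "l \<in> nums"
  shows "(\<Sum>j\<in>{j\<in>batch I l. Del j \<in> A}. cost I j) \<le> cap I"
proof -
  from assms(1) obtain es where es: "set es = A" "sorted_wrt (\<lambda>e e'. start I e < start I e') es"
    "battery_ok I (cap I) es" and sub: "A \<subseteq> Del ` dels I \<union> Swap ` stas I"
    and disj: "pairwise (\<lambda>e e'. disjnt (ivl I e) (ivl I e')) A"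
    unfolding feasible_def by blast
  have "(\<Sum>j\<in>{j\<in>batch I l. Del j \<in> set es}. cost I j) \<le> cap I"
  proof (rule battery_sum_le_cap[OF es(3,2)])
    show "0 \<le> cost I j" if "Del j \<in> set es" for j
      using that sub es(1) cost_pos[of j] by auto
    show "(\<forall>j\<in>batch I l. Del j \<in> set es \<longrightarrow> tL I j < tA I k) \<or> (\<forall>j\<in>batch I l. tA I k < tL I j)"
      if "Swap k \<in> set es" for k
    proof -
      have k: "k \<in> stas I" using that sub es(1) by auto
      consider "k < l" | "l < k" | "k = l" by linarith
      then show ?thesis
      proof cases
        case 1
        then have "\<forall>j\<in>batch I l. tA I k < tL I j"
          using batch_start[of _ l k] k tA_less_tD[of k] assms(2) by fastforce
        then show ?thesis by blast
      next
        case 2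
        then have "\<forall>j\<in>batch I l. tL I j < tA I k"
          using batch_end[of _ l k] k tL_le_tR[OF batch_dels] assms(2) by fastforce
        then show ?thesis by blast
      next
        case 3
        \<comment> \<open>A delivery of batch \<open>k\<close> starts no later than
          \<open>tD I k\<close>, so disjointness from the swap can only mean that it ends before the
          swap begins.\<close>
        have "tL I j < tA I k" if j: "j \<in> batch I l" "Del j \<in> set es" for j
        proof -
          have "disjnt (ivl I (Del j)) (ivl I (Swap k))"
            using disj j \<open>Swap k \<in> set es\<close> es(1) unfolding pairwise_def by blast
          then have "tR I j < tA I k"
            using disjnt_delivery_swap[of j k] k j batch_dels[of j l] batch_le[of j l] 3 by auto
          then show ?thesis using tL_le_tR[OF batch_dels[OF j(1)]] by simp
        qed
        then show ?thesis by blast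
      qed
    qed
  qed (use cap_pos in auto)
  then show ?thesis by (simp only: es(1))
qed

end

section \<open>Clique, load and matching bounds for an arbitrary feasible schedule\<close>

locale ddp_schedule = ddp +
  fixes m :: nat and A :: "nat \<Rightarrow> event set"
  assumes schedule: "feasible_schedule I m A"
begin

definition drone :: "nat \<Rightarrow> nat" where
  "drone j = (THE d. d \<in> {1..m} \<and> Del j \<in> A d)"

lemma drone:
  assumes "j \<in> dels I"
  shows "drone j \<in> {1..m}" "Del j \<in> A (drone j)"
proof -
  have "\<exists>!d. d \<in> {1..m} \<and> Del j \<in> A d"
    using schedule assms unfolding feasible_schedule_def by blast
  from theI'[OF this] show "drone j \<in> {1..m}" "Del j \<in> A (drone j)"
    unfolding drone_def by blast+
qed

lemma drone_unique:
  assumes "j \<in> dels I" "d \<in> {1..m}" "Del j \<in> A d"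
  shows "d = drone j"
proof -
  have "\<exists>!d. d \<in> {1..m} \<and> Del j \<in> A d"
    using schedule assms unfolding feasible_schedule_def by blast
  then show ?thesis using assms drone[OF assms(1)] by blast
qed

lemma feasible_drone: "d \<in> {1..m} \<Longrightarrow> feasible I (A d)"
  using schedule unfolding feasible_schedule_def by blast

lemma same_drone_not_adj:
  assumes "i \<in> dels I" "j \<in> dels I" "drone i = drone j"
  shows "\<not> adj I i j"
proof -
  have "pairwise (\<lambda>e e'. disjnt (ivl I e) (ivl I e')) (A (drone j))"
    using feasible_drone drone assms unfolding feasible_def by blast
  moreover have "Del i \<in> A (drone j)" "Del j \<in> A (drone j)" using assms drone by metis+
  ultimately show ?thesis unfolding adj_def pairwise_def by blast
qed

lemma omega_le: "omega I \<le> m"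
proof -
  obtain S where S: "S \<subseteq> dels I" "pairwise (adj I) S" "card S = omega I"
    using omega_attained by blast
  have "inj_on drone S"
    using same_drone_not_adj S unfolding inj_on_def pairwise_def by (meson subsetD)
  then have "card S \<le> card {1..m}"
    using drone S by (intro card_inj_on_le[of drone]) auto
  then show ?thesis using S by simp
qed

lemma batch_cost_le:
  assumes "l \<in> nums"
  shows "(\<Sum>j\<in>batch I l. cost I j) \<le> real m * cap I"
proof -
  have "(\<Sum>j\<in>batch I l. cost I j) =
      (\<Sum>d\<in>{1..m}. \<Sum>j\<in>{j\<in>batch I l. drone j = d}. cost I j)"
    using drone(1)[OF batch_dels] by (intro sum.group[symmetric]) auto
  also have "\<dots> \<le> (\<Sum>d\<in>{1..m}. cap I)"
  proof (rule sum_mono)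
    fix d assume d: "d \<in> {1..m}"
    have "{j\<in>batch I l. drone j = d} = {j\<in>batch I l. Del j \<in> A d}"
      using drone drone_unique d batch_dels by blast
    then show "(\<Sum>j\<in>{j\<in>batch I l. drone j = d}. cost I j) \<le> cap I"
      using feasible_batch_cost[OF feasible_drone[OF d] assms] by simp
  qed
  finally show ?thesis by simp
qed

text \<open>The pairs of deliveries in \<open>ext\<close> that share a drone form a matching, and dropping one delivery
  of each pair leaves deliveries on distinct drones.\<close>

lemma zval_le:
  assumes "max_matching I l M" "l \<in> nums"
  shows "zval I l M \<le> m"
proof -
  define N where "N = {(u, v). u \<in> lefts I l \<and> v \<in> rights I l \<and> drone u = drone v}"
  have dels: "lefts I l \<subseteq> dels I" "rights I l \<subseteq> dels I" using ext_subset batch_subset by blast+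
  have inj: "inj_on drone (lefts I l)" "inj_on drone (rights I l)"
    using dels lefts_conflict rights_conflict same_drone_not_adj
    unfolding inj_on_def by (meson subsetD)+
  have fstN: "inj_on fst N" and sndN: "inj_on snd N"
    using inj unfolding N_def inj_on_def by auto
  have "N \<subseteq> bip_edges I l"
  proof (clarsimp simp: N_def)
    fix u v assume u: "u \<in> lefts I l" and v: "v \<in> rights I l" and eq: "drone u = drone v"
    have uv: "u \<in> batch I l" "v \<in> batch I l" "u \<noteq> v"
      using u v ext_subset lefts_rights_disjoint by blast+
    have "disjnt (ivl I (Del u)) (ivl I (Del v))"
      using same_drone_not_adj[of u v] eq uv batch_dels unfolding adj_def by blast
    moreover have "cost I u + cost I v \<le> cap I"
    proof -
      let ?J = "{j\<in>batch I l. Del j \<in> A (drone v)}"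
      have "(\<Sum>j\<in>{u, v}. cost I j) \<le> (\<Sum>j\<in>?J. cost I j)"
      proof (rule sum_mono2)
        show "{u, v} \<subseteq> ?J" using uv drone(2)[OF batch_dels[OF uv(1)]] drone(2)[OF batch_dels[OF uv(2)]] eq by simp
        show "0 \<le> cost I j" if "j \<in> ?J - {u, v}" for j
          using that cost_pos[of j] batch_dels[of j l] by simp
      qed simp
      also have "\<dots> \<le> cap I"
        using feasible_batch_cost[OF feasible_drone assms(2)] drone(1)[OF batch_dels[OF uv(2)]] by blast
      finally show ?thesis using uv by simp
    qed
    ultimately show "(u, v) \<in> bip_edges I l" using u v by (simp add: bip_edges_def)
  qed
  then have "card N \<le> card M"
    using assms(1) fstN sndN unfolding max_matching_def matching_def by blast
  moreover have "card (fst ` N) = card N" by (rule card_image[OF fstN])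
  moreover have "fst ` N \<subseteq> ext I l" by (auto simp: N_def)
  moreover have "card (ext I l - fst ` N) \<le> m"
  proof -
    have "inj_on drone (ext I l - fst ` N)"
    proof (rule inj_onI)
      fix x y assume xy: "x \<in> ext I l - fst ` N" "y \<in> ext I l - fst ` N" "drone x = drone y"
      have "x \<notin> fst ` N" "y \<notin> fst ` N" using xy by auto
      then have "(x, y) \<notin> N" "(y, x) \<notin> N" by (auto simp: image_iff)
      then have "\<not> (x \<in> lefts I l \<and> y \<in> rights I l)" "\<not> (y \<in> lefts I l \<and> x \<in> rights I l)"
        using xy(3) unfolding N_def by simp_all
      then consider "x \<in> lefts I l" "y \<in> lefts I l" | "x \<in> rights I l" "y \<in> rights I l"
        using xy(1,2) by blast
      then show "x = y" using xy(3) inj by cases (auto dest: inj_onD)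
    qed
    then have "card (ext I l - fst ` N) \<le> card {1..m}"
      using drone(1) dels by (intro card_inj_on_le[of drone]) auto
    then show ?thesis by simp
  qed
  moreover have "card (ext I l - fst ` N) = card (ext I l) - card (fst ` N)"
    using \<open>fst ` N \<subseteq> ext I l\<close> finite_subset[of "fst ` N" "ext I l"]
    by (intro card_Diff_subset) simp_all
  ultimately show ?thesis by (simp add: zval_def)
qed

end

section \<open>Coloring a batch\<close>

context ddp
begin

lemma max_matching_exists: "\<exists>M. max_matching I l M"
proof -
  have "matching I l {}" by (simp add: matching_def)
  moreover have "card M < Suc (card (lefts I l \<times> rights I l))" if "matching I l M" for M
  proof -
    have "M \<subseteq> lefts I l \<times> rights I l" using that by (auto simp: matching_def bip_edges_def)
    then have "card M \<le> card (lefts I l \<times> rights I l)" by (intro card_mono) auto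
    then show ?thesis by simp
  qed
  ultimately have "\<exists>M. matching I l M \<and> (\<forall>M'. matching I l M' \<longrightarrow> card M' \<le> card M)"
    using ex_has_greatest_nat[of "matching I l" "{}" card] by blast
  then show ?thesis by (simp add: max_matching_def)
qed

lemma matching_mem: "matching I l M \<Longrightarrow> (u, v) \<in> M \<Longrightarrow> u \<in> lefts I l \<and> v \<in> rights I l"
  by (auto simp: matching_def bip_edges_def)

lemma matching_fst: "matching I l M \<Longrightarrow> (u, v) \<in> M \<Longrightarrow> (u, v') \<in> M \<Longrightarrow> v = v'"
  and matching_snd: "matching I l M \<Longrightarrow> (u, v) \<in> M \<Longrightarrow> (u', v) \<in> M \<Longrightarrow> u = u'"
  unfolding matching_def inj_on_def by force+

lemma matching_not_adj: "matching I l M \<Longrightarrow> (u, v) \<in> M \<Longrightarrow> \<not> adj I u v \<and> \<not> adj I v u"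
  using adj_sym by (auto simp: matching_def bip_edges_def adj_def)

lemma matching_fst_rights: "matching I l M \<Longrightarrow> v \<in> rights I l \<Longrightarrow> v \<notin> fst ` M"
  using matching_mem lefts_rights_disjoint by fastforce

lemma matching_finite: "matching I l M \<Longrightarrow> finite M"
  by (rule finite_subset[of _ "lefts I l \<times> rights I l"]) (auto simp: matching_def bip_edges_def)

text \<open>Deleting the left end of each matched pair leaves one delivery per pair and all
  unmatched ones, so \<open>zval\<close> is the number of colors that \<open>ext\<close> needs. From
  here on the right ends represent their pairs.\<close>

lemma zval_eq:
  assumes "matching I l M"
  shows "zval I l M = card (ext I l - fst ` M)"
proof -
  have "card (fst ` M) = card M"
    using assms by (intro card_image) (simp add: matching_def)
  moreover have "fst ` M \<subseteq> ext I l" using matching_mem[OF assms] by auto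
  ultimately show ?thesis using card_Diff_subset[of "fst ` M" "ext I l"] matching_finite[OF assms]
    by (simp add: zval_def)
qed

text \<open>Colors are handed out through representatives: a matched left is represented by its
  mate, everything else by itself. There are \<open>zval I l M\<close> representatives, and
  enumerating them injectively gives the coloring.\<close>

lemma ext_coloring_exists:
  assumes M: "matching I l M" and k: "zval I l M \<le> k"
  shows "\<exists>col. ext_coloring I l M k col"
proof -
  define E where "E = ext I l - fst ` M"
  define rep where "rep j = (if j \<in> fst ` M then (THE v. (j, v) \<in> M) else j)" for j
  have rep_M: "rep u = v" if "(u, v) \<in> M" for u v
  proof -
    have "(THE w. (u, w) \<in> M) = v" using that matching_fst[OF M] by blast
    then show ?thesis using that by (auto simp: rep_def image_iff)
  qed
  have rep_other: "rep u = u" if "u \<notin> fst ` M" for u using that by (simp add: rep_def)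
  have rep_E: "rep j \<in> E" if "j \<in> ext I l" for j
  proof (cases "j \<in> fst ` M")
    case True
    then obtain v where "(j, v) \<in> M" by auto
    then show ?thesis
      using matching_mem[OF M] rep_M matching_fst_rights[OF M] by (auto simp: E_def)
  qed (use that rep_other in \<open>auto simp: E_def\<close>)
  have "finite E" by (simp add: E_def)
  then obtain h where "bij_betw h E {0..<card E}" using ex_bij_betw_finite_nat by blast
  then have h: "inj_on h E" "\<And>j. j \<in> E \<Longrightarrow> Suc (h j) \<le> k"
  proof -
    assume bij: "bij_betw h E {0..<card E}"
    then have "h j < card E" if "j \<in> E" for j using that bij_betwE by fastforce
    then show "Suc (h j) \<le> k" if "j \<in> E" for j
      using that k zval_eq[OF M] unfolding E_def by fastforce
    show "inj_on h E" using bij by (simp add: bij_betw_def)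
  qed
  \<comment> \<open>\<open>h\<close> counts from 0, whereas colors start at 1.\<close>
  define col where "col j = (if j \<in> ext I l then Some (Suc (h (rep j))) else None)" for j
  have "col u = col v \<longleftrightarrow> u = v \<or> (u, v) \<in> M \<or> (v, u) \<in> M"
    if uv: "u \<in> ext I l" "v \<in> ext I l" for u v
  proof -
    have "col u = col v \<longleftrightarrow> rep u = rep v"
      using uv rep_E h(1) by (auto simp: col_def inj_on_eq_iff)
    also have "\<dots> \<longleftrightarrow> u = v \<or> (u, v) \<in> M \<or> (v, u) \<in> M"
    proof (cases "u \<in> fst ` M"; cases "v \<in> fst ` M")
      assume "u \<in> fst ` M" "v \<in> fst ` M"
      then obtain x y where xy: "(u, x) \<in> M" "(v, y) \<in> M" by auto
      then have "(u, v) \<notin> M" "(v, u) \<notin> M"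
        using matching_mem[OF M] matching_fst_rights[OF M] by force+
      then show ?thesis using rep_M xy matching_snd[OF M] matching_fst[OF M] by metis
    next
      assume "u \<in> fst ` M" "v \<notin> fst ` M"
      then obtain x where x: "(u, x) \<in> M" by auto
      moreover have "(v, u) \<notin> M" using \<open>v \<notin> fst ` M\<close> by force
      ultimately show ?thesis using rep_M rep_other \<open>v \<notin> fst ` M\<close> \<open>u \<in> fst ` M\<close>
          matching_fst[OF M] by metis
    next
      assume "u \<notin> fst ` M" "v \<in> fst ` M"
      then obtain x where x: "(v, x) \<in> M" by auto
      moreover have "(u, v) \<notin> M" using \<open>u \<notin> fst ` M\<close> by force
      ultimately show ?thesis using rep_M rep_other \<open>u \<notin> fst ` M\<close> \<open>v \<in> fst ` M\<close>
          matching_fst[OF M] by metis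
    next
      assume "u \<notin> fst ` M" "v \<notin> fst ` M"
      then have "(u, v) \<notin> M" "(v, u) \<notin> M" by force+
      then show ?thesis using rep_other \<open>u \<notin> fst ` M\<close> \<open>v \<notin> fst ` M\<close> by simp
    qed
    finally show ?thesis .
  qed
  moreover have "dom col = ext I l" by (auto simp: col_def split: if_splits)
  moreover have "ran col \<subseteq> {1..k}"
    using h(2) rep_E by (auto simp: col_def ran_def split: if_splits)
  ultimately show ?thesis unfolding ext_coloring_def by blast
qed

text \<open>The domain is left open so that the property can serve as an invariant while the
  coloring grows.\<close>

definition partial_coloring :: "nat \<Rightarrow> (nat \<rightharpoonup> nat) \<Rightarrow> bool" where
  "partial_coloring k col \<longleftrightarrow> ran col \<subseteq> {1..k} \<and>
     (\<forall>u\<in>dom col. \<forall>v\<in>dom col. adj I u v \<longrightarrow> col u \<noteq> col v)"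

lemma ext_coloring_proper:
  assumes "matching I l M" "ext_coloring I l M k col"
  shows "partial_coloring k col"
  unfolding partial_coloring_def
proof (intro conjI ballI impI)
  show "ran col \<subseteq> {1..k}" using assms(2) unfolding ext_coloring_def by blast
  fix u v assume uv: "u \<in> dom col" "v \<in> dom col" "adj I u v"
  then have "u \<in> ext I l" "v \<in> ext I l" "u \<noteq> v"
    using assms(2) unfolding ext_coloring_def adj_def by blast+
  moreover have "(u, v) \<notin> M" "(v, u) \<notin> M" using matching_not_adj[OF assms(1)] uv by blast+
  ultimately show "col u \<noteq> col v" using assms(2) unfolding ext_coloring_def by blast
qed

lemma rest_order_exists: "\<exists>vs. rest_order I l vs"
proof
  let ?vs = "rev (sort_key (tR I) (sorted_list_of_set (batch I l - ext I l)))"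
  have "sorted_wrt (\<lambda>i j. tR I i \<le> tR I j) (sort_key (tR I) (sorted_list_of_set (batch I l - ext I l)))"
    using sorted_sort_key[of "tR I"] by (simp only: sorted_map)
  then show "rest_order I l ?vs"
    by (simp add: rest_order_def sorted_wrt_rev)
qed

text \<open>When \<open>v\<close> is colored, all its colored neighbours contain its rendezvous time, so
  together with \<open>v\<close> they are a clique.\<close>

lemma color_available:
  assumes l: "1 \<le> l" and v: "v \<in> batch I l - ext I l" and k: "omega I \<le> k"
    and dom: "dom col = ext I l \<union> S" "S \<subseteq> batch I l" "v \<notin> S"
    and late: "\<And>u. u \<in> S \<Longrightarrow> tR I v \<le> tR I u"
  shows "\<exists>c. c \<in> {1..k} \<and> (\<forall>u\<in>batch I l. adj I u v \<longrightarrow> col u \<noteq> Some c)"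
proof -
  define N where "N = {u \<in> dom col. adj I u v}"
  have "dom col \<subseteq> batch I l" using dom ext_subset by blast
  then have sub: "N \<subseteq> dels I" "v \<in> dels I" "finite N"
    using v batch_subset finite_subset[OF _ finite_batch, of N l] unfolding N_def by blast+
  have contains: "tL I u \<le> tR I v \<and> tR I v \<le> tR I u" if "u \<in> N" for u
  proof -
    \<comment> \<open>Neighbors from \<open>S\<close> end late by assumption. Those from
      \<open>ext I l\<close> reach \<open>tA I l\<close>, while \<open>v\<close>, lying outside
      \<open>ext I l\<close>, ends before that point.\<close>
    have "tR I v \<le> tR I u"
    proof (cases "u \<in> S")
      case False
      then have "u \<in> ext I l" using that dom by (auto simp: N_def)
      then have "tA I l \<le> tR I u" "l \<le> nsta I" using ext_iff[OF l] by auto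
      moreover have "tR I v < tA I l" using ext_iff[OF l] v \<open>l \<le> nsta I\<close> by force
      ultimately show ?thesis by simp
    qed (use late in auto)
    moreover have "tL I u \<le> tR I v" using that sub adj_iff[of u v] unfolding N_def by blast
    ultimately show ?thesis by simp
  qed
  have vN: "v \<notin> N" using v dom by (auto simp: N_def)
  have "pairwise (adj I) (insert v N)"
  proof (rule pairwiseI)
    fix x y assume xy: "x \<in> insert v N" "y \<in> insert v N" "x \<noteq> y"
    have "tL I x \<le> tR I v \<and> tR I v \<le> tR I x" "tL I y \<le> tR I v \<and> tR I v \<le> tR I y"
      using contains xy tL_le_tR[OF sub(2)] by auto
    moreover have "x \<in> dels I" "y \<in> dels I" using xy sub by auto
    ultimately show "adj I x y" using xy by (subst adj_iff) auto
  qed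
  then have "Suc (card N) \<le> omega I"
    using clique_le_omega[of "insert v N"] sub vN by simp
  then have "card (the ` col ` N) < k"
    using card_image_le[of N col] card_image_le[of "col ` N" the] sub(3) k by simp
  then have "card (the ` col ` N) < card {1..k}" by simp
  then have "\<not> {1..k} \<subseteq> the ` col ` N"
    using card_mono[of "the ` col ` N" "{1..k}"] sub(3) by auto
  then obtain c where c: "c \<in> {1..k}" "c \<notin> the ` col ` N" by blast
  have "col u \<noteq> Some c" if "u \<in> batch I l" "adj I u v" for u
  proof
    assume "col u = Some c"
    then have "u \<in> N" using that by (auto simp: N_def)
    then show False using c \<open>col u = Some c\<close> by force
  qed
  then show ?thesis using c by blast
qed

text \<open>With at least \<open>omega I\<close> colors a free one exists at each turn, whatever was
  picked before. Since colors on \<open>ext I l\<close> are never overwritten, the pattern of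
  matched pairs fixed there survives.\<close>

lemma always_color_rest:
  assumes l: "1 \<le> l" and k: "omega I \<le> k" and vs: "rest_order I l vs"
    and col: "dom col = ext I l" "partial_coloring k col"
  shows "always (\<lambda>col'. dom col' = batch I l \<and> partial_coloring k col' \<and>
    (\<forall>u\<in>ext I l. col' u = col u)) (for_each vs (color_vertex I l k) col)"
proof -
  define P where "P ys col' \<longleftrightarrow> dom col' = ext I l \<union> set ys \<and> partial_coloring k col' \<and>
    (\<forall>u\<in>ext I l. col' u = col u)" for ys col'
  have "always (P vs) (for_each vs (color_vertex I l k) col)"
  proof (rule always_for_each)
    show "P [] col" using col by (simp add: P_def)
    fix ys x zs col' assume split: "vs = ys @ x # zs" and P: "P ys col'"
    have x: "x \<in> batch I l - ext I l" "x \<notin> set ys" "set ys \<subseteq> batch I l"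
      and late: "\<And>u. u \<in> set ys \<Longrightarrow> tR I x \<le> tR I u"
      using vs split unfolding rest_order_def by (auto simp: sorted_wrt_append)
    show "always (P (ys @ [x])) (color_vertex I l k x col')"
      unfolding color_vertex_def
    proof (intro always_bind_pick)
      show "\<exists>c. c \<in> {1..k} \<and> (\<forall>u\<in>batch I l. adj I u x \<longrightarrow> col' u \<noteq> Some c)"
        using P x late by (intro color_available[OF l x(1) k, of _ "set ys"]) (auto simp: P_def)
    next
      fix c assume c: "c \<in> {1..k} \<and> (\<forall>u\<in>batch I l. adj I u x \<longrightarrow> col' u \<noteq> Some c)"
      have dom: "dom col' \<subseteq> batch I l" using P x ext_subset unfolding P_def by blast
      have xd: "x \<notin> dom col'" using P x unfolding P_def by blast
      have "ran (col'(x \<mapsto> c)) \<subseteq> {1..k}"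
        using P c xd ran_map_upd[of col' x c] unfolding P_def partial_coloring_def domIff by simp
      moreover have "(col'(x \<mapsto> c)) u \<noteq> (col'(x \<mapsto> c)) v"
        if uv: "u \<in> dom (col'(x \<mapsto> c))" "v \<in> dom (col'(x \<mapsto> c))" "adj I u v" for u v
      proof -
        have nc: "col' w \<noteq> Some c" if "w \<in> dom col'" "adj I w x" for w using c that dom by blast
        have "u \<noteq> v" using uv(3) by (simp add: adj_def)
        consider "u = x" "v \<in> dom col'" | "v = x" "u \<in> dom col'" | "u \<noteq> x" "v \<noteq> x"
          using uv \<open>u \<noteq> v\<close> by (auto split: if_splits)
        then show ?thesis
        proof cases
          case 1
          then show ?thesis using nc[of v] adj_sym[of u v] uv \<open>u \<noteq> v\<close> by auto
        next
          case 2
          then show ?thesis using nc[of u] uv \<open>u \<noteq> v\<close> by auto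
        next
          case 3
          then show ?thesis using P uv unfolding P_def partial_coloring_def by auto
        qed
      qed
      ultimately have "partial_coloring k (col'(x \<mapsto> c))"
        unfolding partial_coloring_def by blast
      then show "always (P (ys @ [x])) (ret (col'(x \<mapsto> c)))"
        using P x unfolding P_def by auto
    qed
  qed
  moreover have "ext I l \<union> set vs = batch I l"
    using vs ext_subset unfolding rest_order_def by blast
  ultimately show ?thesis unfolding P_def by simp
qed

lemma partial_coloring_proper:
  "dom col = batch I l \<Longrightarrow> partial_coloring k col \<longleftrightarrow> proper_coloring I l k col"
  unfolding partial_coloring_def proper_coloring_def by simp

text \<open>The last batch has no \<open>ext\<close>, so the greedy procedure may start from the
  empty map; its guarantee together with nonemptiness of its outcomes yields a coloring.\<close>

lemma proper_coloring_exists: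
  assumes "nsta I < l"
  shows "\<exists>col. proper_coloring I l (omega I) col"
proof -
  obtain vs where vs: "rest_order I l vs" using rest_order_exists by blast
  let ?C = "for_each vs (color_vertex I l (omega I)) Map.empty"
  have ne: "?C \<noteq> {}"
    by (intro for_each_nonempty) (simp add: color_vertex_def bind_nonempty pick_nonempty ret_def)
  have "always (\<lambda>col'. dom col' = batch I l \<and> partial_coloring (omega I) col' \<and>
    (\<forall>u\<in>ext I l. col' u = Map.empty u)) ?C"
    using assms vs ext_empty[OF assms]
    by (intro always_color_rest) (auto simp: partial_coloring_def)
  from this ne show ?thesis
    by (rule always_nonempty) (use partial_coloring_proper in blast)
qed

text \<open>All that later arguments use of step (5). The equivalence on \<open>ext\<close> both
  joins matched pairs and separates all other deliveries of \<open>ext\<close>, without reference to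
  the order in which colors were chosen.\<close>

definition valid_coloring :: "nat \<Rightarrow> (nat \<times> nat) set \<Rightarrow> (nat \<rightharpoonup> nat) \<Rightarrow> bool" where
  "valid_coloring l M col \<longleftrightarrow> proper_coloring I l (ncolors I l M) col \<and>
     (\<forall>u\<in>ext I l. \<forall>v\<in>ext I l. col u = col v \<longleftrightarrow> u = v \<or> (u, v) \<in> M \<or> (v, u) \<in> M)"

lemma always_color_batch:
  assumes l: "1 \<le> l" and M: "matching I l M"
  shows "always (valid_coloring l M) (color_batch I l M)"
proof (cases "l \<le> nsta I")
  case False
  then have "ext I l = {}" using ext_empty by simp
  then have "always (valid_coloring l M) (pick (proper_coloring I l (ncolors I l M)))"
    using proper_coloring_exists[of l] False
    by (intro always_pick) (auto simp: valid_coloring_def ncolors_def)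
  then show ?thesis using False by (simp add: color_batch_def)
next
  case True
  let ?k = "ncolors I l M"
  have k: "omega I \<le> ?k" "zval I l M \<le> ?k" using True by (auto simp: ncolors_def)
  have "always (valid_coloring l M) (for_each vs (color_vertex I l ?k) col)"
    if col: "ext_coloring I l M ?k col" and vs: "rest_order I l vs" for col vs
  proof (rule always_mono)
    show "always (\<lambda>col'. dom col' = batch I l \<and> partial_coloring ?k col' \<and>
        (\<forall>u\<in>ext I l. col' u = col u)) (for_each vs (color_vertex I l ?k) col)"
      using col ext_coloring_proper[OF M col]
      by (intro always_color_rest[OF l k(1) vs]) (auto simp: ext_coloring_def)
    show "valid_coloring l M col'" if "dom col' = batch I l \<and> partial_coloring ?k col' \<and>
        (\<forall>u\<in>ext I l. col' u = col u)" for col'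
      using that col partial_coloring_proper[of col' l ?k] unfolding valid_coloring_def ext_coloring_def
      by simp
  qed
  then show ?thesis
    using True ext_coloring_exists[OF M k(2)] rest_order_exists[of l]
    unfolding color_batch_def by (simp add: always_bind_pick)
qed

text \<open>Every valid coloring is a possible outcome, whatever the order in which it was found.\<close>

lemma color_batch_complete:
  assumes M: "matching I l M" and col: "valid_coloring l M col"
  shows "Some col \<in> color_batch I l M"
proof (cases "l \<le> nsta I")
  case False
  then show ?thesis using col by (simp add: color_batch_def valid_coloring_def)
next
  case True
  let ?k = "ncolors I l M"
  obtain vs where vs: "rest_order I l vs" using rest_order_exists by blast
  then have vs_set: "set vs = batch I l - ext I l" "distinct vs" by (auto simp: rest_order_def)
  have dom: "dom col = batch I l" "ran col \<subseteq> {1..?k}"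
    and proper: "\<And>u v. u \<in> batch I l \<Longrightarrow> v \<in> batch I l \<Longrightarrow> adj I u v \<Longrightarrow> col u \<noteq> col v"
    using col by (auto simp: valid_coloring_def proper_coloring_def)
  \<comment> \<open>The intermediate states are restrictions of \<open>col\<close> itself; since
    \<open>col\<close> is proper, each of its colors is a legal pick at its turn.\<close>
  define g where "g ys = col |` (ext I l \<union> set ys)" for ys
  have "Some (g vs) \<in> for_each vs (color_vertex I l ?k) (g [])"
  proof (rule Some_in_for_each)
    fix ys x zs assume split: "vs = ys @ x # zs"
    then have x: "x \<in> batch I l" "x \<notin> ext I l" "x \<notin> set ys" using vs_set by auto
    then obtain c where c: "col x = Some c" using dom by blast
    moreover have "c \<in> {1..?k}" using dom(2) c by (auto simp: ran_def)
    moreover have "g ys u \<noteq> Some c" if "u \<in> batch I l" "adj I u x" for u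
      using proper[OF that(1) x(1) that(2)] c by (auto simp: g_def restrict_map_def)
    moreover have "g (ys @ [x]) = (g ys)(x \<mapsto> c)"
      using c x by (auto simp: g_def restrict_map_def fun_eq_iff)
    ultimately show "Some (g (ys @ [x])) \<in> color_vertex I l ?k x (g ys)"
      unfolding color_vertex_def by (auto simp: Some_in_bind)
  qed
  moreover have "g vs = col"
  proof -
    have "ext I l \<union> set vs = dom col" using vs_set ext_subset dom by blast
    then show ?thesis by (auto simp: g_def restrict_map_def fun_eq_iff domIff)
  qed
  moreover have "ext_coloring I l M ?k (g [])"
  proof -
    have "dom (g []) = ext I l" using dom(1) ext_subset[of l] by (auto simp: g_def)
    moreover have "ran (g []) \<subseteq> {1..?k}"
      using dom(2) by (auto simp: g_def restrict_map_def ran_def split: if_splits)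
    ultimately show ?thesis
      using col unfolding g_def ext_coloring_def valid_coloring_def by (auto simp: restrict_map_def)
  qed
  ultimately show ?thesis
    using True vs unfolding color_batch_def by (auto simp: Some_in_bind)
qed

end

section \<open>Packing a batch\<close>

context ddp
begin

abbreviation load :: "nat set \<Rightarrow> real" where "load X \<equiv> \<Sum>j\<in>X. cost I j"

lemma eps_max_le: "eps_max I \<le> 1 / 2"
  unfolding eps_max_def by (rule min.cobounded1)

lemma cost_bounds:
  assumes "j \<in> dels I"
  shows "eps_min I * cap I \<le> cost I j" "cost I j \<le> Max (cost I ` dels I)"
  using assms cap_pos Min_le[of "cost I ` dels I" "cost I j"] Max_ge[of "cost I ` dels I" "cost I j"]
  by (auto simp: eps_min_def)

text \<open>The capacity left beside the costliest delivery, but never less than half the capacity,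
  because \<open>eps_max\<close> is cut off at 1/2.\<close>

definition threshold :: real where
  "threshold = (1 - eps_max I) * cap I"

text \<open>If a delivery does not fit into a block, then the block is fuller than the threshold or the
  delivery on its own is (the latter is possible only for \<open>eps_max I = 1/2\<close>).\<close>

lemma overflow:
  assumes "j \<in> dels I" "cap I < s + cost I j"
  shows "threshold < s \<or> threshold < cost I j"
proof (cases "eps_max I = 1 / 2")
  case True
  then have "threshold = cap I / 2" by (simp add: threshold_def)
  then show ?thesis using assms(2) by linarith
next
  case False
  then have "eps_max I = Max (cost I ` dels I) / cap I" by (simp add: eps_max_def min_def split: if_splits)
  then have "threshold = cap I - Max (cost I ` dels I)"
    using cap_pos by (simp add: threshold_def field_simps)
  then show ?thesis using assms(2) cost_bounds(2)[OF assms(1)] by linarith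
qed

definition packing :: "nat set \<Rightarrow> nat set set \<Rightarrow> bool" where
  "packing C Bs \<longleftrightarrow> \<Union>Bs = C \<and> {} \<notin> Bs \<and> pairwise disjnt Bs \<and> (\<forall>X\<in>Bs. load X \<le> cap I)"

text \<open>At most one block fails to exceed the threshold. The pairwise form is preserved when a
  block grows or is added, without having to name the exceptional block.\<close>

definition well_filled :: "nat set set \<Rightarrow> bool" where
  "well_filled Bs \<longleftrightarrow> (\<forall>X\<in>Bs. \<forall>Y\<in>Bs. X \<noteq> Y \<longrightarrow> threshold < load X \<or> threshold < load Y)"

lemma packing_finite:
  assumes "packing C Bs" "finite C"
  shows "finite Bs" "\<And>X. X \<in> Bs \<Longrightarrow> finite X"
  using assms finite_UnionD[of Bs] finite_subset[OF Union_upper] unfolding packing_def by auto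

lemma packing_load:
  assumes "packing C Bs" "finite C"
  shows "load C = (\<Sum>X\<in>Bs. load X)"
  using assms packing_finite[OF assms] sum.Union_disjoint[of Bs "cost I"]
  unfolding packing_def pairwise_def disjnt_def by (simp add: o_def)

text \<open>The last three clauses are there for matched pairs: a first delivery founds a single
  block, a delivery that fits into the only block must join it, and no block is ever split.\<close>

lemma always_pack:
  assumes C: "C \<subseteq> dels I" "finite C" and j: "j \<in> dels I" "j \<notin> C"
    and Bs: "packing C Bs" "well_filled Bs"
  shows "always (\<lambda>Bs'. packing (insert j C) Bs' \<and> well_filled Bs' \<and>
      (\<forall>X\<in>Bs. \<exists>Y\<in>Bs'. X \<subseteq> Y) \<and>
      (\<forall>X. Bs = {X} \<longrightarrow> load X + cost I j \<le> cap I \<longrightarrow> Bs' = {insert j X}) \<and>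
      (Bs = {} \<longrightarrow> Bs' = {{j}})) (pack I j Bs)"
proof -
  have B: "\<Union>Bs = C" "{} \<notin> Bs" "pairwise disjnt Bs" "\<And>X. X \<in> Bs \<Longrightarrow> load X \<le> cap I"
    using Bs unfolding packing_def by blast+
  have nin: "j \<notin> X" "finite X" if "X \<in> Bs" for X
    using that B j packing_finite[OF Bs(1) C(2)] by auto
  show ?thesis
  proof (cases "\<exists>X\<in>Bs. cost I j \<le> cap I - load X")
    case True
    have "packing (insert j C) (insert (insert j X) (Bs - {X})) \<and>
        well_filled (insert (insert j X) (Bs - {X})) \<and>
        (\<forall>Z\<in>Bs. \<exists>Y\<in>insert (insert j X) (Bs - {X}). Z \<subseteq> Y)"
      if X: "X \<in> Bs" "cost I j \<le> cap I - load X" for X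
    proof (intro conjI)
      have loadX: "load (insert j X) = cost I j + load X" using nin X by simp
      have "pairwise disjnt (insert (insert j X) (Bs - {X}))"
        unfolding pairwise_def disjnt_def
      proof (intro ballI impI)
        fix Y Z assume YZ: "Y \<in> insert (insert j X) (Bs - {X})" "Z \<in> insert (insert j X) (Bs - {X})" "Y \<noteq> Z"
        have W: "X \<inter> W = {} \<and> j \<notin> W" if "W \<in> Bs" "W \<noteq> X" for W
          using that pairwiseD[OF B(3) X(1), of W] nin(1)[of W] by (auto simp: disjnt_def)
        from YZ consider "Y = insert j X" "Z \<in> Bs" "Z \<noteq> X" | "Z = insert j X" "Y \<in> Bs" "Y \<noteq> X"
          | "Y \<in> Bs" "Z \<in> Bs" by blast
        then show "Y \<inter> Z = {}"
        proof cases
          case 1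
          then show ?thesis using W[of Z] by auto
        next
          case 2
          then show ?thesis using W[of Y] by auto
        next
          case 3
          then show ?thesis using pairwiseD[OF B(3), of Y Z] YZ(3) by (auto simp: disjnt_def)
        qed
      qed
      moreover have "\<Union>(insert (insert j X) (Bs - {X})) = insert j C" using B(1) X by blast
      moreover have "\<forall>Y\<in>insert (insert j X) (Bs - {X}). load Y \<le> cap I"
        using B(4) X(2) loadX by auto
      ultimately show "packing (insert j C) (insert (insert j X) (Bs - {X}))"
        using B(2) unfolding packing_def by simp
      have "load X \<le> load (insert j X)" using loadX cost_pos[OF j(1)] by simp
      then have grow: "threshold < load X \<Longrightarrow> threshold < load (insert j X)" by simp
      have wf: "threshold < load Y \<or> threshold < load Z" if "Y \<in> Bs" "Z \<in> Bs" "Y \<noteq> Z" for Y Z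
        using that Bs(2) unfolding well_filled_def by blast
      show "well_filled (insert (insert j X) (Bs - {X}))"
        unfolding well_filled_def
      proof (intro ballI impI)
        fix Y Z assume YZ: "Y \<in> insert (insert j X) (Bs - {X})" "Z \<in> insert (insert j X) (Bs - {X})" "Y \<noteq> Z"
        then show "threshold < load Y \<or> threshold < load Z"
          using wf[of Y Z] wf[of X Z] wf[of Y X] grow X(1) by blast
      qed
      show "\<forall>Z\<in>Bs. \<exists>Y\<in>insert (insert j X) (Bs - {X}). Z \<subseteq> Y" by blast
    qed
    then show ?thesis using True unfolding pack_def
      by (auto intro!: always_bind_pick)
  next
    case False
    then have full: "cap I < load X + cost I j" if "X \<in> Bs" for X using that by force
    have "packing (insert j C) (insert {j} Bs)"
      using B nin j cost_le_cap[OF j(1)] unfolding packing_def pairwise_def disjnt_def by auto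
    \<comment> \<open>A new block is opened only if \<open>j\<close> overflows every old one, so
      \<open>overflow\<close> settles each pair consisting of \<open>{j}\<close> and an old
      block.\<close>
    moreover have "well_filled (insert {j} Bs)"
      using Bs(2) overflow[OF j(1) full] unfolding well_filled_def by auto
    ultimately show ?thesis using False full unfolding pack_def by auto
  qed
qed

text \<open>After zero or one delivery the state is determined. Hence the second delivery faces
  exactly one block and joins it whenever both fit together; from then on blocks only grow.\<close>

lemma always_pack_class:
  assumes xs: "distinct xs" "set xs \<subseteq> dels I"
  shows "always (\<lambda>Bs. packing (set xs) Bs \<and> well_filled Bs \<and>
      (2 \<le> length xs \<longrightarrow> cost I (xs ! 0) + cost I (xs ! 1) \<le> cap I \<longrightarrow>
        (\<exists>X\<in>Bs. {xs ! 0, xs ! 1} \<subseteq> X))) (for_each xs (pack I) {})"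
proof -
  define P where "P ys Bs \<longleftrightarrow> packing (set ys) Bs \<and> well_filled Bs \<and>
      (length ys = 0 \<longrightarrow> Bs = {}) \<and> (length ys = 1 \<longrightarrow> Bs = {{xs ! 0}}) \<and>
      (2 \<le> length ys \<longrightarrow> cost I (xs ! 0) + cost I (xs ! 1) \<le> cap I \<longrightarrow>
        (\<exists>X\<in>Bs. {xs ! 0, xs ! 1} \<subseteq> X))" for ys Bs
  have "always (P xs) (for_each xs (pack I) {})"
  proof (rule always_for_each)
    show "P [] {}" by (simp add: P_def packing_def well_filled_def)
    fix ys x zs Bs assume split: "xs = ys @ x # zs" and P: "P ys Bs"
    have "always (\<lambda>Bs'. packing (insert x (set ys)) Bs' \<and> well_filled Bs' \<and>
      (\<forall>X\<in>Bs. \<exists>Y\<in>Bs'. X \<subseteq> Y) \<and>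
      (\<forall>X. Bs = {X} \<longrightarrow> load X + cost I x \<le> cap I \<longrightarrow> Bs' = {insert x X}) \<and>
      (Bs = {} \<longrightarrow> Bs' = {{x}})) (pack I x Bs)"
      using P xs split unfolding P_def by (intro always_pack) auto
    then show "always (P (ys @ [x])) (pack I x Bs)"
    proof (rule always_mono)
      fix Bs' assume Bs': "packing (insert x (set ys)) Bs' \<and> well_filled Bs' \<and>
        (\<forall>X\<in>Bs. \<exists>Y\<in>Bs'. X \<subseteq> Y) \<and>
        (\<forall>X. Bs = {X} \<longrightarrow> load X + cost I x \<le> cap I \<longrightarrow> Bs' = {insert x X}) \<and>
        (Bs = {} \<longrightarrow> Bs' = {{x}})"
      consider "length ys = 0" | "length ys = 1" | "2 \<le> length ys" by linarith
      then have "(length (ys @ [x]) = 0 \<longrightarrow> Bs' = {}) \<and> (length (ys @ [x]) = 1 \<longrightarrow> Bs' = {{xs ! 0}}) \<and>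
        (2 \<le> length (ys @ [x]) \<longrightarrow> cost I (xs ! 0) + cost I (xs ! 1) \<le> cap I \<longrightarrow>
        (\<exists>X\<in>Bs'. {xs ! 0, xs ! 1} \<subseteq> X))"
      proof cases
        case 1
        then show ?thesis using Bs' P split by (auto simp: P_def)
      next
        case 2
        then have "xs ! 1 = x" "Bs = {{xs ! 0}}" using P split by (auto simp: P_def nth_append)
        then show ?thesis using Bs' 2 by auto
      next
        case 3
        have "\<exists>X\<in>Bs'. {xs ! 0, xs ! 1} \<subseteq> X" if "cost I (xs ! 0) + cost I (xs ! 1) \<le> cap I"
        proof -
          from P 3 that obtain X where "X \<in> Bs" "{xs ! 0, xs ! 1} \<subseteq> X" unfolding P_def by blast
          then show ?thesis using Bs' by (meson subset_trans)
        qed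
        then show ?thesis using 3 by auto
      qed
      then show "P (ys @ [x]) Bs'" using Bs' unfolding P_def by simp
    qed
  qed
  then show ?thesis by (rule always_mono) (auto simp: P_def)
qed

text \<open>By \<open>uniq\<close> and the matching property a class holds at most one matched pair,
  so placing this pair first meets the requirement for all edges at once.\<close>

lemma pack_order_exists:
  assumes M: "matching I l M" and C: "finite C"
    and uniq: "\<And>u v u' v'. (u, v) \<in> M \<Longrightarrow> (u', v') \<in> M \<Longrightarrow> u \<in> C \<Longrightarrow> u' \<in> C \<Longrightarrow> u = u'"
    and closed: "\<And>u v. (u, v) \<in> M \<Longrightarrow> u \<in> C \<Longrightarrow> v \<in> C"
  shows "\<exists>xs. pack_order M C xs"
proof (cases "\<exists>u v. (u, v) \<in> M \<and> u \<in> C")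
  case False
  then have "pack_order M C (sorted_list_of_set C)" using C by (auto simp: pack_order_def)
  then show ?thesis ..
next
  case True
  then obtain u v where uv: "(u, v) \<in> M" "u \<in> C" by blast
  then have "v \<in> C" "u \<noteq> v" using closed matching_mem[OF M uv(1)] lefts_rights_disjoint by blast+
  have only: "a = u \<and> b = v" if "(a, b) \<in> M" "a \<in> C" for a b
    using uniq[OF that(1) uv(1) that(2) uv(2)] matching_fst[OF M uv(1)] that(1) by blast
  have "pack_order M C (u # v # sorted_list_of_set (C - {u, v}))"
    unfolding pack_order_def
  proof (intro conjI ballI)
    show "set (u # v # sorted_list_of_set (C - {u, v})) = C"
      using C uv(2) \<open>v \<in> C\<close> by auto
    show "case p of (a, b) \<Rightarrow> a \<in> C \<longrightarrow> set (take 2 (u # v # sorted_list_of_set (C - {u, v}))) = {a, b}"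
      if "p \<in> M" for p
      using that only[of "fst p" "snd p"] by (cases p) simp
  qed (use C \<open>u \<noteq> v\<close> in simp)
  then show ?thesis ..
qed

lemma block_load_lower:
  assumes "packing C Bs" "C \<subseteq> dels I" "finite C" and X: "X \<in> Bs"
  shows "eps_min I * cap I \<le> load X"
proof -
  have "X \<noteq> {}" "X \<subseteq> dels I" using assms unfolding packing_def by blast+
  then obtain j where j: "j \<in> X" "j \<in> dels I" by blast
  have "cost I j \<le> load X"
    using j(1) packing_finite(2)[OF assms(1,3) X] cost_pos \<open>X \<subseteq> dels I\<close>
    by (intro member_le_sum) (auto intro!: less_imp_le)
  then show ?thesis using cost_bounds(1)[OF j(2)] by linarith
qed

text \<open>All blocks but one reach the threshold, and even the exceptional one is nonempty and so
  contains a delivery of cost at least \<open>eps_min I * cap I\<close>.\<close>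

lemma well_filled_load:
  assumes "packing C Bs" "well_filled Bs" "C \<subseteq> dels I" "finite C" "C \<noteq> {}"
  shows "real (card Bs - 1) * threshold + eps_min I * cap I \<le> load C"
proof -
  have fin: "finite Bs" using packing_finite(1)[OF assms(1,4)] .
  have ne: "Bs \<noteq> {}" using assms(1,5) unfolding packing_def by blast
  note lower = block_load_lower[OF assms(1,3,4)]
  obtain X where X: "X \<in> Bs" "\<And>Y. Y \<in> Bs \<Longrightarrow> Y \<noteq> X \<Longrightarrow> threshold \<le> load Y"
  proof (cases "\<exists>X\<in>Bs. load X \<le> threshold")
    case True
    then obtain X where "X \<in> Bs" "load X \<le> threshold" by blast
    then show ?thesis using assms(2) unfolding well_filled_def by (intro that[of X]) force+
  next
    case False
    from ne obtain X where "X \<in> Bs" by blast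
    then show ?thesis using False by (intro that[of X]) (auto simp: not_le intro: less_imp_le)
  qed
  have "real (card Bs - 1) * threshold = (\<Sum>Y\<in>Bs - {X}. threshold)"
    using X(1) fin by simp
  also have "\<dots> \<le> (\<Sum>Y\<in>Bs - {X}. load Y)" using X(2) by (intro sum_mono) auto
  also have "\<dots> = load C - load X"
    using packing_load[OF assms(1,4)] sum.remove[OF fin X(1), of load] by simp
  finally show ?thesis using lower[OF X(1)] by simp
qed

text \<open>A cruder count that ignores the threshold. It is the stronger one when every delivery
  costs more than half the capacity.\<close>

lemma packing_min_load:
  assumes "packing C Bs" "C \<subseteq> dels I" "finite C"
  shows "real (card Bs) * (eps_min I * cap I) \<le> load C"
proof -
  note lower = block_load_lower[OF assms(1,2,3)]
  have "real (card Bs) * (eps_min I * cap I) = (\<Sum>X\<in>Bs. eps_min I * cap I)" by simp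
  also have "\<dots> \<le> (\<Sum>X\<in>Bs. load X)" using lower by (rule sum_mono)
  also have "\<dots> = load C" using packing_load[OF assms(1,3)] by simp
  finally show ?thesis .
qed

text \<open>The bounds compare with every feasible schedule rather than with \<open>OPT_SC\<close>:
  that a feasible schedule exists at all is only learned from the algorithm's own result.\<close>

definition good_blocks :: "nat \<Rightarrow> nat set set \<Rightarrow> nat \<Rightarrow> bool" where
  "good_blocks l Bs z \<longleftrightarrow> packing (batch I l) Bs \<and>
     (\<forall>X\<in>Bs. \<forall>i\<in>X. \<forall>j\<in>X. \<not> adj I i j) \<and>
     card {X \<in> Bs. X \<inter> ext I l \<noteq> {}} \<le> z \<and>
     (\<forall>m A. feasible_schedule I m A \<longrightarrow> z \<le> m \<and>
       real (card Bs) \<le> (2 + (eps_max I - eps_min I) / (1 - eps_max I)) * real m)"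

text \<open>Here \<open>k\<close> counts blocks, \<open>q\<close> nonempty classes and
  \<open>m\<close> drones, with \<open>a\<close> = \<open>eps_max I\<close> and \<open>e\<close> =
  \<open>eps_min I\<close>. If \<open>e <= 1 - a\<close>, the coefficient of \<open>q\<close> is
  nonpositive and \<open>q\<close> may be replaced by \<open>m\<close>, giving
  \<open>k * (1 - a) <= (2 - a - e) * m\<close>. Otherwise \<open>e\<close> exceeds 1/2, so
  \<open>a = 1/2\<close> and the claim reads \<open>k <= (3 - 2 * e) * m\<close>; it follows from
  \<open>k <= m / e\<close> because \<open>(2 * e - 1) * (1 - e)\<close> is nonnegative.\<close>

lemma blocks_bound:
  fixes k m q :: real and a e :: real
  assumes "0 < e" "a \<le> 1 / 2" "e \<le> 1" "q \<le> m" "0 \<le> m"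
    and "e \<le> 1 / 2 \<or> a = 1 / 2"
    and "k * (1 - a) + q * (e - (1 - a)) \<le> m" "k * e \<le> m"
  shows "k \<le> (2 + (a - e) / (1 - a)) * m"
proof -
  have "k * (1 - a) \<le> (2 - a - e) * m"
  proof (cases "e \<le> 1 - a")
    case True
    then have "q * (1 - a - e) \<le> m * (1 - a - e)" using assms by (intro mult_right_mono) auto
    then show ?thesis using assms(7) by (simp add: algebra_simps)
  next
    case False
    then have e: "1 / 2 < e" "a = 1 / 2" using assms by auto
    have "k \<le> m / e" using assms by (simp add: field_simps)
    also have "\<dots> \<le> (3 - 2 * e) * m"
    proof -
      have "0 \<le> (2 * e - 1) * (1 - e)" using e assms by (intro mult_nonneg_nonneg) auto
      then have "1 \<le> (3 - 2 * e) * e" by (simp add: algebra_simps)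
      then have "1 * m \<le> (3 - 2 * e) * e * m" using assms by (intro mult_right_mono) auto
      then show ?thesis using assms by (simp add: field_simps)
    qed
    finally show ?thesis unfolding e(2) by (simp add: algebra_simps)
  qed
  moreover have "(2 + (a - e) / (1 - a)) * m = (2 - a - e) * m / (1 - a)"
    using assms by (simp add: field_simps)
  ultimately show ?thesis using assms by (simp add: field_simps)
qed

text \<open>The third fact separates the two regimes of the numerical bound: if the cheapest
  delivery exceeds half the capacity, so does the costliest one, and the minimum in
  \<open>eps_max\<close> is 1/2.\<close>

lemma eps_min_pos: "0 < eps_min I" and eps_min_le_1: "eps_min I \<le> 1"
  and eps_min_le_half: "eps_min I \<le> 1 / 2 \<or> eps_max I = 1 / 2"
proof -
  have fin: "finite (cost I ` dels I)" "cost I ` dels I \<noteq> {}" using ndel_pos by auto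
  then have "Min (cost I ` dels I) \<in> cost I ` dels I" by (rule Min_in)
  then obtain j where j: "j \<in> dels I" "Min (cost I ` dels I) = cost I j" by auto
  show "0 < eps_min I" "eps_min I \<le> 1"
    using j cost_pos cost_le_cap cap_pos by (auto simp: eps_min_def)
  have "cost I j \<le> Max (cost I ` dels I)" using cost_bounds(2)[OF j(1)] .
  then have "cost I j / cap I \<le> Max (cost I ` dels I) / cap I" using cap_pos by (simp add: divide_right_mono)
  then show "eps_min I \<le> 1 / 2 \<or> eps_max I = 1 / 2"
    unfolding eps_min_def eps_max_def j(2) by linarith
qed

section \<open>From the color classes to a whole batch\<close>

definition color_class :: "nat \<Rightarrow> (nat \<rightharpoonup> nat) \<Rightarrow> nat \<Rightarrow> nat set" where
  "color_class l col c = {j \<in> batch I l. col j = Some c}"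

text \<open>Two different lefts of equal color would have to be joined by a matching edge, but every
  edge runs from a left to a right.\<close>

lemma color_class_matched:
  assumes M: "matching I l M" and col: "valid_coloring l M col"
    and uv: "(u, v) \<in> M" "u \<in> color_class l col c"
  shows "v \<in> color_class l col c"
    "(u', v') \<in> M \<Longrightarrow> u' \<in> color_class l col c \<Longrightarrow> u' = u"
proof -
  have uv': "u \<in> ext I l" "v \<in> ext I l" "v \<in> batch I l"
    using matching_mem[OF M uv(1)] ext_subset by blast+
  then have "col u = col v" using col uv(1) unfolding valid_coloring_def by blast
  then show "v \<in> color_class l col c" using uv(2) uv' by (simp add: color_class_def)
  assume u': "(u', v') \<in> M" "u' \<in> color_class l col c"
  then have "col u' = col u" using uv(2) by (simp add: color_class_def)
  then have "u' = u \<or> (u', u) \<in> M \<or> (u, u') \<in> M"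
    using col uv' matching_mem[OF M u'(1)] unfolding valid_coloring_def by blast
  then show "u' = u"
    using matching_mem[OF M] u'(1) uv(1) lefts_rights_disjoint by blast
qed

lemma always_pack_color:
  fixes c :: nat
  assumes l: "1 \<le> l" and M: "matching I l M" and col: "valid_coloring l M col"
  defines "C \<equiv> color_class l col c"
  shows "always (\<lambda>Bs. packing C Bs \<and> well_filled Bs \<and> (\<forall>(u, v)\<in>M. u \<in> C \<longrightarrow> (\<exists>X\<in>Bs. {u, v} \<subseteq> X)))
    (pick (pack_order M C) \<triangleright> (\<lambda>xs. for_each xs (pack I) {}))"
proof (rule always_bind_pick)
  show "\<exists>xs. pack_order M C xs"
  proof (rule pack_order_exists[OF M])
    show "finite C" by (simp add: C_def color_class_def)
    show "u = u'" if "(u, v) \<in> M" "(u', v') \<in> M" "u \<in> C" "u' \<in> C" for u v u' v'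
      using color_class_matched(2)[OF M col that(1), of c u' v'] that unfolding C_def by simp
    show "v \<in> C" if "(u, v) \<in> M" "u \<in> C" for u v
      using color_class_matched(1)[OF M col that(1), of c] that unfolding C_def by simp
  qed
  fix xs assume xs: "pack_order M C xs"
  then have set: "set xs = C" "distinct xs" by (auto simp: pack_order_def)
  have "C \<subseteq> dels I" using batch_dels by (auto simp: C_def color_class_def)
  then have "always (\<lambda>Bs. packing C Bs \<and> well_filled Bs \<and>
      (2 \<le> length xs \<longrightarrow> cost I (xs ! 0) + cost I (xs ! 1) \<le> cap I \<longrightarrow>
        (\<exists>X\<in>Bs. {xs ! 0, xs ! 1} \<subseteq> X))) (for_each xs (pack I) {})"
    using always_pack_class[of xs] set by simp
  then show "always (\<lambda>Bs. packing C Bs \<and> well_filled Bs \<and>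
      (\<forall>(u, v)\<in>M. u \<in> C \<longrightarrow> (\<exists>X\<in>Bs. {u, v} \<subseteq> X))) (for_each xs (pack I) {})"
  proof (rule always_mono)
    fix Bs assume Bs: "packing C Bs \<and> well_filled Bs \<and>
      (2 \<le> length xs \<longrightarrow> cost I (xs ! 0) + cost I (xs ! 1) \<le> cap I \<longrightarrow>
        (\<exists>X\<in>Bs. {xs ! 0, xs ! 1} \<subseteq> X))"
    have "\<exists>X\<in>Bs. {u, v} \<subseteq> X" if uv: "(u, v) \<in> M" "u \<in> C" for u v
    proof -
      have take: "set (take 2 xs) = {u, v}" using xs uv unfolding pack_order_def by blast
      have "u \<noteq> v" using matching_mem[OF M uv(1)] lefts_rights_disjoint by blast
      \<comment> \<open>Two distinct members in \<open>take 2 xs\<close> force a second entry, so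
        the pair occupies positions 0 and 1, in one order or the other.\<close>
      then have len: "2 \<le> length xs"
        using take card_length[of "take 2 xs"] by (simp add: min_def split: if_splits)
      then have "take 2 xs = [xs ! 0, xs ! 1]" by (auto simp: numeral_2_eq_2 Suc_le_length_iff)
      then have eq: "{xs ! 0, xs ! 1} = {u, v}" using take by simp
      have "cost I u + cost I v \<le> cap I"
        using M uv(1) bip_edges_iff[OF l, of u v] unfolding matching_def by blast
      then have "cost I (xs ! 0) + cost I (xs ! 1) \<le> cap I"
        using eq by (auto simp: doubleton_eq_iff)
      then show ?thesis using Bs len unfolding eq by blast
    qed
    then show "packing C Bs \<and> well_filled Bs \<and> (\<forall>(u, v)\<in>M. u \<in> C \<longrightarrow> (\<exists>X\<in>Bs. {u, v} \<subseteq> X))"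
      using Bs by blast
  qed
qed

text \<open>\<open>q\<close> is the number of nonempty classes, and the inequality is the sum over
  them of \<open>(card - 1) * threshold + eps_min I * cap I\<close>. Empty classes leave
  \<open>q\<close> unchanged, so it is only bounded by the number of colors.\<close>

lemma always_pack_batch:
  assumes l: "1 \<le> l" and M: "matching I l M" and col: "valid_coloring l M col"
  shows "always (\<lambda>Bs. packing (batch I l) Bs \<and> (\<forall>X\<in>Bs. \<exists>b. \<forall>i\<in>X. col i = Some b) \<and>
      (\<exists>q \<le> ncolors I l M. real (card Bs) * threshold + real q * (eps_min I * cap I - threshold)
          \<le> load (batch I l)) \<and>
      (\<forall>(u, v)\<in>M. \<exists>X\<in>Bs. {u, v} \<subseteq> X)) (pack_batch I l M col)"
proof -
  let ?C = "color_class l col" and ?k = "ncolors I l M"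
  define U where "U cs = (\<Union>c\<in>set cs. ?C c)" for cs
  have finU: "finite (U cs)" "U cs \<subseteq> dels I" for cs
    using batch_dels by (auto simp: U_def color_class_def)
  define P where "P cs Bs \<longleftrightarrow> packing (U cs) Bs \<and> (\<forall>X\<in>Bs. \<exists>b. \<forall>i\<in>X. col i = Some b) \<and>
      (\<exists>q \<le> length cs. real (card Bs) * threshold + real q * (eps_min I * cap I - threshold)
          \<le> load (U cs)) \<and>
      (\<forall>(u, v)\<in>M. u \<in> U cs \<longrightarrow> (\<exists>X\<in>Bs. {u, v} \<subseteq> X))" for cs Bs
  have "always (P [1..<?k + 1]) (pack_batch I l M col)"
    unfolding pack_batch_def
  proof (rule always_for_each)
    show "P [] {}" by (simp add: P_def packing_def U_def)
    fix cs c ds Bs assume split: "[1..<?k + 1] = cs @ c # ds" and P: "P cs Bs"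
    have "distinct (cs @ c # ds)" unfolding split[symmetric] by simp
    then have c: "c \<notin> set cs" by simp
    then have disj: "U cs \<inter> ?C c = {}" by (auto simp: U_def color_class_def)
    have U: "U (cs @ [c]) = U cs \<union> ?C c" by (auto simp: U_def)
    have "always (\<lambda>Bs'. packing (?C c) Bs' \<and> well_filled Bs' \<and>
        (\<forall>(u, v)\<in>M. u \<in> ?C c \<longrightarrow> (\<exists>X\<in>Bs'. {u, v} \<subseteq> X)))
      (pick (pack_order M (?C c)) \<triangleright> (\<lambda>xs. for_each xs (pack I) {}))"
      by (rule always_pack_color[OF l M col])
    then have "always (P (cs @ [c])) (pick (pack_order M (?C c)) \<triangleright> (\<lambda>xs. for_each xs (pack I) {}) \<triangleright>
        (\<lambda>Bs'. ret (Bs \<union> Bs')))"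
    proof (rule always_bind)
      fix Bs' assume Bs': "packing (?C c) Bs' \<and> well_filled Bs' \<and>
        (\<forall>(u, v)\<in>M. u \<in> ?C c \<longrightarrow> (\<exists>X\<in>Bs'. {u, v} \<subseteq> X))"
      have fin: "finite (?C c)" "?C c \<subseteq> dels I" using batch_dels by (auto simp: color_class_def)
      have PB: "packing (U cs) Bs" and PB': "packing (?C c) Bs'"
        using P Bs' unfolding P_def by simp_all
      have finB: "finite Bs" "finite Bs'"
        using packing_finite(1)[OF PB finU(1)] packing_finite(1)[OF PB' fin(1)] .
      have cross: "X \<inter> Y = {}" if "X \<in> Bs" "Y \<in> Bs'" for X Y
      proof -
        have "X \<subseteq> U cs" "Y \<subseteq> ?C c" using that PB PB' unfolding packing_def by blast+
        then show ?thesis using disj by blast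
      qed
      have "packing (U (cs @ [c])) (Bs \<union> Bs')"
        unfolding packing_def
      proof (intro conjI)
        show "\<Union>(Bs \<union> Bs') = U (cs @ [c])" using PB PB' unfolding packing_def U by simp
        show "pairwise disjnt (Bs \<union> Bs')"
          using PB PB' cross unfolding packing_def disjnt_def pairwise_def by (metis Int_commute Un_iff)
      qed (use PB PB' in \<open>auto simp: packing_def\<close>)
      moreover have "\<forall>X\<in>Bs \<union> Bs'. \<exists>b. \<forall>i\<in>X. col i = Some b"
      proof -
        have "col i = Some c" if "X \<in> Bs'" "i \<in> X" for X i
        proof -
          have "i \<in> ?C c" using that PB' unfolding packing_def by blast
          then show ?thesis by (simp add: color_class_def)
        qed
        then show ?thesis using P unfolding P_def by blast
      qed
      moreover have "\<exists>q \<le> length (cs @ [c]). real (card (Bs \<union> Bs')) * threshold +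
          real q * (eps_min I * cap I - threshold) \<le> load (U (cs @ [c]))"
      proof -
        from P obtain q where q: "q \<le> length cs"
          "real (card Bs) * threshold + real q * (eps_min I * cap I - threshold) \<le> load (U cs)"
          unfolding P_def by blast
        have "{} \<notin> Bs" using PB by (simp add: packing_def)
        \<comment> \<open>A block common to both sides would be disjoint from itself and hence
          empty.\<close>
        then have "Bs \<inter> Bs' = {}" using cross by (metis Int_absorb disjoint_iff)
        then have card: "card (Bs \<union> Bs') = card Bs + card Bs'" using finB by (intro card_Un_disjoint)
        have load: "load (U (cs @ [c])) = load (U cs) + load (?C c)"
          unfolding U using finU fin disj by (intro sum.union_disjoint)
        show ?thesis
        proof (cases "?C c = {}")
          case True
          then have "\<Union>Bs' = {}" "{} \<notin> Bs'" using PB' by (simp_all add: packing_def)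
          then have "Bs' = {}" by (metis Union_upper equals0I subset_empty)
          then show ?thesis using True q load by (intro exI[of _ q]) (auto simp: card)
        next
          case False
          then have "Bs' \<noteq> {}" using PB' by (auto simp: packing_def)
          then have "real (card Bs' - 1) = real (card Bs') - 1" using finB by (simp add: card_gt_0_iff of_nat_diff Suc_leI)
          moreover have "real (card Bs' - 1) * threshold + eps_min I * cap I \<le> load (?C c)"
            using Bs' False fin by (intro well_filled_load[OF PB']) simp_all
          ultimately show ?thesis using q load
            by (intro exI[of _ "Suc q"]) (simp add: card algebra_simps)
        qed
      qed
      moreover have "\<forall>(u, v)\<in>M. u \<in> U (cs @ [c]) \<longrightarrow> (\<exists>X\<in>Bs \<union> Bs'. {u, v} \<subseteq> X)"
      proof clarify
        fix u v assume uv: "(u, v) \<in> M" "u \<in> U (cs @ [c])"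
        have 1: "\<forall>(u, v)\<in>M. u \<in> U cs \<longrightarrow> (\<exists>X\<in>Bs. {u, v} \<subseteq> X)"
          using P unfolding P_def by (elim conjE)
        have 2: "\<forall>(u, v)\<in>M. u \<in> ?C c \<longrightarrow> (\<exists>X\<in>Bs'. {u, v} \<subseteq> X)"
          using Bs' by (elim conjE)
        from uv(2) have "u \<in> U cs \<or> u \<in> ?C c" by (simp add: U)
        then show "\<exists>X\<in>Bs \<union> Bs'. {u, v} \<subseteq> X"
          using bspec[OF 1 uv(1)] bspec[OF 2 uv(1)] by (simp add: bex_Un) argo
      qed
      ultimately show "always (P (cs @ [c])) (ret (Bs \<union> Bs'))"
        unfolding P_def always_ret by (intro conjI)
    qed
    then show "always (P (cs @ [c])) (pick (pack_order M {j \<in> batch I l. col j = Some c}) \<triangleright>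
        (\<lambda>xs. for_each xs (pack I) {}) \<triangleright> (\<lambda>Bs'. ret (Bs \<union> Bs')))"
      unfolding color_class_def .
  qed
  moreover have "U [1..<?k + 1] = batch I l"
  proof -
    have "\<exists>c\<in>{1..?k}. col j = Some c" if "j \<in> batch I l" for j
      using that col unfolding valid_coloring_def proper_coloring_def ran_def by blast
    moreover have "set [1..<?k + 1] = {1..?k}" by auto
    ultimately show ?thesis unfolding U_def color_class_def by auto
  qed
  moreover have mem: "u \<in> batch I l" if "(u, v) \<in> M" for u v
    using matching_mem[OF M that] ext_subset by blast
  ultimately show ?thesis
  proof (elim always_mono)
    fix Bs assume U: "U [1..<?k + 1] = batch I l" and P: "P [1..<?k + 1] Bs"
    have pairs: "\<forall>(u, v)\<in>M. u \<in> batch I l \<longrightarrow> (\<exists>X\<in>Bs. {u, v} \<subseteq> X)"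
      using P unfolding P_def U by (elim conjE)
    have "\<exists>X\<in>Bs. {u, v} \<subseteq> X" if "(u, v) \<in> M" for u v
      using bspec[OF pairs that] mem[OF that] by simp
    then have "\<forall>(u, v)\<in>M. \<exists>X\<in>Bs. {u, v} \<subseteq> X" by blast
    moreover have len: "length [1..<?k + 1] = ?k" by (simp del: upt_Suc)
    ultimately show "packing (batch I l) Bs \<and> (\<forall>X\<in>Bs. \<exists>b. \<forall>i\<in>X. col i = Some b) \<and>
      (\<exists>q \<le> ncolors I l M. real (card Bs) * threshold + real q * (eps_min I * cap I - threshold)
          \<le> load (batch I l)) \<and>
      (\<forall>(u, v)\<in>M. \<exists>X\<in>Bs. {u, v} \<subseteq> X)"
      using P unfolding P_def U len by (elim conjE, intro conjI)
  qed
qed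

lemma always_process_batch:
  assumes l: "l \<in> nums"
  shows "always (\<lambda>(Bs, z). good_blocks l Bs z) (process_batch I l)"
  unfolding process_batch_def
proof (rule always_bind_pick)
  have l1: "1 \<le> l" using l by simp
  show "\<exists>M. max_matching I l M" by (rule max_matching_exists)
  fix M assume max: "max_matching I l M"
  then have M: "matching I l M" by (simp add: max_matching_def)
  show "always (\<lambda>(Bs, z). good_blocks l Bs z)
    (color_batch I l M \<triangleright> (\<lambda>col. pack_batch I l M col \<triangleright> (\<lambda>Bs. ret (Bs, zval I l M))))"
  proof (rule always_bind[OF always_color_batch[OF l1 M]])
    fix col assume col: "valid_coloring l M col"
    show "always (\<lambda>(Bs, z). good_blocks l Bs z) (pack_batch I l M col \<triangleright> (\<lambda>Bs. ret (Bs, zval I l M)))"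
    proof (rule always_bind[OF always_pack_batch[OF l1 M col]])
    fix Bs assume Bs: "packing (batch I l) Bs \<and> (\<forall>X\<in>Bs. \<exists>b. \<forall>i\<in>X. col i = Some b) \<and>
      (\<exists>q \<le> ncolors I l M. real (card Bs) * threshold + real q * (eps_min I * cap I - threshold)
          \<le> load (batch I l)) \<and>
      (\<forall>(u, v)\<in>M. \<exists>X\<in>Bs. {u, v} \<subseteq> X)"
    have mem: "i \<in> batch I l" if "X \<in> Bs" "i \<in> X" for X i
      using Bs that unfolding packing_def by blast
    have "\<not> adj I i j" if X: "X \<in> Bs" "i \<in> X" "j \<in> X" for X i j
    proof -
      have "\<exists>b. \<forall>i\<in>X. col i = Some b" using Bs X(1) by blast
      then have "col i = col j" using X(2,3) by force
      moreover have "i \<in> batch I l" "j \<in> batch I l" using mem X by blast+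
      ultimately show ?thesis using col unfolding valid_coloring_def proper_coloring_def by blast
    qed
    moreover have "card {X \<in> Bs. X \<inter> ext I l \<noteq> {}} \<le> zval I l M"
    proof -
      have "\<exists>X\<in>Bs. j \<in> X" if "j \<in> batch I l" for j using Bs that unfolding packing_def by blast
      then obtain b where b: "\<And>j. j \<in> batch I l \<Longrightarrow> b j \<in> Bs \<and> j \<in> b j" by metis
      have uniq: "X = b j" if "X \<in> Bs" "j \<in> X" for X j
        using that b[OF mem[OF that]] Bs unfolding packing_def pairwise_def disjnt_def by blast
      \<comment> \<open>A block with a matched left also contains its mate, so the representatives
        counted by \<open>zval_eq\<close> hit every block that meets \<open>ext I l\<close>.\<close>
      have "{X \<in> Bs. X \<inter> ext I l \<noteq> {}} \<subseteq> b ` (ext I l - fst ` M)"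
      proof
        fix X assume "X \<in> {X \<in> Bs. X \<inter> ext I l \<noteq> {}}"
        then obtain j where X: "X \<in> Bs" "j \<in> X" "j \<in> ext I l" by blast
        show "X \<in> b ` (ext I l - fst ` M)"
        proof (cases "j \<in> fst ` M")
          case True
          then obtain v where v: "(j, v) \<in> M" by auto
          then obtain Y where Y: "Y \<in> Bs" "{j, v} \<subseteq> Y" using Bs by blast
          then have "X = Y" using uniq[of X j] uniq[of Y j] X by simp
          then have "X = b v" using Y uniq[of X v] by simp
          moreover have "v \<in> ext I l - fst ` M"
            using matching_mem[OF M v] matching_fst_rights[OF M] by blast
          ultimately show ?thesis by blast
        next
          case False
          then show ?thesis using uniq X by blast
        qed
      qed
      then have "card {X \<in> Bs. X \<inter> ext I l \<noteq> {}} \<le> card (b ` (ext I l - fst ` M))"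
        by (intro card_mono) auto
      also have "\<dots> \<le> card (ext I l - fst ` M)" by (intro card_image_le) simp
      finally show ?thesis using zval_eq[OF M] by simp
    qed
    moreover have "zval I l M \<le> m \<and>
       real (card Bs) \<le> (2 + (eps_max I - eps_min I) / (1 - eps_max I)) * real m"
      if "feasible_schedule I m A" for m A
    proof -
      interpret ddp_schedule I m A by unfold_locales fact
      have z: "zval I l M \<le> m" using zval_le[OF max l] .
      then have nc: "ncolors I l M \<le> m" using omega_le by (simp add: ncolors_def)
      obtain q where q: "q \<le> ncolors I l M"
        "real (card Bs) * threshold + real q * (eps_min I * cap I - threshold) \<le> load (batch I l)"
        using Bs by blast
      have "real (card Bs) * (eps_min I * cap I) \<le> load (batch I l)"
        using Bs batch_subset by (intro packing_min_load) auto
      then have "(real (card Bs) * eps_min I) * cap I \<le> real m * cap I"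
        using batch_cost_le[OF l] by (simp add: algebra_simps)
      then have 1: "real (card Bs) * eps_min I \<le> real m" using cap_pos by simp
      have "(real (card Bs) * (1 - eps_max I) + real q * (eps_min I - (1 - eps_max I))) * cap I
          \<le> real m * cap I"
        using q(2) batch_cost_le[OF l] unfolding threshold_def by (simp add: algebra_simps)
      then have 2: "real (card Bs) * (1 - eps_max I) + real q * (eps_min I - (1 - eps_max I)) \<le> real m"
        using cap_pos by simp
      have "real (card Bs) \<le> (2 + (eps_max I - eps_min I) / (1 - eps_max I)) * real m"
        using q(1) nc by (intro blocks_bound[OF eps_min_pos eps_max_le eps_min_le_1 _ _ eps_min_le_half 2 1]) auto
      then show ?thesis using z by simp
    qed
    ultimately show "always (\<lambda>(Bs, z). good_blocks l Bs z) (ret (Bs, zval I l M))"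
      using Bs unfolding good_blocks_def always_ret split by blast
    qed
  qed
qed

end

section \<open>Assigning the blocks\<close>

text \<open>Translates the prefixes occurring in loop invariants into statements about all batches
  with a smaller number.\<close>

lemma upt_eq_append_Cons:
  assumes "[a..<b] = ys @ x # zs"
  shows "ys = [a..<x]" "a \<le> x" "x < b"
proof -
  have len: "length ys < b - a" using arg_cong[OF assms, of length] by simp
  then have "[a..<b] ! length ys = a + length ys" by simp
  then have x: "x = a + length ys" unfolding assms by simp
  then show "a \<le> x" "x < b" using len by simp_all
  have "ys = take (length ys) [a..<b]" unfolding assms by simp
  then show "ys = [a..<x]" using x len by (simp add: take_upt)
qed

section \<open>The course of a single drone\<close>

context ddp
begin

lemma battery_ok_append:
  "(\<And>j. j \<in> set xs \<Longrightarrow> 0 \<le> cost I j) \<Longrightarrow> (\<Sum>j\<leftarrow>xs. cost I j) \<le> b \<Longrightarrow>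
    battery_ok I (b - (\<Sum>j\<leftarrow>xs. cost I j)) es \<Longrightarrow> battery_ok I b (map Del xs @ es)"
proof (induction xs arbitrary: b)
  case (Cons x xs)
  have "0 \<le> (\<Sum>j\<leftarrow>xs. cost I j)" using Cons.prems(1) by (intro sum_list_nonneg) auto
  then show ?case using Cons by (simp add: algebra_simps)
qed simp

text \<open>One drone seen in isolation: blocks, colors and the other drones are forgotten, and only
  what it serves in each batch matters for feasibility.\<close>

definition itinerary :: "(nat \<Rightarrow> nat set) \<Rightarrow> event set" where
  "itinerary S = (\<Union>l\<in>nums. Del ` S l \<union> (if l \<le> nsta I \<and> S l \<inter> ext I l = {} then {Swap l} else {}))"

lemma itinerary_cases:
  "e \<in> itinerary S \<Longrightarrow> (\<exists>l j. l \<in> nums \<and> j \<in> S l \<and> e = Del j) \<or>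
      (\<exists>l. l \<in> stas I \<and> S l \<inter> ext I l = {} \<and> e = Swap l)"
  unfolding itinerary_def by (auto split: if_splits)

text \<open>Batches two or more apart are separated by a whole swapping interval. For consecutive
  ones, \<open>gap\<close> forces the earlier deliveries out of \<open>ext\<close>, so they end
  before the station between the two batches opens.\<close>

lemma itinerary_disjnt:
  assumes sub: "\<And>l. l \<in> nums \<Longrightarrow> S l \<subseteq> batch I l"
    and indep: "\<And>l i j. l \<in> nums \<Longrightarrow> i \<in> S l \<Longrightarrow> j \<in> S l \<Longrightarrow> \<not> adj I i j"
    and gap: "\<And>l. l \<in> stas I \<Longrightarrow> S l \<inter> ext I l \<noteq> {} \<Longrightarrow> S (l + 1) = {}"
  shows "pairwise (\<lambda>e e'. disjnt (ivl I e) (ivl I e')) (itinerary S)"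
proof (rule pairwiseI)
  have before: "disjnt (ivl I (Del i)) (ivl I (Del j))"
    if "i \<in> S l" "j \<in> S k" "l \<in> nums" "k \<in> nums" "l < k" for i j l k
  proof -
    have b: "i \<in> batch I l" "j \<in> batch I k" using sub that by blast+
    have "tR I i < tL I j"
    proof (cases "k = l + 1")
      case True
      then have "i \<notin> ext I l" using gap[of l] that by auto
      then have "tR I i < tA I l" using ext_iff[of l i] b that by force
      moreover have "tA I l < tD I l" using tA_less_tD[of l] that by auto
      moreover have "tD I l < tL I j" using batch_start[OF b(2), of l] that by auto
      ultimately show ?thesis by simp
    next
      case False
      then have "tR I i < tA I (l + 1)" using batch_end[OF b(1), of "l + 1"] that by auto
      moreover have "tA I (l + 1) < tD I (l + 1)" using tA_less_tD[of "l + 1"] that False by auto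
      moreover have "tD I (l + 1) < tL I j" using batch_start[OF b(2), of "l + 1"] that False by auto
      ultimately show ?thesis by simp
    qed
    then show ?thesis using disjnt_deliveries[of i j] b batch_dels by blast
  qed
  have swap: "disjnt (ivl I (Del j)) (ivl I (Swap l))"
    if "j \<in> S k" "k \<in> nums" "l \<in> stas I" "S l \<inter> ext I l = {}" for j k l
    using disjnt_swap_iff[of j k l] that sub by blast
  have swaps: "disjnt (ivl I (Swap k)) (ivl I (Swap l))" if "k \<in> stas I" "l \<in> stas I" "k < l" for k l
    using station_less[of k l] tA_less_tD[of k] tA_less_tD[of l] that
    by (simp add: disjnt_atLeastAtMost_iff)
  fix e e' assume e: "e \<in> itinerary S" "e' \<in> itinerary S" "e \<noteq> e'"
  from itinerary_cases[OF e(1)] itinerary_cases[OF e(2)]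
  show "disjnt (ivl I e) (ivl I e')"
  proof (elim disjE exE conjE)
    fix l i k j assume *: "l \<in> nums" "i \<in> S l" "e = Del i" "k \<in> nums" "j \<in> S k" "e' = Del j"
    consider "l < k" | "k < l" | "l = k" by linarith
    then show ?thesis
    proof cases
      case 1
      then show ?thesis using before[of i l j k] * by simp
    next
      case 2
      then show ?thesis using before[of j k i l] * disjnt_sym by simp
    next
      case 3
      then show ?thesis using indep[of l i j] * e(3) by (simp add: adj_def)
    qed
  next
    fix l i k assume "l \<in> nums" "i \<in> S l" "e = Del i" "k \<in> stas I" "S k \<inter> ext I k = {}" "e' = Swap k"
    then show ?thesis using swap by blast
  next
    fix l i k assume "l \<in> nums" "i \<in> S l" "e' = Del i" "k \<in> stas I" "S k \<inter> ext I k = {}" "e = Swap k"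
    then show ?thesis using swap disjnt_sym by blast
  next
    fix l k assume "l \<in> stas I" "e = Swap l" "k \<in> stas I" "e' = Swap k"
    then show ?thesis using swaps[of k l] swaps[of l k] e(3) disjnt_sym by (metis linorder_neqE_nat)
  qed
qed

text \<open>The battery is full at the start of every batch that is served: if no swap ends a batch,
  then \<open>ext\<close> was touched, \<open>gap\<close> leaves the next batch empty, and that one
  ends with a swap unless it is the last.\<close>

lemma feasible_itinerary:
  assumes sub: "\<And>l. l \<in> nums \<Longrightarrow> S l \<subseteq> batch I l"
    and load: "\<And>l. l \<in> nums \<Longrightarrow> load (S l) \<le> cap I"
    and indep: "\<And>l i j. l \<in> nums \<Longrightarrow> i \<in> S l \<Longrightarrow> j \<in> S l \<Longrightarrow> \<not> adj I i j"
    and gap: "\<And>l. l \<in> stas I \<Longrightarrow> S l \<inter> ext I l \<noteq> {} \<Longrightarrow> S (l + 1) = {}"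
  shows "feasible I (itinerary S)"
proof -
  have finS: "finite (S l)" if "l \<in> nums" for l using sub[OF that] finite_subset finite_batch by blast
  define xs where "xs l = sort_key (tL I) (sorted_list_of_set (S l))" for l
  define seg where "seg l = map Del (xs l) @
    (if l \<le> nsta I \<and> S l \<inter> ext I l = {} then [Swap l] else [])" for l
  have set_xs: "set (xs l) = S l" "distinct (xs l)" if "l \<in> nums" for l
    using finS[OF that] by (simp_all add: xs_def)
  have set_seg: "set (seg l) = Del ` S l \<union> (if l \<le> nsta I \<and> S l \<inter> ext I l = {} then {Swap l} else {})"
    if "l \<in> nums" for l
    using set_xs[OF that] by (auto simp: seg_def)
  have sorted_seg: "sorted_wrt (\<lambda>e e'. start I e < start I e') (seg l)" if l: "l \<in> nums" for l
  proof -
    have "sorted_wrt (\<lambda>i j. tL I i \<le> tL I j) (xs l)"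
      using sorted_sort_key[of "tL I"] by (simp only: xs_def sorted_map)
    then have "sorted_wrt (\<lambda>i j. tL I i \<le> tL I j \<and> i \<noteq> j) (xs l)"
      using set_xs(2)[OF l] by (simp add: sorted_wrt_iff_nth_less distinct_conv_nth)
    \<comment> \<open>Deliveries with equal start would be adjacent, so independence makes the order
      strict.\<close>
    then have "sorted_wrt (\<lambda>i j. tL I i < tL I j) (xs l)"
    proof (rule sorted_wrt_mono_rel[rotated])
      fix i j assume ij: "i \<in> set (xs l)" "j \<in> set (xs l)" "tL I i \<le> tL I j \<and> i \<noteq> j"
      then have "i \<in> S l" "j \<in> S l" using set_xs[OF l] by simp_all
      moreover from this have "i \<in> dels I" "j \<in> dels I" using sub[OF l] batch_dels by blast+
      ultimately show "tL I i < tL I j"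
        using indep[OF l, of i j] adj_iff[of i j] tL_le_tR[of i] tL_le_tR[of j] ij(3) by fastforce
    qed
    moreover have "tL I i < tA I l" if "i \<in> S l" "l \<le> nsta I" "S l \<inter> ext I l = {}" for i
    proof -
      have "i \<in> batch I l" "i \<notin> ext I l" using that sub[OF l] by blast+
      then show ?thesis using ext_iff[of l i] l that(2) tL_le_tR[OF batch_dels] by force
    qed
    ultimately show ?thesis
      using set_xs[OF l] by (auto simp: seg_def sorted_wrt_append sorted_wrt_map)
  qed
  have cross: "start I e < start I e'"
    if "e \<in> set (seg l)" "e' \<in> set (seg k)" "l \<in> nums" "k \<in> nums" "l < k" for e e' l k
  proof -
    have "start I e \<le> tD I l"
      using that set_seg[of l] batch_le[of _ l] sub[of l] tA_less_tD[of l]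
      by (auto split: if_splits intro: less_imp_le)
    also have "tD I l < start I e'"
      using that set_seg[of k] batch_start[of _ k l] sub[of k] station_less[of l k]
      by (auto split: if_splits)
    finally show ?thesis .
  qed
  define es where "es = concat (map seg [1..<nsta I + 2])"
  have "sorted_wrt (\<lambda>e e'. start I e < start I e') (concat (map seg [1..<k]))" if "k \<le> nsta I + 2" for k
    using that
  proof (induction k)
    case (Suc k)
    show ?case
    proof (cases "1 \<le> k")
      case True
      then show ?thesis
        using Suc sorted_seg[of k] cross by (auto simp: sorted_wrt_append)
    qed simp
  qed simp
  from this[OF order_refl] have "sorted_wrt (\<lambda>e e'. start I e < start I e') es" unfolding es_def .
  moreover have "set es = itinerary S"
  proof -
    have "set [1..<nsta I + 2] = nums" by auto
    then have "set es = (\<Union>l\<in>nums. set (seg l))" by (simp only: es_def set_concat set_map image_image)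
    also have "\<dots> = itinerary S" unfolding itinerary_def using set_seg by (intro SUP_cong) auto
    finally show ?thesis .
  qed
  moreover have "battery_ok I (cap I) es"
  proof -
    \<comment> \<open>Backward induction over the batches, for an arbitrary level \<open>b\<close>
      if the coming batch is empty: its segment is at most a swap, which resets the level
      anyway.\<close>
    have "battery_ok I b (concat (map seg [k..<nsta I + 2]))"
      if "1 \<le> k" "k \<le> nsta I + 2" "b = cap I \<or> S k = {}" for k b
      using that(2,1,3)
    proof (induction k arbitrary: b rule: inc_induct)
      case base
      then show ?case by simp
    next
      case (step k)
      then have k: "k \<in> nums" by simp
      define rest where "rest = concat (map seg [Suc k..<nsta I + 2])"
      have IH: "battery_ok I b rest" if "b = cap I \<or> S (Suc k) = {} \<or> nsta I < k" for b
      proof (cases "nsta I < k")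
        case True
        then show ?thesis by (simp add: rest_def)
      next
        case False
        then show ?thesis using step.IH[of b] that step.prems unfolding rest_def by simp
      qed
      have eq: "concat (map seg [k..<nsta I + 2]) = seg k @ rest"
        using upt_conv_Cons[of k "nsta I + 2"] step.hyps
        by (simp only: list.map concat.simps rest_def)
      show ?case
      proof (cases "S k = {}")
        case True
        then have "battery_ok I b (seg k @ rest)"
          using IH set_xs[OF k] by (auto simp: seg_def)
        then show ?thesis using eq by simp
      next
        case False
        then have b: "b = cap I" using step.prems by simp
        have sum: "(\<Sum>j\<leftarrow>xs k. cost I j) = load (S k)"
          using set_xs[OF k] by (metis sum_list_distinct_conv_sum_set)
        have "battery_ok I (b - load (S k)) ((if k \<le> nsta I \<and> S k \<inter> ext I k = {} then [Swap k] else []) @ rest)"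
          using IH gap[of k] step.hyps k by (cases "k \<le> nsta I") auto
        then have "battery_ok I b (map Del (xs k) @ ((if k \<le> nsta I \<and> S k \<inter> ext I k = {} then [Swap k] else []) @ rest))"
          using load[OF k] b sub[OF k] set_xs[OF k] cost_pos batch_dels
          by (intro battery_ok_append) (auto simp: sum intro!: less_imp_le)
        then show ?thesis unfolding eq by (simp only: seg_def append_assoc)
      qed
    qed
    from this[of 1 "cap I"] show ?thesis unfolding es_def by simp
  qed
  moreover have "itinerary S \<subseteq> Del ` dels I \<union> Swap ` stas I"
  proof
    fix e assume "e \<in> itinerary S"
    from itinerary_cases[OF this] show "e \<in> Del ` dels I \<union> Swap ` stas I"
      using sub batch_dels by blast
  qed
  moreover have "pairwise (\<lambda>e e'. disjnt (ivl I e) (ivl I e')) (itinerary S)"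
    by (rule itinerary_disjnt[OF sub indep gap])
  ultimately show ?thesis
    unfolding feasible_def by (intro conjI exI[of _ es])
qed

end

section \<open>Distributing the blocks of all batches over the drones\<close>

locale ddp_blocks = ddp +
  fixes blocks :: "nat \<Rightarrow> nat set set" and z :: "nat \<Rightarrow> nat" and m :: nat
  assumes good: "l \<in> nums \<Longrightarrow> good_blocks l (blocks l) (z l)"
    and enough: "l \<in> nums \<Longrightarrow> k \<in> nums \<Longrightarrow> card (blocks l) + z k \<le> m"
begin

lemma blocks_packing: "l \<in> nums \<Longrightarrow> packing (batch I l) (blocks l)"
  using good unfolding good_blocks_def by blast

lemma blocks_unique: "l \<in> nums \<Longrightarrow> X \<in> blocks l \<Longrightarrow> Y \<in> blocks l \<Longrightarrow> j \<in> X \<Longrightarrow> j \<in> Y \<Longrightarrow> X = Y"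
  using blocks_packing[of l] unfolding packing_def pairwise_def disjnt_def by blast

lemma blocks_cover: "l \<in> nums \<Longrightarrow> j \<in> batch I l \<Longrightarrow> \<exists>X\<in>blocks l. j \<in> X"
  and blocks_subset: "l \<in> nums \<Longrightarrow> X \<in> blocks l \<Longrightarrow> X \<subseteq> batch I l"
  using blocks_packing[of l] unfolding packing_def by blast+

lemma finite_blocks: "l \<in> nums \<Longrightarrow> finite (blocks l)"
  using packing_finite(1)[OF blocks_packing finite_batch] .

text \<open>The value at 0 is the empty set that precedes the first batch, so \<open>l - 1\<close>
  can be used for every batch alike.\<close>

definition ext_drones :: "(nat \<Rightarrow> nat set \<Rightarrow> nat) \<Rightarrow> nat \<Rightarrow> nat set" where
  "ext_drones f l = (if l = 0 then {} else f l ` {X \<in> blocks l. X \<inter> ext I l \<noteq> {}})"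

definition admissible :: "(nat \<Rightarrow> nat set \<Rightarrow> nat) \<Rightarrow> nat \<Rightarrow> bool" where
  "admissible f l \<longleftrightarrow> inj_on (f l) (blocks l) \<and> f l ` blocks l \<subseteq> {1..m} - ext_drones f (l - 1)"

text \<open>Closed form of the state of \<open>assign_batch\<close> after the batches in
  \<open>ls\<close>, where \<open>f\<close> collects the injections picked for the single
  batches.\<close>

definition assignment :: "(nat \<Rightarrow> nat set \<Rightarrow> nat) \<Rightarrow> nat list \<Rightarrow> nat \<Rightarrow> event set" where
  "assignment f ls d = (\<Union>l\<in>set ls. Del ` \<Union>{X \<in> blocks l. f l X = d} \<union>
     (if l \<le> nsta I \<and> d \<in> {1..m} - ext_drones f l then {Swap l} else {}))"

lemma Del_mem_assignment:
  "Del j \<in> assignment f ls d \<longleftrightarrow> (\<exists>l\<in>set ls. \<exists>X\<in>blocks l. f l X = d \<and> j \<in> X)"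
  by (auto simp: assignment_def)

lemma assign_batch_step:
  assumes "1 \<le> l"
  shows "(\<lambda>d. assignment f [1..<l] d \<union> Del ` \<Union>{X \<in> blocks l. f l X = d} \<union>
      (if l \<le> nsta I \<and> d \<in> {1..m} - f l ` {X \<in> blocks l. X \<inter> ext I l \<noteq> {}} then {Swap l} else {}),
      f l ` {X \<in> blocks l. X \<inter> ext I l \<noteq> {}}) = (assignment f [1..<Suc l], ext_drones f l)"
  using assms by (auto simp: assignment_def ext_drones_def fun_eq_iff)

text \<open>The direction that the program needs: any admissible choices form a run of the
  assignment phase. The final set of blocked drones is existential because the result discards
  it.\<close>

lemma admissible_complete:
  assumes "\<And>l. l \<in> nums \<Longrightarrow> admissible f l"
  shows "\<exists>D. Some (assignment f [1..<nsta I + 2], D)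
    \<in> for_each [1..<nsta I + 2] (assign_batch I m blocks) (\<lambda>_. {}, {})"
proof -
  define g where "g ys = (assignment f ys, ext_drones f (if ys = [] then 0 else last ys))" for ys
  have "Some (g [1..<nsta I + 2]) \<in> for_each [1..<nsta I + 2] (assign_batch I m blocks) (g [])"
  proof (rule Some_in_for_each)
    fix ys l zs assume "[1..<nsta I + 2] = ys @ l # zs"
    note l = upt_eq_append_Cons[OF this]
    have gy: "g ys = (assignment f [1..<l], ext_drones f (l - 1))"
      using l by (auto simp: g_def)
    have gl: "g (ys @ [l]) = (assignment f [1..<Suc l], ext_drones f l)"
      using l by (simp add: g_def)
    have "admissible f l" using assms l by simp
    then show "Some (g (ys @ [l])) \<in> assign_batch I m blocks l (g ys)"
      unfolding gy gl assign_batch_step[OF l(2), symmetric] assign_batch_def admissible_def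
      by (auto simp: Some_in_bind Let_def)
  qed
  moreover have "g [] = (\<lambda>_. {}, {})" by (simp add: g_def assignment_def ext_drones_def fun_eq_iff)
  ultimately show ?thesis by (auto simp: g_def)
qed

lemma card_ext_drones:
  assumes "l \<in> nums" "k \<in> nums"
  shows "card (ext_drones f (l - 1)) + card (blocks k) \<le> m"
proof (cases "l = 1")
  case True
  then show ?thesis using enough[OF assms(2,1)] by (simp add: ext_drones_def)
next
  case False
  then have l: "l - 1 \<in> nums" using assms by auto
  have "card (ext_drones f (l - 1)) \<le> card {X \<in> blocks (l - 1). X \<inter> ext I (l - 1) \<noteq> {}}"
    using finite_blocks[OF l] by (auto simp: ext_drones_def intro!: card_image_le)
  also have "\<dots> \<le> z (l - 1)" using good[OF l] unfolding good_blocks_def by blast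
  finally show ?thesis using enough[OF assms(2) l] by simp
qed

text \<open>At most \<open>z (l - 1)\<close> drones are blocked, and \<open>enough\<close> leaves
  room for an injection of the blocks. Recording the pick changes only \<open>f l\<close>, so what
  holds of earlier batches persists.\<close>

lemma always_assign:
  "always (\<lambda>(A, D). \<exists>f. (\<forall>l\<in>nums. admissible f l) \<and> A = assignment f [1..<nsta I + 2])
    (for_each [1..<nsta I + 2] (assign_batch I m blocks) (\<lambda>_. {}, {}))"
proof -
  define P where "P ys AD \<longleftrightarrow> (\<exists>f. (\<forall>l\<in>set ys. admissible f l) \<and>
    AD = (assignment f ys, ext_drones f (if ys = [] then 0 else last ys)))" for ys AD
  have "always (P [1..<nsta I + 2]) (for_each [1..<nsta I + 2] (assign_batch I m blocks) (\<lambda>_. {}, {}))"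
  proof (rule always_for_each)
    show "P [] (\<lambda>_. {}, {})" by (simp add: P_def assignment_def ext_drones_def fun_eq_iff)
    fix ys l zs AD assume "[1..<nsta I + 2] = ys @ l # zs" and P: "P ys AD"
    note l = upt_eq_append_Cons[OF this(1)]
    from P obtain f where f: "\<forall>l\<in>set ys. admissible f l"
      and AD: "AD = (assignment f [1..<l], ext_drones f (l - 1))"
      unfolding P_def using l by (auto split: if_splits)
    have nums: "l \<in> nums" using l by simp
    show "always (P (ys @ [l])) (assign_batch I m blocks l AD)"
      unfolding AD assign_batch_def prod.case
    proof (rule always_bind_pick)
      have "ext_drones f (l - 1) \<subseteq> {1..m}"
      proof (cases "l = 1")
        case False
        then have "admissible f (l - 1)" using f l by auto
        then show ?thesis unfolding admissible_def ext_drones_def by auto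
      qed (simp add: ext_drones_def)
      then have "card ({1..m} - ext_drones f (l - 1)) = m - card (ext_drones f (l - 1))"
        using finite_subset[of "ext_drones f (l - 1)" "{1..m}"] by (subst card_Diff_subset) auto
      then have "card (blocks l) \<le> card ({1..m} - ext_drones f (l - 1))"
        using card_ext_drones[OF nums nums, of f] by simp
      then show "\<exists>h. inj_on h (blocks l) \<and> h ` blocks l \<subseteq> {1..m} - ext_drones f (l - 1)"
        using inj_on_iff_card_le[OF finite_blocks[OF nums], of "{1..m} - ext_drones f (l - 1)"] by simp
      fix h assume h: "inj_on h (blocks l) \<and> h ` blocks l \<subseteq> {1..m} - ext_drones f (l - 1)"
      let ?f = "f(l := h)"
      have ext: "ext_drones ?f k = ext_drones f k" if "k < l" for k using that by (simp add: ext_drones_def)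
      have adm: "\<forall>k\<in>set (ys @ [l]). admissible ?f k"
      proof
        fix k assume k: "k \<in> set (ys @ [l])"
        show "admissible ?f k"
        proof (cases "k = l")
          case True
          then show ?thesis using h ext[of "l - 1"] l by (simp add: admissible_def)
        next
          case False
          then have "k \<in> set ys" "k < l" using k l by auto
          then show ?thesis using f ext[of "k - 1"] by (simp add: admissible_def)
        qed
      qed
      have "assignment f [1..<l] = assignment ?f [1..<l]"
        using ext by (auto simp: assignment_def fun_eq_iff)
      then have "P (ys @ [l]) (\<lambda>d. assignment f [1..<l] d \<union> Del ` \<Union>{X \<in> blocks l. h X = d} \<union>
          (if l \<le> nsta I \<and> d \<in> {1..m} - h ` {X \<in> blocks l. X \<inter> ext I l \<noteq> {}} then {Swap l} else {}),
          h ` {X \<in> blocks l. X \<inter> ext I l \<noteq> {}})"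
      proof -
        have "ys @ [l] = [1..<Suc l]" "ys @ [l] \<noteq> []" "last (ys @ [l]) = l" using l by simp_all
        then show ?thesis
          using adm assign_batch_step[OF l(2), of ?f] \<open>assignment f [1..<l] = assignment ?f [1..<l]\<close>
          unfolding P_def by (intro exI[of _ ?f]) (simp only: fun_upd_same if_False)
      qed
      then show "always (P (ys @ [l])) (let D' = h ` {X \<in> blocks l. X \<inter> ext I l \<noteq> {}} in
        ret (\<lambda>d. assignment f [1..<l] d \<union> Del ` \<Union>{X \<in> blocks l. h X = d} \<union>
                (if l \<le> nsta I \<and> d \<in> {1..m} - D' then {Swap l} else {}), D'))"
        by (simp add: Let_def)
    qed
  qed
  then show ?thesis
  proof (rule always_mono)
    have nums: "set [1..<nsta I + 2] = nums" by auto
    fix AD assume "P [1..<nsta I + 2] AD"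
    then show "case AD of (A, D) \<Rightarrow> \<exists>f. (\<forall>l\<in>nums. admissible f l) \<and> A = assignment f [1..<nsta I + 2]"
      unfolding P_def nums by auto
  qed
qed

text \<open>Injectivity of \<open>f l\<close> gives a drone at most one block per batch, so its
  assignment is an itinerary; avoiding \<open>ext_drones f (l - 1)\<close> is precisely the
  \<open>gap\<close> condition there.\<close>

lemma assignment_feasible:
  assumes adm: "\<And>l. l \<in> nums \<Longrightarrow> admissible f l"
  shows "feasible_schedule I m (assignment f [1..<nsta I + 2])"
  unfolding feasible_schedule_def
proof (intro conjI ballI)
  have nums: "set [1..<nsta I + 2] = nums" by auto
  fix d assume d: "d \<in> {1..m}"
  define S where "S l = \<Union>{X \<in> blocks l. f l X = d}" for l
  have S_block: "S l = X" if "l \<in> nums" "X \<in> blocks l" "f l X = d" for l X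
  proof -
    have "Y = X" if "Y \<in> blocks l" "f l Y = d" for Y
      using adm[OF \<open>l \<in> nums\<close>] \<open>X \<in> blocks l\<close> \<open>f l X = d\<close> that
      unfolding admissible_def inj_on_def by blast
    then have "{X \<in> blocks l. f l X = d} = {X}" using that by blast
    then show ?thesis by (simp add: S_def)
  qed
  have S_cases: "S l = {} \<or> S l \<in> blocks l \<and> f l (S l) = d" if "l \<in> nums" for l
  proof (cases "\<exists>X\<in>blocks l. f l X = d")
    case True
    then show ?thesis using S_block[OF that] by metis
  qed (auto simp: S_def)
  have ext: "d \<in> ext_drones f l \<longleftrightarrow> S l \<inter> ext I l \<noteq> {}" if "l \<in> nums" for l
    using that S_block[OF that] by (auto simp: ext_drones_def S_def)
  have "assignment f [1..<nsta I + 2] d = itinerary S"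
    unfolding assignment_def itinerary_def nums S_def[symmetric] using ext d by (intro SUP_cong) auto
  moreover have "feasible I (itinerary S)"
  proof (rule feasible_itinerary)
    fix l assume l: "l \<in> nums"
    show "S l \<subseteq> batch I l" using S_cases[OF l] blocks_subset[OF l] by blast
    show "load (S l) \<le> cap I"
      using S_cases[OF l] blocks_packing[OF l] cap_pos unfolding packing_def by auto
    show "\<not> adj I i j" if "i \<in> S l" "j \<in> S l" for i j
      using S_cases[OF l] good[OF l] that unfolding good_blocks_def by blast
  next
    fix l assume l: "l \<in> stas I" "S l \<inter> ext I l \<noteq> {}"
    then have "d \<in> ext_drones f l" "l + 1 \<in> nums" using ext[of l] by auto
    then show "S (l + 1) = {}"
      using S_cases[of "l + 1"] adm[of "l + 1"] unfolding admissible_def by auto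
  qed
  ultimately show "feasible I (assignment f [1..<nsta I + 2] d)" by simp
next
  have nums: "set [1..<nsta I + 2] = nums" by auto
  fix j assume "j \<in> dels I"
  then obtain l where l: "l \<in> nums" "j \<in> batch I l" using batch_exists by blast
  then obtain X where X: "X \<in> blocks l" "j \<in> X" using blocks_cover by blast
  have mem: "Del j \<in> assignment f [1..<nsta I + 2] d \<longleftrightarrow> f l X = d" for d
  proof
    assume "Del j \<in> assignment f [1..<nsta I + 2] d"
    then obtain k Y where Y: "k \<in> nums" "Y \<in> blocks k" "f k Y = d" "j \<in> Y"
      unfolding Del_mem_assignment nums by blast
    then have "k = l" using blocks_subset[OF Y(1,2)] batch_unique[of j k l] l by blast
    then show "f l X = d" using blocks_unique[of l X Y j] X Y l by simp
  next
    assume "f l X = d"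
    then show "Del j \<in> assignment f [1..<nsta I + 2] d"
      using X l unfolding Del_mem_assignment nums by blast
  qed
  have "f l X \<in> {1..m}" using adm[OF l(1)] X(1) unfolding admissible_def by blast
  then show "\<exists>!d. d \<in> {1..m} \<and> Del j \<in> assignment f [1..<nsta I + 2] d"
    unfolding mem by blast
qed

end

section \<open>The approximation guarantee for every outcome\<close>

context ddp
begin

text \<open>The two maxima in \<open>m\<close> may be attained in different batches. The bounds for
  blocks and for \<open>z\<close> are therefore applied separately, contributing the factor with 2
  and the additional 1.\<close>

lemma always_mod_alg:
  "always (\<lambda>(m, A). feasible_schedule I m A \<and>
     real m \<le> (3 + (eps_max I - eps_min I) / (1 - eps_max I)) * real (OPT_SC I)) (mod_alg I)"
  unfolding mod_alg_def
proof (rule always_bind)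
  have nums: "set [1..<nsta I + 2] = nums" by auto
  show "always (\<lambda>P. \<forall>l\<in>set [1..<nsta I + 2]. good_blocks l (fst (P l)) (snd (P l)))
    (for_each [1..<nsta I + 2] (\<lambda>l P. process_batch I l \<triangleright> (\<lambda>q. ret (P(l := q)))) (\<lambda>_. ({}, 0)))"
  proof (rule always_for_each)
    fix ys l zs and P :: "nat \<Rightarrow> nat set set \<times> nat"
    assume split: "[1..<nsta I + 2] = ys @ l # zs"
      and P: "\<forall>l\<in>set ys. good_blocks l (fst (P l)) (snd (P l))"
    note l = upt_eq_append_Cons[OF split]
    have "always (\<lambda>(Bs, z). good_blocks l Bs z) (process_batch I l)"
      using l by (intro always_process_batch) simp
    then show "always (\<lambda>P. \<forall>l\<in>set (ys @ [l]). good_blocks l (fst (P l)) (snd (P l)))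
        (process_batch I l \<triangleright> (\<lambda>q. ret (P(l := q))))"
      using P l by (elim always_bind) auto
  qed simp
next
  have nums: "set [1..<nsta I + 2] = nums" by auto
  fix P :: "nat \<Rightarrow> nat set set \<times> nat"
  assume P: "\<forall>l\<in>set [1..<nsta I + 2]. good_blocks l (fst (P l)) (snd (P l))"
  define blocks where "blocks l = fst (P l)" for l
  define z where "z l = snd (P l)" for l
  define m where "m = Max ((\<lambda>l. card (blocks l)) ` nums) + Max (z ` nums)"
  interpret ddp_blocks I blocks z m
  proof
    show "good_blocks l (blocks l) (z l)" if "l \<in> nums" for l
      using P that unfolding blocks_def z_def nums by blast
    show "card (blocks l) + z k \<le> m" if "l \<in> nums" "k \<in> nums" for l k
      unfolding m_def using that by (intro add_mono Max_ge) auto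
  qed
  have "always (\<lambda>(m, A). feasible_schedule I m A \<and>
     real m \<le> (3 + (eps_max I - eps_min I) / (1 - eps_max I)) * real (OPT_SC I))
    (for_each [1..<nsta I + 2] (assign_batch I m blocks) (\<lambda>_. {}, {}) \<triangleright> (\<lambda>(A, D). ret (m, A)))"
  proof (rule always_bind[OF always_assign], clarsimp simp del: upt_Suc)
    fix f assume "\<forall>l\<in>{Suc 0..Suc (nsta I)}. admissible f l"
    then have adm: "\<And>l. l \<in> nums \<Longrightarrow> admissible f l" by simp
    have feas: "feasible_schedule I m (assignment f [1..<nsta I + 2])"
      by (rule assignment_feasible[OF adm])
    \<comment> \<open>The schedule just constructed is the witness that makes the
      \<open>LEAST\<close> in \<open>OPT_SC\<close> meaningful.\<close>
    then have "\<exists>A. feasible_schedule I (OPT_SC I) A"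
      unfolding OPT_SC_def by (intro LeastI) blast
    then obtain A where A: "feasible_schedule I (OPT_SC I) A" by blast
    have bound: "z l \<le> OPT_SC I \<and> real (card (blocks l)) \<le>
        (2 + (eps_max I - eps_min I) / (1 - eps_max I)) * real (OPT_SC I)" if "l \<in> nums" for l
      using good[OF that] A unfolding good_blocks_def by blast
    have ne: "nums \<noteq> {}" "finite nums" by simp_all
    have "Max ((\<lambda>l. card (blocks l)) ` nums) \<in> (\<lambda>l. card (blocks l)) ` nums"
      using ne by (intro Max_in) auto
    then obtain l where l: "Max ((\<lambda>l. card (blocks l)) ` nums) = card (blocks l)" "l \<in> nums"
      by (rule imageE)
    have "Max (z ` nums) \<in> z ` nums" using ne by (intro Max_in) auto
    then obtain k where k: "Max (z ` nums) = z k" "k \<in> nums" by (rule imageE)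
    have m: "m = card (blocks l) + z k" using l k by (simp only: m_def)
    have "real m \<le> (2 + (eps_max I - eps_min I) / (1 - eps_max I)) * real (OPT_SC I) + real (OPT_SC I)"
      using bound[OF l(2)] bound[OF k(2)] m by simp
    then have "real m \<le> (3 + (eps_max I - eps_min I) / (1 - eps_max I)) * real (OPT_SC I)"
      by (simp add: algebra_simps)
    then show "feasible_schedule I m (assignment f [Suc 0..<Suc (Suc (nsta I))]) \<and>
      real m \<le> (3 + (eps_max I - eps_min I) / (1 - eps_max I)) * real (OPT_SC I)"
      using feas by (simp del: upt_Suc)
  qed
  then show "always (\<lambda>(m, A). feasible_schedule I m A \<and>
     real m \<le> (3 + (eps_max I - eps_min I) / (1 - eps_max I)) * real (OPT_SC I))
    (let blocks = (\<lambda>l. fst (P l)); z = (\<lambda>l. snd (P l));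
              m = Max ((\<lambda>l. card (blocks l)) ` {1..nsta I + 1}) + Max (z ` {1..nsta I + 1})
          in for_each [1..<nsta I + 2] (assign_batch I m blocks) (\<lambda>_. {}, {}) \<triangleright>
             (\<lambda>(A, D). ret (m, A)))"
    unfolding Let_def m_def blocks_def z_def .
qed

end

section \<open>Greedy matching\<close>

text \<open>Specification of a search for a maximiser. The value 0 means that no candidate exists,
  which is unambiguous because numbering starts at 1; ties are left open.\<close>

definition best :: "(nat \<Rightarrow> bool) \<Rightarrow> (nat \<Rightarrow> real) \<Rightarrow> nat \<Rightarrow> nat \<Rightarrow> bool" where
  "best P K N b \<longleftrightarrow> b = 0 \<and> (\<forall>i\<in>{1..N}. \<not> P i) \<or>
     b \<in> {1..N} \<and> P b \<and> (\<forall>i\<in>{1..N}. P i \<longrightarrow> K i \<le> K b)"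

lemma best_cong:
  "(\<And>i. i \<in> {1..N} \<Longrightarrow> P i \<longleftrightarrow> P' i) \<Longrightarrow> best P K N b \<longleftrightarrow> best P' K N b"
  unfolding best_def by blast

section \<open>The exchange step, and the number of the batch of a delivery\<close>

context ddp
begin

text \<open>Exchange argument: the lefts are processed by non-increasing end, so later lefts accept every right
  that an earlier left accepts by time, and the most expensive right is the least useful one
  for them.\<close>

lemma greedy_step:
  assumes l: "1 \<le> l" and N: "max_matching I l N" and MN: "M \<subseteq> N" and u: "u \<in> lefts I l" "u \<notin> S"
    and S: "fst ` M \<subseteq> S" "\<And>w. w \<in> S \<Longrightarrow> w \<in> fst ` N \<Longrightarrow> w \<in> fst ` M"
    and late: "\<And>w. w \<in> lefts I l \<Longrightarrow> w \<notin> S \<Longrightarrow> tR I w \<le> tR I u"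
    and b: "best (\<lambda>v. v \<in> rights I l \<and> v \<notin> snd ` M \<and> tR I u < tL I v \<and> cost I u + cost I v \<le> cap I)
      (cost I) (ndel I) b"
  defines "M' \<equiv> (if b = 0 then M else insert (u, b) M)"
  shows "\<exists>N'. max_matching I l N' \<and> M' \<subseteq> N' \<and> (\<forall>w\<in>insert u S. w \<in> fst ` N' \<longrightarrow> w \<in> fst ` M')"
proof -
  have mN: "matching I l N" and maxN: "\<And>N'. matching I l N' \<Longrightarrow> card N' \<le> card N"
    using N by (auto simp: max_matching_def)
  have finN: "finite N" using matching_finite[OF mN] .
  have uM: "u \<notin> fst ` M" using u(2) S(1) by blast
  have cand: "v \<in> rights I l" "v \<notin> snd ` M" "tR I u < tL I v" "cost I u + cost I v \<le> cap I" "v \<in> {1..ndel I}"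
    if "(u, v) \<in> N" for v
  proof -
    have e: "(u, v) \<in> bip_edges I l" using mN that unfolding matching_def by blast
    then show "v \<in> rights I l" "tR I u < tL I v" "cost I u + cost I v \<le> cap I"
      using bip_edges_iff[OF l] by blast+
    then show "v \<in> {1..ndel I}" using ext_subset batch_dels by blast
    show "v \<notin> snd ` M"
    proof
      assume "v \<in> snd ` M"
      then obtain w where w: "(w, v) \<in> M" by auto
      then have "(w, v) \<in> N" using MN by blast
      then have "w = u" using matching_snd[OF mN _ that] by blast
      then show False using w uM by force
    qed
  qed
  show ?thesis
  proof (cases "b = 0")
    case True
    then have none: "\<not> (v \<in> rights I l \<and> v \<notin> snd ` M \<and> tR I u < tL I v \<and> cost I u + cost I v \<le> cap I)"
      if "v \<in> {1..ndel I}" for v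
      using b that unfolding best_def by auto
    \<comment> \<open>A partner of \<open>u\<close> in \<open>N\<close> would be a candidate, so the
      failed search shows that \<open>N\<close> leaves \<open>u\<close> unmatched and can be
      kept.\<close>
    have "u \<notin> fst ` N"
    proof
      assume "u \<in> fst ` N"
      then obtain v where v: "(u, v) \<in> N" by auto
      show False using none[OF cand(5)[OF v]] cand(1-4)[OF v] by blast
    qed
    then have "\<forall>w\<in>insert u S. w \<in> fst ` N \<longrightarrow> w \<in> fst ` M" using S(2) by blast
    then show ?thesis using N MN True unfolding M'_def by (intro exI[of _ N]) simp
  next
    case False
    then have bc: "b \<in> rights I l" "b \<notin> snd ` M" "tR I u < tL I b" "cost I u + cost I b \<le> cap I"
      and bmax: "\<And>v. (u, v) \<in> N \<Longrightarrow> cost I v \<le> cost I b"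
      using b cand unfolding best_def by auto
    have M': "M' = insert (u, b) M" using False by (simp add: M'_def)
    have ub: "(u, b) \<in> bip_edges I l" using bip_edges_iff[OF l] u(1) bc by blast
    \<comment> \<open>A processed partner of \<open>b\<close> in \<open>N\<close> would be matched
      in \<open>M\<close> already, necessarily to \<open>b\<close>, which is still free.\<close>
    have late': "w \<notin> S" if "(w, b) \<in> N" for w
    proof
      assume "w \<in> S"
      then have "w \<in> fst ` M" using S(2) that by force
      then obtain x where x: "(w, x) \<in> M" by auto
      then have "x = b" using matching_fst[OF mN _ that] MN by blast
      then show False using x bc(2) by force
    qed
    \<comment> \<open>\<open>N\<close> without its edges at \<open>u\<close> and at
      \<open>b\<close>. At most two edges are lost, and the cases below show how to regain as
      many.\<close>
    define N1 where "N1 = {p \<in> N. fst p \<noteq> u \<and> snd p \<noteq> b}"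
    have finN1: "finite N1" using finN by (simp add: N1_def)
    have mN1: "matching I l N1"
      using mN unfolding matching_def N1_def by (auto intro: inj_on_subset)
    have MN1: "M \<subseteq> N1"
    proof
      fix p assume "p \<in> M"
      then have "p \<in> N" "fst p \<in> fst ` M" "snd p \<in> snd ` M" using MN by auto
      then show "p \<in> N1" using uM bc(2) by (auto simp: N1_def)
    qed
    have ins: "matching I l (insert (x, y) L)"
      if "matching I l L" "(x, y) \<in> bip_edges I l" "x \<notin> fst ` L" "y \<notin> snd ` L" for x y L
      using that unfolding matching_def by auto
    have new: "u \<notin> fst ` N1" "b \<notin> snd ` N1" by (auto simp: N1_def)
    have mN1': "matching I l (insert (u, b) N1)" using ins[OF mN1 ub new] .
    have "(u, b) \<notin> N1" using new by force
    then have cN1: "card (insert (u, b) N1) = Suc (card N1)" using finN1 by simp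
    \<comment> \<open>Common end of all cases: an extension of \<open>N1\<close> by
      \<open>(u, b)\<close> and possibly more is maximum once it is as large as \<open>N\<close>.
      The last premise keeps it from matching processed lefts anew.\<close>
    have done1: ?thesis if "matching I l (insert (u, b) L)" "N1 \<subseteq> L" "card N \<le> card (insert (u, b) L)"
      "\<And>w. w \<in> S \<Longrightarrow> w \<in> fst ` L \<Longrightarrow> w \<in> fst ` N1" for L
    proof (intro exI conjI)
      show "max_matching I l (insert (u, b) L)"
        using that maxN unfolding max_matching_def by (meson le_trans)
      show "M' \<subseteq> insert (u, b) L" unfolding M' using MN1 that(2) by blast
      show "\<forall>w\<in>insert u S. w \<in> fst ` insert (u, b) L \<longrightarrow> w \<in> fst ` M'"
      proof (intro ballI impI)
        fix w assume w: "w \<in> insert u S" "w \<in> fst ` insert (u, b) L"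
        show "w \<in> fst ` M'"
        proof (cases "w = u")
          case False
          then have "w \<in> fst ` N1" using w that(4)[of w] by auto
          then have "w \<in> fst ` N" by (auto simp: N1_def)
          then show ?thesis using S(2)[of w] w(1) False unfolding M' by auto
        qed (simp add: M')
      qed
    qed
    have remU: "{p \<in> N. fst p = u} = {(u, v)}" if "(u, v) \<in> N" for v
    proof -
      have eq: "p = (u, v)" if "p \<in> N" "fst p = u" for p
        using that matching_fst[OF mN, of u "snd p" v] \<open>(u, v) \<in> N\<close> by (cases p) simp
      show ?thesis
      proof
        show "{p \<in> N. fst p = u} \<subseteq> {(u, v)}" using eq by blast
      qed (use that in simp)
    qed
    have remB: "{p \<in> N. snd p = b} = {(w, b)}" if "(w, b) \<in> N" for w
    proof -
      have eq: "p = (w, b)" if "p \<in> N" "snd p = b" for p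
        using that matching_snd[OF mN, of "fst p" b w] \<open>(w, b) \<in> N\<close> by (cases p) simp
      show ?thesis
      proof
        show "{p \<in> N. snd p = b} \<subseteq> {(w, b)}" using eq by blast
      qed (use that in simp)
    qed
    have split: "N = N1 \<union> {p \<in> N. fst p = u} \<union> {p \<in> N. snd p = b}" by (auto simp: N1_def)
    consider (both) v w where "(u, v) \<in> N" "(w, b) \<in> N" | (one) "\<not> (\<exists>v w. (u, v) \<in> N \<and> (w, b) \<in> N)"
      by blast
    then show ?thesis
    proof cases
      case both
      show ?thesis
      proof (cases "v = b")
        case True
        then have "w = u" using matching_snd[OF mN] both by blast
        have "card N \<le> card N1 + card {(u, b)}"
          using split remU[OF both(1)] remB[OF both(2)] True \<open>w = u\<close> card_Un_le[of N1 "{(u, b)}"] by simp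
        then show ?thesis using done1[of N1] mN1' cN1 by simp
      next
        case False
        then have "w \<noteq> u" using matching_fst[OF mN] both by blast
        have lw: "w \<in> lefts I l" and lv: "v \<in> rights I l" using matching_mem[OF mN] both by blast+
        \<comment> \<open>The exchange: replace \<open>(u, v)\<close> and \<open>(w, b)\<close> by
          \<open>(u, b)\<close> and \<open>(w, v)\<close>. The unprocessed \<open>w\<close> ends no
          later than \<open>u\<close>, hence before \<open>v\<close> starts, and \<open>v\<close>
          costs at most as much as \<open>b\<close>, the costliest candidate.\<close>
        have "tR I w < tL I v"
          using late[OF lw late'[OF both(2)]] cand(3)[OF both(1)] by simp
        moreover have "cost I w + cost I v \<le> cap I"
        proof -
          have "(w, b) \<in> bip_edges I l" using mN both(2) unfolding matching_def by blast
          then have "cost I w + cost I b \<le> cap I" using bip_edges_iff[OF l] by blast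
          then show ?thesis using bmax[OF both(1)] by simp
        qed
        ultimately have wv: "(w, v) \<in> bip_edges I l" using bip_edges_iff[OF l] lw lv by blast
        have nw: "w \<notin> fst ` insert (u, b) N1"
          using \<open>w \<noteq> u\<close> matching_fst[OF mN both(2)] by (force simp: N1_def)
        have nv: "v \<notin> snd ` insert (u, b) N1"
          using \<open>v \<noteq> b\<close> matching_snd[OF mN both(1)] by (force simp: N1_def)
        have m: "matching I l (insert (u, b) (insert (w, v) N1))"
          using ins[OF mN1' wv nw nv] insert_commute[of "(u, b)" "(w, v)" N1] by simp
        have "(w, v) \<notin> insert (u, b) N1" using nw by force
        then have "card (insert (u, b) (insert (w, v) N1)) = Suc (Suc (card N1))"
          using finN1 cN1 insert_commute[of "(u, b)" "(w, v)" N1]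
            card_insert_disjoint[of "insert (u, b) N1" "(w, v)"] by simp
        moreover have "card N \<le> card N1 + card {(u, v), (w, b)}"
        proof -
          have "N = N1 \<union> {(u, v), (w, b)}" using split remU[OF both(1)] remB[OF both(2)] by blast
          then show ?thesis using card_Un_le[of N1 "{(u, v), (w, b)}"] by simp
        qed
        ultimately have c: "card N \<le> card (insert (u, b) (insert (w, v) N1))"
          using card_insert_le_m1[of 2 "{(w, b)}" "(u, v)"] by simp
        show ?thesis using late'[OF both(2)] by (intro done1[OF m _ c]) auto
      qed
    next
      case one
      \<comment> \<open>Only one of \<open>u\<close> and \<open>b\<close> is matched in
        \<open>N\<close>, if any, so the single new edge \<open>(u, b)\<close> makes up for the
        loss.\<close>
      have "card N \<le> card N1 + 1"
      proof (cases "\<exists>v. (u, v) \<in> N")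
        case True
        then obtain v where v: "(u, v) \<in> N" by blast
        then have e: "{p \<in> N. snd p = b} = {}" using one by auto
        from split have "N = N1 \<union> {(u, v)}" unfolding remU[OF v] e by simp
        then show ?thesis using card_Un_le[of N1 "{(u, v)}"] by simp
      next
        case False
        then have e: "{p \<in> N. fst p = u} = {}" by auto
        show ?thesis
        proof (cases "\<exists>w. (w, b) \<in> N")
          case True
          then obtain w where w: "(w, b) \<in> N" by blast
          from split have "N = N1 \<union> {(w, b)}" unfolding remB[OF w] e by simp
          then show ?thesis using card_Un_le[of N1 "{(w, b)}"] by simp
        next
          case False
          then have e': "{p \<in> N. snd p = b} = {}" by auto
          from split have "N = N1" unfolding e e' by simp
          then show ?thesis by simp
        qed
      qed
      then show ?thesis using done1[of N1] mN1' cN1 by simp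
    qed
  qed
qed

definition num :: "nat \<Rightarrow> nat" where
  "num j = (THE l. l \<in> nums \<and> j \<in> batch I l)"

lemma num:
  assumes "j \<in> dels I"
  shows "num j \<in> nums" "j \<in> batch I (num j)"
proof -
  have "\<exists>!l. l \<in> nums \<and> j \<in> batch I l"
    using batch_exists[OF assms] batch_unique by blast
  from theI'[OF this] show "num j \<in> nums" "j \<in> batch I (num j)"
    unfolding num_def by blast+
qed

lemma num_eq: "j \<in> batch I l \<Longrightarrow> l \<in> nums \<Longrightarrow> num j = l"
  using num[OF batch_dels] batch_unique by blast

abbreviation is_left :: "nat \<Rightarrow> bool" where "is_left j \<equiv> j \<in> lefts I (num j)"
abbreviation is_ext :: "nat \<Rightarrow> bool" where "is_ext j \<equiv> j \<in> ext I (num j)"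

lemma mem_lefts: "l \<in> nums \<Longrightarrow> j \<in> lefts I l \<longleftrightarrow> j \<in> dels I \<and> num j = l \<and> is_left j"
  and mem_ext: "l \<in> nums \<Longrightarrow> j \<in> ext I l \<longleftrightarrow> j \<in> dels I \<and> num j = l \<and> is_ext j"
  and mem_batch: "l \<in> nums \<Longrightarrow> j \<in> batch I l \<longleftrightarrow> j \<in> dels I \<and> num j = l"
  using num_eq[of j l] ext_subset[of l] batch_dels[of j l] num[of j] by auto

lemma mem_rights:
  "l \<in> nums \<Longrightarrow> j \<in> rights I l \<longleftrightarrow> j \<in> dels I \<and> num j = l \<and> is_ext j \<and> \<not> is_left j"
  using mem_ext[of l j] mem_lefts[of l j] lefts_rights_disjoint[of l] by blast

text \<open>\<open>ext\<close> is cut out of a batch by a lower bound on the end. By non-increasing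
  end it thus precedes the rest of its batch, although the passes below never separate the
  two.\<close>

lemma ext_of_later:
  assumes "i \<in> dels I" "j \<in> dels I" "num i = num j" "is_ext j" "tR I j \<le> tR I i"
  shows "is_ext i"
  using assms num[OF assms(1)] ext_iff[of "num j"] by force

end

section \<open>Greedy matching in the global order by non-increasing end\<close>

locale ddp_order = ddp +
  fixes Q :: "nat \<Rightarrow> nat"
  assumes Q_bij: "bij_betw Q {1..ndel I} (dels I)"
    and Q_order: "1 \<le> p \<Longrightarrow> p \<le> q \<Longrightarrow> q \<le> ndel I \<Longrightarrow> tR I (Q q) \<le> tR I (Q p)"
begin

definition seen :: "nat \<Rightarrow> nat set" where "seen p = Q ` {1..<p}"

lemma Q_dels: "1 \<le> p \<Longrightarrow> p \<le> ndel I \<Longrightarrow> Q p \<in> dels I"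
  using bij_betwE[OF Q_bij] by simp

lemma seen_1 [simp]: "seen 1 = {}" "seen (Suc 0) = {}"
  by (simp_all add: seen_def)

lemma seen_Suc: "1 \<le> p \<Longrightarrow> seen (Suc p) = insert (Q p) (seen p)"
  by (auto simp: seen_def less_Suc_eq)

lemma seen_all: "seen (Suc (ndel I)) = dels I"
proof -
  have "{1..<Suc (ndel I)} = {1..ndel I}" by auto
  then show ?thesis using Q_bij by (simp only: seen_def bij_betw_def)
qed

lemma seen_subset: "p \<le> Suc (ndel I) \<Longrightarrow> seen p \<subseteq> dels I"
  using seen_all unfolding seen_def by fastforce

lemma finite_seen [simp]: "finite (seen p)"
  by (simp add: seen_def)

lemma Q_not_seen:
  assumes "1 \<le> p" "p \<le> ndel I"
  shows "Q p \<notin> seen p"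
proof
  assume "Q p \<in> seen p"
  then obtain q where q: "1 \<le> q" "q < p" "Q p = Q q" unfolding seen_def by auto
  have "inj_on Q {1..ndel I}" using Q_bij by (simp add: bij_betw_def)
  from inj_onD[OF this q(3)] show False using q assms by simp
qed

lemma seen_early: "i \<in> seen p \<Longrightarrow> p \<le> ndel I \<Longrightarrow> tR I (Q p) \<le> tR I i"
  using Q_order unfolding seen_def by auto

lemma unseen_late:
  assumes "i \<in> dels I" "i \<notin> seen p" "1 \<le> p"
  shows "tR I i \<le> tR I (Q p)"
proof -
  obtain q where q: "q \<in> {1..ndel I}" "i = Q q" using assms(1) Q_bij unfolding bij_betw_def by blast
  then have "p \<le> q" using assms(2) unfolding seen_def by force
  then show ?thesis using Q_order[of p q] q assms(3) by simp
qed

definition mates :: "nat \<Rightarrow> (nat \<Rightarrow> nat) \<Rightarrow> (nat \<times> nat) set" where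
  "mates l mate = {(u, mate u) |u. u \<in> lefts I l \<and> mate u \<noteq> 0}"

lemma mem_mates: "(u, v) \<in> mates l mate \<longleftrightarrow> u \<in> lefts I l \<and> v = mate u \<and> v \<noteq> 0"
  by (auto simp: mates_def)

text \<open>The third clause says that the pairs found extend to a maximum matching without using a
  processed left that was passed over. \<open>tk\<close> is constrained on deliveries only, because
  a failed search also marks entry 0.\<close>

definition mate_inv :: "nat \<Rightarrow> (nat \<Rightarrow> nat) \<Rightarrow> (nat \<Rightarrow> nat) \<Rightarrow> bool" where
  "mate_inv p mate tk \<longleftrightarrow>
     (\<forall>u. mate u \<noteq> 0 \<longrightarrow> u \<in> seen p \<and> is_left u) \<and>
     (\<forall>v\<in>dels I. tk v \<noteq> 0 \<longleftrightarrow> v \<in> range mate) \<and>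
     (\<forall>l\<in>nums. \<exists>N. max_matching I l N \<and> mates l mate \<subseteq> N \<and>
        (\<forall>u\<in>seen p. u \<in> fst ` N \<longrightarrow> u \<in> fst ` mates l mate))"

lemma mate_inv_init: "mate_inv 1 (\<lambda>_. 0) (\<lambda>_. 0)"
  using max_matching_exists by (simp add: mate_inv_def mates_def)

lemma mate_inv_skip:
  assumes p: "1 \<le> p" "p \<le> ndel I" and inv: "mate_inv p mate tk" and u: "\<not> is_left (Q p)"
  shows "mate_inv (Suc p) mate tk"
proof -
  have "Q p \<notin> fst ` N" if "max_matching I l N" "l \<in> nums" for l N
  proof
    assume "Q p \<in> fst ` N"
    then have "Q p \<in> lefts I l"
      using that(1) matching_mem[of l N] unfolding max_matching_def by auto
    then show False using u mem_lefts[OF that(2), of "Q p"] by simp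
  qed
  then show ?thesis using inv unfolding mate_inv_def seen_Suc[OF p(1)]
    by (metis insert_iff)
qed

lemma mate_inv_step:
  assumes p: "1 \<le> p" "p \<le> ndel I" and inv: "mate_inv p mate tk" and u: "u = Q p" "is_left u"
    and b: "best (\<lambda>v. num v = num u \<and> is_ext v \<and> \<not> is_left v \<and> tk v = 0 \<and> tR I u < tL I v \<and>
      cost I u + cost I v \<le> cap I) (cost I) (ndel I) b"
  shows "mate_inv (Suc p) (mate(u := b)) (tk(b := 1))"
proof -
  let ?mate = "mate(u := b)" and ?tk = "tk(b := 1)"
  have i1: "\<And>u. mate u \<noteq> 0 \<Longrightarrow> u \<in> seen p \<and> is_left u"
    and i2: "\<And>v. v \<in> dels I \<Longrightarrow> tk v \<noteq> 0 \<longleftrightarrow> v \<in> range mate"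
    and i3: "\<And>l. l \<in> nums \<Longrightarrow> \<exists>N. max_matching I l N \<and> mates l mate \<subseteq> N \<and>
        (\<forall>u\<in>seen p. u \<in> fst ` N \<longrightarrow> u \<in> fst ` mates l mate)"
    using inv unfolding mate_inv_def by blast+
  have us: "u \<notin> seen p" using Q_not_seen p u by simp
  have mu: "mate u = 0" using i1 us by blast
  have "\<exists>N. max_matching I l N \<and> mates l ?mate \<subseteq> N \<and>
        (\<forall>w\<in>seen (Suc p). w \<in> fst ` N \<longrightarrow> w \<in> fst ` mates l ?mate)" if l: "l \<in> nums" for l
  proof (cases "l = num u")
    case False
    obtain N where N: "max_matching I l N" "mates l mate \<subseteq> N"
      "\<forall>u\<in>seen p. u \<in> fst ` N \<longrightarrow> u \<in> fst ` mates l mate" using i3[OF l] by blast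
    have "u \<notin> lefts I l" using False mem_lefts[OF l, of u] by simp
    then have eq: "mates l ?mate = mates l mate" by (auto simp: mates_def)
    have "u \<notin> fst ` N" using \<open>u \<notin> lefts I l\<close> matching_mem[of l N] N(1)
      unfolding max_matching_def by auto
    then have "\<forall>w\<in>seen (Suc p). w \<in> fst ` N \<longrightarrow> w \<in> fst ` mates l ?mate"
      using N(3) unfolding seen_Suc[OF p(1)] u(1)[symmetric] eq by blast
    then show ?thesis using N eq by blast
  next
    case True
    obtain N where N: "max_matching I l N" "mates l mate \<subseteq> N"
      "\<forall>u\<in>seen p. u \<in> fst ` N \<longrightarrow> u \<in> fst ` mates l mate" using i3[OF l] by blast
    have ul: "u \<in> lefts I l" using u(2) True by simp
    have cond: "(num v = num u \<and> is_ext v \<and> \<not> is_left v \<and> tk v = 0 \<and> tR I u < tL I v \<and> cost I u + cost I v \<le> cap I)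
        \<longleftrightarrow> (v \<in> rights I l \<and> v \<notin> snd ` mates l mate \<and> tR I u < tL I v \<and> cost I u + cost I v \<le> cap I)"
      if v: "v \<in> {1..ndel I}" for v
    proof (cases "v \<in> rights I l")
      case R: True
      \<comment> \<open>\<open>tk\<close> is global while \<open>greedy_step\<close> concerns one
        batch. They agree since a mate lies in the same batch as its left, so a marked right of
        batch \<open>l\<close> was taken by a left of batch \<open>l\<close>.\<close>
      have "v \<in> range mate \<longleftrightarrow> v \<in> snd ` mates l mate"
      proof
        assume "v \<in> range mate"
        then obtain w where w: "v = mate w" "mate w \<noteq> 0" using v by auto
        then have "w \<in> seen p" "is_left w" using i1[of w] by simp_all
        then have "w \<in> dels I" "is_left w" using seen_subset[of p] p by auto
        then obtain N' where N': "max_matching I (num w) N'" "mates (num w) mate \<subseteq> N'"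
          using i3[OF num(1)] by blast
        have "(w, v) \<in> mates (num w) mate" using w \<open>is_left w\<close> by (simp add: mem_mates)
        then have "v \<in> rights I (num w)" using N' matching_mem unfolding max_matching_def by blast
        then have "num v = num w" using num_eq num(1)[OF \<open>w \<in> dels I\<close>] ext_subset by blast
        moreover have "num v = l" using num_eq[of v l] R l ext_subset by blast
        ultimately have "num w = l" by simp
        then show "v \<in> snd ` mates l mate" using \<open>(w, v) \<in> mates (num w) mate\<close> by force
      qed (auto simp: mates_def)
      then have "tk v = 0 \<longleftrightarrow> v \<notin> snd ` mates l mate" using i2[OF v] by (cases "tk v = 0") simp_all
      moreover have "num v = num u" "is_ext v" "\<not> is_left v"
        using R mem_rights[OF l, of v] True by blast+
      ultimately show ?thesis using R by blast
    next
      case False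
      then have "\<not> (num v = num u \<and> is_ext v \<and> \<not> is_left v)"
        using mem_rights[OF l, of v] v True by blast
      then show ?thesis using False by blast
    qed
    have b': "best (\<lambda>v. v \<in> rights I l \<and> v \<notin> snd ` mates l mate \<and> tR I u < tL I v \<and> cost I u + cost I v \<le> cap I)
      (cost I) (ndel I) b"
      using b by (subst best_cong[OF cond, symmetric])
    have "\<exists>N'. max_matching I l N' \<and> (if b = 0 then mates l mate else insert (u, b) (mates l mate)) \<subseteq> N' \<and>
        (\<forall>w\<in>insert u (seen p). w \<in> fst ` N' \<longrightarrow>
          w \<in> fst ` (if b = 0 then mates l mate else insert (u, b) (mates l mate)))"
    proof (rule greedy_step[OF _ N(1,2) ul us _ _ _ b'])
      show "fst ` mates l mate \<subseteq> seen p" using i1 by (auto simp: mates_def)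
      show "tR I w \<le> tR I u" if "w \<in> lefts I l" "w \<notin> seen p" for w
        using unseen_late[of w p] that mem_lefts[OF l, of w] p u by blast
    qed (use l N(3) in auto)
    moreover have "(if b = 0 then mates l mate else insert (u, b) (mates l mate)) = mates l ?mate"
    proof (rule set_eqI)
      fix q
      show "q \<in> (if b = 0 then mates l mate else insert (u, b) (mates l mate)) \<longleftrightarrow> q \<in> mates l ?mate"
        using mu ul by (cases q) (auto simp: mem_mates)
    qed
    ultimately show ?thesis unfolding seen_Suc[OF p(1)] u(1)[symmetric] by simp
  qed
  moreover have "?tk v \<noteq> 0 \<longleftrightarrow> v \<in> range ?mate" if v: "v \<in> dels I" for v
  proof -
    have "v \<in> range ?mate \<longleftrightarrow> v \<in> range mate \<or> v = b"
    proof -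
      have "v \<noteq> mate u" using mu v by simp
      then show ?thesis by (auto simp: image_iff split: if_splits)
    qed
    then show ?thesis using i2[OF v] by auto
  qed
  moreover have "w \<in> seen (Suc p) \<and> is_left w" if "?mate w \<noteq> 0" for w
    using that i1[of w] u unfolding seen_Suc[OF p(1)] by (cases "w = u") auto
  ultimately show ?thesis unfolding mate_inv_def by blast
qed

text \<open>Once every left is processed, the extension \<open>N\<close> has no left beyond those of
  \<open>mates\<close>; as both are matchings with \<open>mates\<close> inside \<open>N\<close>,
  they coincide.\<close>

lemma mate_inv_final:
  assumes inv: "mate_inv (Suc (ndel I)) mate tk" and l: "l \<in> nums"
  shows "max_matching I l (mates l mate)"
proof -
  obtain N where N: "max_matching I l N" "mates l mate \<subseteq> N"
    "\<forall>u\<in>dels I. u \<in> fst ` N \<longrightarrow> u \<in> fst ` mates l mate"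
    using inv l unfolding mate_inv_def seen_all by blast
  have m: "matching I l N" using N(1) by (simp add: max_matching_def)
  have "N \<subseteq> mates l mate"
  proof clarify
    fix u v assume uv: "(u, v) \<in> N"
    then have "u \<in> dels I" using matching_mem[OF m] mem_lefts[OF l, of u] by blast
    then have "u \<in> fst ` mates l mate" using N(3) uv by force
    then obtain v' where v': "(u, v') \<in> mates l mate" by auto
    then have "v' = v" using matching_fst[OF m _ uv] N(2) by blast
    then show "(u, v) \<in> mates l mate" using v' by simp
  qed
  then show ?thesis using N by (simp add: subset_antisym)
qed

end

section \<open>Greedy coloring\<close>

locale ddp_mate = ddp_order +
  fixes mate :: "nat \<Rightarrow> nat"
  assumes mates_max: "l \<in> nums \<Longrightarrow> max_matching I l (mates l mate)"
    and mate_left: "mate u \<noteq> 0 \<Longrightarrow> u \<in> dels I \<and> is_left u"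
begin

lemma mates_matching: "l \<in> nums \<Longrightarrow> matching I l (mates l mate)"
  using mates_max by (simp add: max_matching_def)

lemma mate:
  assumes "mate u \<noteq> 0"
  shows "mate u \<in> dels I" "num (mate u) = num u" "is_ext (mate u)" "mate (mate u) = 0"
    "tR I u < tL I (mate u)" "is_ext u" "u \<in> dels I"
proof -
  have u: "u \<in> dels I" "is_left u" using mate_left[OF assms] by simp_all
  then have l: "num u \<in> nums" using num by blast
  have m: "(u, mate u) \<in> mates (num u) mate" using assms u by (simp add: mem_mates)
  have "(u, mate u) \<in> bip_edges I (num u)"
    using mates_matching[OF l] m unfolding matching_def by blast
  then have r: "mate u \<in> rights I (num u)" and t: "tR I u < tL I (mate u)"
    using bip_edges_iff[of "num u"] l by auto
  show "mate u \<in> dels I" "num (mate u) = num u" "is_ext (mate u)"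
    using r mem_rights[OF l, of "mate u"] by blast+
  show "mate (mate u) = 0"
    using r mem_rights[OF l, of "mate u"] mate_left[of "mate u"] by blast
  show "tR I u < tL I (mate u)" "is_ext u" "u \<in> dels I" using t u by simp_all
qed

lemma mate_inj: "mate u = mate w \<Longrightarrow> mate u \<noteq> 0 \<Longrightarrow> u = w"
proof -
  assume eq: "mate u = mate w" "mate u \<noteq> 0"
  then have l: "num u \<in> nums" "num w = num u" using num mate[of u] mate[of w] by auto
  have "(u, mate u) \<in> mates (num u) mate" "(w, mate u) \<in> mates (num u) mate"
    using eq l mate_left[of u] mate_left[of w] by (auto simp: mem_mates)
  then show "u = w" using matching_snd[OF mates_matching[OF l(1)]] by blast
qed

text \<open>\<open>tail\<close> marks the earliest delivery of each class: all other members start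
  after it ends, so whatever ends before the tail starts fits the whole class. \<open>nc\<close>
  counts the colors opened per batch. \<open>zc\<close> counts the representatives in
  \<open>ext\<close>, those with \<open>mate j = 0\<close>. The last clause bounds the colors by
  \<open>zc\<close> as long as only \<open>ext\<close> of a batch has been seen; after that new
  colors are charged to \<open>omega I\<close>.\<close>

definition color_inv ::
    "nat \<Rightarrow> (nat \<Rightarrow> nat) \<Rightarrow> (nat \<Rightarrow> nat) \<Rightarrow> (nat \<Rightarrow> nat) \<Rightarrow> (nat \<Rightarrow> nat) \<Rightarrow> bool" where
  "color_inv p col tail nc zc \<longleftrightarrow>
     (\<forall>j\<in>seen p. 1 \<le> col j \<and> col j \<le> nc (num j)) \<and>
     (\<forall>l c. 1 \<le> c \<longrightarrow> c \<le> nc l \<longrightarrow> (\<exists>t\<in>seen p. num t = l \<and> col t = c \<and> tail t \<noteq> 0)) \<and>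
     (\<forall>t. tail t \<noteq> 0 \<longrightarrow> t \<in> seen p \<and>
        (\<forall>j\<in>seen p. num j = num t \<longrightarrow> col j = col t \<longrightarrow> j \<noteq> t \<longrightarrow> tR I t < tL I j)) \<and>
     (\<forall>i\<in>seen p. \<forall>j\<in>seen p. num i = num j \<longrightarrow> col i = col j \<longrightarrow> \<not> adj I i j) \<and>
     (\<forall>i\<in>seen p. \<forall>j\<in>seen p. num i = num j \<longrightarrow> is_ext i \<longrightarrow> is_ext j \<longrightarrow>
        (col i = col j \<longleftrightarrow> i = j \<or> mate i = j \<or> mate j = i)) \<and>
     (\<forall>l. zc l = card {j \<in> seen p. num j = l \<and> is_ext j \<and> mate j = 0}) \<and>
     (\<forall>l. nc l \<le> max (omega I) (zc l)) \<and>
     (\<forall>l. (\<forall>j\<in>seen p. num j = l \<longrightarrow> is_ext j) \<longrightarrow> nc l \<le> zc l)"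

lemma color_invI:
  assumes a1: "\<And>j. j \<in> seen p \<Longrightarrow> 1 \<le> col j \<and> col j \<le> nc (num j)"
    and a2: "\<And>l c. 1 \<le> c \<Longrightarrow> c \<le> nc l \<Longrightarrow> \<exists>t\<in>seen p. num t = l \<and> col t = c \<and> tail t \<noteq> 0"
    and a3: "\<And>t. tail t \<noteq> 0 \<Longrightarrow> t \<in> seen p"
    and a4: "\<And>t j. tail t \<noteq> 0 \<Longrightarrow> j \<in> seen p \<Longrightarrow> num j = num t \<Longrightarrow> col j = col t \<Longrightarrow> j \<noteq> t \<Longrightarrow> tR I t < tL I j"
    and a5: "\<And>i j. i \<in> seen p \<Longrightarrow> j \<in> seen p \<Longrightarrow> num i = num j \<Longrightarrow> col i = col j \<Longrightarrow> \<not> adj I i j"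
    and a6: "\<And>i j. i \<in> seen p \<Longrightarrow> j \<in> seen p \<Longrightarrow> num i = num j \<Longrightarrow> is_ext i \<Longrightarrow> is_ext j \<Longrightarrow>
        col i = col j \<longleftrightarrow> i = j \<or> mate i = j \<or> mate j = i"
    and a7: "\<And>l. zc l = card {j \<in> seen p. num j = l \<and> is_ext j \<and> mate j = 0}"
    and a8: "\<And>l. nc l \<le> max (omega I) (zc l)"
    and a9: "\<And>l. (\<And>j. j \<in> seen p \<Longrightarrow> num j = l \<Longrightarrow> is_ext j) \<Longrightarrow> nc l \<le> zc l"
  shows "color_inv p col tail nc zc"
proof -
  have "\<forall>j\<in>seen p. 1 \<le> col j \<and> col j \<le> nc (num j)"
    using a1 by blast
  moreover have "\<forall>l c. 1 \<le> c \<longrightarrow> c \<le> nc l \<longrightarrow> (\<exists>t\<in>seen p. num t = l \<and> col t = c \<and> tail t \<noteq> 0)"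
    using a2 by blast
  moreover have "\<forall>t. tail t \<noteq> 0 \<longrightarrow> t \<in> seen p \<and>
        (\<forall>j\<in>seen p. num j = num t \<longrightarrow> col j = col t \<longrightarrow> j \<noteq> t \<longrightarrow> tR I t < tL I j)"
    using a3 a4 by blast
  moreover have "\<forall>i\<in>seen p. \<forall>j\<in>seen p. num i = num j \<longrightarrow> col i = col j \<longrightarrow> \<not> adj I i j"
    using a5 by blast
  moreover have "\<forall>i\<in>seen p. \<forall>j\<in>seen p. num i = num j \<longrightarrow> is_ext i \<longrightarrow> is_ext j \<longrightarrow>
        (col i = col j \<longleftrightarrow> i = j \<or> mate i = j \<or> mate j = i)"
    using a6 by blast
  moreover have "\<forall>l. zc l = card {j \<in> seen p. num j = l \<and> is_ext j \<and> mate j = 0}"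
    using a7 by blast
  moreover have "\<forall>l. nc l \<le> max (omega I) (zc l)"
    using a8 by blast
  moreover have "\<forall>l. (\<forall>j\<in>seen p. num j = l \<longrightarrow> is_ext j) \<longrightarrow> nc l \<le> zc l"
    using a9 by blast
  ultimately show ?thesis unfolding color_inv_def by (intro conjI)
qed

lemma color_invD:
  assumes "color_inv p col tail nc zc"
  shows "\<And>j. j \<in> seen p \<Longrightarrow> 1 \<le> col j \<and> col j \<le> nc (num j)"
    and "\<And>l c. 1 \<le> c \<Longrightarrow> c \<le> nc l \<Longrightarrow> \<exists>t\<in>seen p. num t = l \<and> col t = c \<and> tail t \<noteq> 0"
    and "\<And>t. tail t \<noteq> 0 \<Longrightarrow> t \<in> seen p"
    and "\<And>t j. tail t \<noteq> 0 \<Longrightarrow> j \<in> seen p \<Longrightarrow> num j = num t \<Longrightarrow> col j = col t \<Longrightarrow> j \<noteq> t \<Longrightarrow> tR I t < tL I j"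
    and "\<And>i j. i \<in> seen p \<Longrightarrow> j \<in> seen p \<Longrightarrow> num i = num j \<Longrightarrow> col i = col j \<Longrightarrow> \<not> adj I i j"
    and "\<And>i j. i \<in> seen p \<Longrightarrow> j \<in> seen p \<Longrightarrow> num i = num j \<Longrightarrow> is_ext i \<Longrightarrow> is_ext j \<Longrightarrow>
        col i = col j \<longleftrightarrow> i = j \<or> mate i = j \<or> mate j = i"
    and "\<And>l. zc l = card {j \<in> seen p. num j = l \<and> is_ext j \<and> mate j = 0}"
    and "\<And>l. nc l \<le> max (omega I) (zc l)"
    and "\<And>l. (\<And>j. j \<in> seen p \<Longrightarrow> num j = l \<Longrightarrow> is_ext j) \<Longrightarrow> nc l \<le> zc l"
proof -
  note c = assms[unfolded color_inv_def]
  show "\<And>j. j \<in> seen p \<Longrightarrow> 1 \<le> col j \<and> col j \<le> nc (num j)"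
    using c[THEN conjunct1] by blast
  show "\<And>l c. 1 \<le> c \<Longrightarrow> c \<le> nc l \<Longrightarrow> \<exists>t\<in>seen p. num t = l \<and> col t = c \<and> tail t \<noteq> 0"
    using c[THEN conjunct2, THEN conjunct1] by blast
  show "\<And>t. tail t \<noteq> 0 \<Longrightarrow> t \<in> seen p"
    using c[THEN conjunct2, THEN conjunct2, THEN conjunct1] by blast
  show "\<And>t j. tail t \<noteq> 0 \<Longrightarrow> j \<in> seen p \<Longrightarrow> num j = num t \<Longrightarrow> col j = col t \<Longrightarrow> j \<noteq> t \<Longrightarrow> tR I t < tL I j"
    using c[THEN conjunct2, THEN conjunct2, THEN conjunct1] by blast
  show "\<And>i j. i \<in> seen p \<Longrightarrow> j \<in> seen p \<Longrightarrow> num i = num j \<Longrightarrow> col i = col j \<Longrightarrow> \<not> adj I i j"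
    using c[THEN conjunct2, THEN conjunct2, THEN conjunct2, THEN conjunct1] by blast
  show "\<And>i j. i \<in> seen p \<Longrightarrow> j \<in> seen p \<Longrightarrow> num i = num j \<Longrightarrow> is_ext i \<Longrightarrow> is_ext j \<Longrightarrow>
        col i = col j \<longleftrightarrow> i = j \<or> mate i = j \<or> mate j = i"
    using c[THEN conjunct2, THEN conjunct2, THEN conjunct2, THEN conjunct2, THEN conjunct1] by blast
  show "\<And>l. zc l = card {j \<in> seen p. num j = l \<and> is_ext j \<and> mate j = 0}"
    using c[THEN conjunct2, THEN conjunct2, THEN conjunct2, THEN conjunct2, THEN conjunct2, THEN conjunct1] by blast
  show "\<And>l. nc l \<le> max (omega I) (zc l)"
    using c[THEN conjunct2, THEN conjunct2, THEN conjunct2, THEN conjunct2, THEN conjunct2, THEN conjunct2, THEN conjunct1] by blast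
  show "\<And>l. (\<And>j. j \<in> seen p \<Longrightarrow> num j = l \<Longrightarrow> is_ext j) \<Longrightarrow> nc l \<le> zc l"
    using c[THEN conjunct2, THEN conjunct2, THEN conjunct2, THEN conjunct2, THEN conjunct2, THEN conjunct2, THEN conjunct2] by blast
qed

lemma color_inv_init: "color_inv 1 (\<lambda>_. 0) (\<lambda>_. 0) (\<lambda>_. 0) (\<lambda>_. 0)"
  by (simp add: color_inv_def)

text \<open>A mate starts after its left has ended, so it ends later and comes earlier in the order:
  the right of a pair is always colored before the left.\<close>

lemma unmatched_by_seen:
  assumes p: "1 \<le> p" "p \<le> ndel I" and i: "i \<in> seen p"
  shows "mate i \<noteq> Q p"
proof
  assume eq: "mate i = Q p"
  then have "mate i \<noteq> 0" using Q_dels[OF p] by auto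
  then have "tR I i < tL I (Q p)" using mate(5)[of i] eq by simp
  moreover have "tR I (Q p) \<le> tR I i" using seen_early[OF i p(2)] .
  moreover have "tL I (Q p) \<le> tR I (Q p)" using tL_le_tR[OF Q_dels[OF p]] .
  ultimately show False by simp
qed

lemma seen_all_ext:
  assumes p: "1 \<le> p" "p \<le> ndel I" and e: "is_ext (Q p)" and i: "i \<in> seen p" "num i = num (Q p)"
  shows "is_ext i"
proof -
  have "i \<in> dels I" using i(1) seen_subset[of p] p by auto
  then show ?thesis using ext_of_later[OF _ Q_dels[OF p] i(2) e seen_early[OF i(1) p(2)]] by blast
qed

text \<open>Every color has a tail. If none of them starts after \<open>tR I (Q p)\<close>, all
  contain this point, since they end no earlier than \<open>Q p\<close>; together with
  \<open>Q p\<close> they form a clique.\<close>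

lemma few_colors:
  assumes p: "1 \<le> p" "p \<le> ndel I" and inv: "color_inv p col tail nc zc"
    and none: "\<And>i. i \<in> dels I \<Longrightarrow> num i = num (Q p) \<Longrightarrow> tail i \<noteq> 0 \<Longrightarrow> tL I i \<le> tR I (Q p)"
  shows "Suc (nc (num (Q p))) \<le> omega I"
proof -
  note C = color_invD[OF inv]
  let ?v = "Q p"
  define T where "T = {t \<in> seen p. num t = num ?v \<and> tail t \<noteq> 0}"
  have dels: "seen p \<subseteq> dels I" "?v \<in> dels I" using seen_subset p Q_dels by auto
  have fT: "finite T" by (simp add: T_def)
  have "{1..nc (num ?v)} \<subseteq> col ` T"
  proof
    fix c assume "c \<in> {1..nc (num ?v)}"
    then have "\<exists>t\<in>seen p. num t = num ?v \<and> col t = c \<and> tail t \<noteq> 0" using C(2)[of c "num ?v"] by simp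
    then show "c \<in> col ` T" unfolding T_def by blast
  qed
  then have "nc (num ?v) \<le> card (col ` T)" using card_mono[OF finite_imageI[OF fT, of col], of "{1..nc (num ?v)}"] by simp
  also have "\<dots> \<le> card T" by (rule card_image_le[OF fT])
  finally have "nc (num ?v) \<le> card T" .
  have vT: "?v \<notin> T" using Q_not_seen[OF p] by (simp add: T_def)
  have contains: "tL I t \<le> tR I ?v \<and> tR I ?v \<le> tR I t \<and> t \<in> dels I" if "t \<in> insert ?v T" for t
  proof (cases "t = ?v")
    case True
    then show ?thesis using dels tL_le_tR[of ?v] by simp
  next
    case False
    then have t: "t \<in> seen p" "num t = num ?v" "tail t \<noteq> 0" using that by (auto simp: T_def)
    then have td: "t \<in> dels I" using dels by blast
    show ?thesis using none[OF td t(2,3)] seen_early[OF t(1) p(2)] td by simp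
  qed
  have "pairwise (adj I) (insert ?v T)"
  proof (rule pairwiseI)
    fix x y assume xy: "x \<in> insert ?v T" "y \<in> insert ?v T" "x \<noteq> y"
    show "adj I x y"
      using contains[OF xy(1)] contains[OF xy(2)] xy(3) adj_iff[of x y] by linarith
  qed
  moreover have "insert ?v T \<subseteq> dels I" using contains by blast
  ultimately have "card (insert ?v T) \<le> omega I" by (intro clique_le_omega)
  then show ?thesis using vT fT \<open>nc (num ?v) \<le> card T\<close> by simp
qed

text \<open>A delivery of \<open>ext\<close> without mate opens a color and raises \<open>zc\<close>
  together with \<open>nc\<close>. Any other delivery opens one only when all tails block it, and
  then \<open>few_colors\<close> keeps the count within \<open>omega I\<close>.\<close>

lemma color_inv_new:
  assumes p: "1 \<le> p" "p \<le> ndel I" and inv: "color_inv p col tail nc zc" and v: "v = Q p"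
    and unmatched: "is_ext v \<Longrightarrow> mate v = 0"
    and none: "\<And>i. \<not> is_ext v \<Longrightarrow> i \<in> dels I \<Longrightarrow> num i = num v \<Longrightarrow> tail i \<noteq> 0 \<Longrightarrow> tL I i \<le> tR I v"
  shows "color_inv (Suc p) (col(v := Suc (nc (num v)))) (tail(v := 1)) (nc(num v := Suc (nc (num v))))
    (if is_ext v then zc(num v := Suc (zc (num v))) else zc)"
    (is "color_inv _ ?col ?tail ?nc ?zc")
proof -
  note C = color_invD[OF inv]
  have s: "seen (Suc p) = insert v (seen p)" using seen_Suc[OF p(1)] v by simp
  have vs: "v \<notin> seen p" using Q_not_seen[OF p] v by simp
  have ne: "i \<noteq> v" if "i \<in> seen p" for i using that vs by blast
  have fresh: "col j \<noteq> Suc (nc (num v))" if "j \<in> seen p" "num j = num v" for j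
    using C(1)[OF that(1)] that(2) by simp
  have mne: "mate i \<noteq> v" if "i \<in> seen p" for i using unmatched_by_seen[OF p that] v by simp
  have 1: "1 \<le> ?col j \<and> ?col j \<le> ?nc (num j)" if "j \<in> seen (Suc p)" for j
    using that C(1)[of j] ne[of j] unfolding s by (cases "j = v"; cases "num j = num v") auto
  have 2: "\<exists>t\<in>seen (Suc p). num t = l \<and> ?col t = c \<and> ?tail t \<noteq> 0" if c: "1 \<le> c" "c \<le> ?nc l" for l c
  proof (cases "l = num v \<and> c = Suc (nc (num v))")
    case True
    then show ?thesis unfolding s by auto
  next
    case False
    then have "c \<le> nc l" using c(2) by (cases "l = num v") auto
    then obtain t where t: "t \<in> seen p" "num t = l" "col t = c" "tail t \<noteq> 0" using C(2)[OF c(1)] by blast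
    then show ?thesis using ne[OF t(1)] unfolding s by (intro bexI[of _ t]) auto
  qed
  have 3: "t \<in> seen (Suc p)" if "?tail t \<noteq> 0" for t
    using that C(3)[of t] unfolding s by (cases "t = v") auto
  have 4: "tR I t < tL I j" if t: "?tail t \<noteq> 0" "j \<in> seen (Suc p)" "num j = num t" "?col j = ?col t" "j \<noteq> t" for t j
  proof (cases "t = v")
    case True
    then have "j \<in> seen p" using t unfolding s by blast
    then show ?thesis using fresh[of j] t True by simp
  next
    case False
    then have t': "tail t \<noteq> 0" "t \<in> seen p" using t C(3)[of t] by auto
    have "j \<noteq> v" using fresh[OF t'(2)] t False by auto
    then show ?thesis using C(4)[OF t'(1), of j] t False unfolding s by auto
  qed
  have 5: "\<not> adj I i j" if ij: "i \<in> seen (Suc p)" "j \<in> seen (Suc p)" "num i = num j" "?col i = ?col j" for i j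
  proof -
    consider "i = v" "j = v" | "i = v" "j \<in> seen p" "j \<noteq> v" | "j = v" "i \<in> seen p" "i \<noteq> v"
      | "i \<in> seen p" "j \<in> seen p" "i \<noteq> v" "j \<noteq> v"
      using ij(1,2) unfolding s by blast
    then show ?thesis
    proof cases
      case 1
      then show ?thesis by (simp add: adj_def)
    next
      case 2
      then show ?thesis using fresh[of j] ij by simp
    next
      case 3
      then show ?thesis using fresh[of i] ij by simp
    next
      case 4
      then show ?thesis using C(5)[of i j] ij by simp
    qed
  qed
  have 6: "?col i = ?col j \<longleftrightarrow> i = j \<or> mate i = j \<or> mate j = i"
    if ij: "i \<in> seen (Suc p)" "j \<in> seen (Suc p)" "num i = num j" "is_ext i" "is_ext j" for i j
  proof -
    have pos: "x \<noteq> 0" if "x \<in> seen p" for x using that seen_subset[of p] p by auto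
    consider "i = v" "j = v" | "i = v" "j \<in> seen p" "j \<noteq> v" | "j = v" "i \<in> seen p" "i \<noteq> v"
      | "i \<in> seen p" "j \<in> seen p" "i \<noteq> v" "j \<noteq> v"
      using ij(1,2) unfolding s by blast
    then show ?thesis
    proof cases
      case 1
      then show ?thesis by simp
    next
      case 2
      then have "mate v = 0" using unmatched ij by simp
      then show ?thesis using 2 fresh[of j] ij(3) mne[of j] pos[of j] by auto
    next
      case 3
      then have "mate v = 0" using unmatched ij by simp
      then show ?thesis using 3 fresh[of i] ij(3) mne[of i] pos[of i] by auto
    next
      case 4
      then show ?thesis using C(6)[of i j] ij by simp
    qed
  qed
  have 7: "?zc l = card {j \<in> seen (Suc p). num j = l \<and> is_ext j \<and> mate j = 0}" for l
  proof (cases "is_ext v \<and> l = num v")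
    case True
    then have "{j \<in> seen (Suc p). num j = l \<and> is_ext j \<and> mate j = 0} =
        insert v {j \<in> seen p. num j = l \<and> is_ext j \<and> mate j = 0}"
      unfolding s using unmatched by auto
    then show ?thesis using vs True C(7)[of l] by simp
  next
    case False
    then have "{j \<in> seen (Suc p). num j = l \<and> is_ext j \<and> mate j = 0} =
        {j \<in> seen p. num j = l \<and> is_ext j \<and> mate j = 0}"
      unfolding s by auto
    then show ?thesis using False C(7)[of l] by auto
  qed
  have old: "nc (num v) \<le> zc (num v)" if "is_ext v"
    using C(9)[of "num v"] seen_all_ext[OF p] that unfolding v by blast
  have 8: "?nc l \<le> max (omega I) (?zc l)" for l
  proof (cases "l = num v")
    case True
    show ?thesis
    proof (cases "is_ext v")
      case e: True
      then show ?thesis using old[OF e] True by simp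
    next
      case False
      then have "Suc (nc (num (Q p))) \<le> omega I"
        using few_colors[OF p inv] none unfolding v by blast
      then show ?thesis using True v by (simp add: max_def)
    qed
  next
    case False
    then show ?thesis using C(8)[of l] by auto
  qed
  have 9: "?nc l \<le> ?zc l" if "\<And>j. j \<in> seen (Suc p) \<Longrightarrow> num j = l \<Longrightarrow> is_ext j" for l
  proof (cases "l = num v")
    case True
    then have "is_ext v" using that[of v] unfolding s by blast
    then show ?thesis using True old by simp
  next
    case False
    have "nc l \<le> zc l" using C(9)[of l] that unfolding s by blast
    then show ?thesis using False by simp
  qed
  show ?thesis by (rule color_invI[OF 1 2 3 4 5 6 7 8 9])
qed

text \<open>For a matched left the class to join is prescribed, so it has to be shown that its mate
  is still a tail: so far only \<open>ext\<close> of the batch has been seen, and two of those share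
  a color only if matched to each other.\<close>

lemma color_inv_join:
  assumes p: "1 \<le> p" "p \<le> ndel I" and inv: "color_inv p col tail nc zc" and v: "v = Q p"
    and u: "u \<noteq> 0" "if is_ext v then u = mate v else tail u \<noteq> 0 \<and> num u = num v \<and> tR I v < tL I u"
  shows "color_inv (Suc p) (col(v := col u)) ((tail(u := 0))(v := 1)) nc zc"
    (is "color_inv _ ?col ?tail _ _")
proof -
  note C = color_invD[OF inv]
  have s: "seen (Suc p) = insert v (seen p)" using seen_Suc[OF p(1)] v by simp
  have vs: "v \<notin> seen p" using Q_not_seen[OF p] v by simp
  have vd: "v \<in> dels I" using Q_dels[OF p] v by simp
  have ne: "i \<noteq> v" if "i \<in> seen p" for i using that vs by blast
  have mne: "mate i \<noteq> v" if "i \<in> seen p" for i using unmatched_by_seen[OF p that] v by simp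
  have sd: "i \<in> dels I" if "i \<in> seen p" for i using that seen_subset[of p] p by auto
  have u': "u \<in> seen p \<and> num u = num v \<and> tR I v < tL I u \<and> tail u \<noteq> 0 \<and> (is_ext v \<longrightarrow> is_ext u \<and> mate u = 0)"
  proof (cases "is_ext v")
    case False
    then show ?thesis using u C(3)[of u] by simp
  next
    case True
    then have um: "u = mate v" "mate v \<noteq> 0" using u by simp_all
    note m = mate[OF um(2)]
    have "u \<in> seen p"
    proof (rule ccontr)
      assume "u \<notin> seen p"
      then have "tR I u \<le> tR I v" using unseen_late[of u p] m(1) p um v by simp
      then show False using m(5) tL_le_tR[OF m(1)] um by simp
    qed
    moreover have "1 \<le> col u" "col u \<le> nc (num v)" using C(1)[OF \<open>u \<in> seen p\<close>] m(2) um by simp_all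
    then obtain t where t: "t \<in> seen p" "num t = num v" "col t = col u" "tail t \<noteq> 0"
      using C(2)[of "col u" "num v"] by blast
    have "is_ext t" using seen_all_ext[OF p _ t(1)] True t(2) v by simp
    then have "t = u \<or> mate t = u \<or> mate u = t"
      using C(6)[OF t(1) \<open>u \<in> seen p\<close>] t m(2,3) um by simp
    moreover have "mate u \<noteq> t" using m(4) um sd[OF t(1)] by auto
    moreover have "mate t \<noteq> u" using mate_inj[of v t] um ne[OF t(1)] by auto
    ultimately have "tail u \<noteq> 0" using t by auto
    then show ?thesis using \<open>u \<in> seen p\<close> m um by simp
  qed
  then have us: "u \<in> seen p" and un: "num u = num v" and ut: "tail u \<noteq> 0" and uv: "tR I v < tL I u" by auto
  have before: "tR I v < tL I j" if "j \<in> seen p" "num j = num v" "col j = col u" for j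
  proof (cases "j = u")
    case False
    then have "tR I u < tL I j" using C(4)[OF ut that(1)] that un by simp
    then show ?thesis using uv tL_le_tR[OF sd[OF us]] by simp
  qed (use uv in simp)
  \<comment> \<open>Tails are unique within a class: each of two tails would end before the other
    starts.\<close>
  have only: "t = u" if "tail t \<noteq> 0" "num t = num v" "col t = col u" for t
  proof (rule ccontr)
    assume "t \<noteq> u"
    have ts: "t \<in> seen p" using C(3)[OF that(1)] .
    have "tR I t < tL I u" using C(4)[OF that(1) us] that un \<open>t \<noteq> u\<close> by simp
    moreover have "tR I u < tL I t" using C(4)[OF ut ts] that un \<open>t \<noteq> u\<close> by simp
    moreover have "tL I u \<le> tR I u" "tL I t \<le> tR I t" using tL_le_tR sd us ts by auto
    ultimately show False by simp
  qed
  have 1: "1 \<le> ?col j \<and> ?col j \<le> nc (num j)" if "j \<in> seen (Suc p)" for j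
    using that C(1)[of j] C(1)[OF us] un unfolding s by (cases "j = v") auto
  have 2: "\<exists>t\<in>seen (Suc p). num t = l \<and> ?col t = c \<and> ?tail t \<noteq> 0" if c: "1 \<le> c" "c \<le> nc l" for l c
  proof (cases "l = num v \<and> c = col u")
    case True
    then show ?thesis unfolding s by auto
  next
    case False
    obtain t where t: "t \<in> seen p" "num t = l" "col t = c" "tail t \<noteq> 0" using C(2)[OF c] by blast
    then have "t \<noteq> u" using False un by auto
    then show ?thesis using t ne[OF t(1)] unfolding s by (intro bexI[of _ t]) auto
  qed
  have 3: "t \<in> seen (Suc p)" if "?tail t \<noteq> 0" for t
    using that C(3)[of t] unfolding s by (cases "t = v"; cases "t = u") auto
  have 4: "tR I t < tL I j" if t: "?tail t \<noteq> 0" "j \<in> seen (Suc p)" "num j = num t" "?col j = ?col t" "j \<noteq> t" for t j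
  proof (cases "t = v")
    case True
    then have "j \<in> seen p" "num j = num v" "col j = col u" using t ne[of j] unfolding s by auto
    then show ?thesis using before True by simp
  next
    case False
    then have tu: "t \<noteq> u" "tail t \<noteq> 0" using t by (auto split: if_splits)
    show ?thesis
    proof (cases "j = v")
      case True
      then have "t = u" using only[OF tu(2)] t False by simp
      then show ?thesis using tu by simp
    next
      case jv: False
      then show ?thesis using C(4)[OF tu(2), of j] t False unfolding s by auto
    qed
  qed
  have nadj: "\<not> adj I v j \<and> \<not> adj I j v" if "j \<in> seen p" "num j = num v" "col j = col u" for j
    using before[OF that] adj_iff[OF vd sd[OF that(1)]] adj_sym[of v j] by auto
  have 5: "\<not> adj I i j" if ij: "i \<in> seen (Suc p)" "j \<in> seen (Suc p)" "num i = num j" "?col i = ?col j" for i j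
  proof -
    consider "i = v" "j = v" | "i = v" "j \<in> seen p" "j \<noteq> v" | "j = v" "i \<in> seen p" "i \<noteq> v"
      | "i \<in> seen p" "j \<in> seen p" "i \<noteq> v" "j \<noteq> v"
      using ij(1,2) unfolding s by blast
    then show ?thesis
    proof cases
      case 1
      then show ?thesis by (simp add: adj_def)
    next
      case 2
      then show ?thesis using nadj[of j] ij by simp
    next
      case 3
      then show ?thesis using nadj[of i] ij by simp
    next
      case 4
      then show ?thesis using C(5)[of i j] ij by simp
    qed
  qed
  have colv: "col i = col u \<longleftrightarrow> mate v = i" if "is_ext v" "i \<in> seen p" "num i = num v" "is_ext i" for i
  proof -
    have mv: "u = mate v" using u that(1) by simp
    have "mate u = 0" "is_ext u" using u' that(1) by blast+
    then have "mate u \<noteq> i" using sd[OF that(2)] by auto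
    moreover have "mate i \<noteq> u"
      using mate_inj[of v i] mv u(1) ne[OF that(2)] by auto
    ultimately show ?thesis using C(6)[OF that(2) us] that un \<open>is_ext u\<close> mv by auto
  qed
  have 6: "?col i = ?col j \<longleftrightarrow> i = j \<or> mate i = j \<or> mate j = i"
    if ij: "i \<in> seen (Suc p)" "j \<in> seen (Suc p)" "num i = num j" "is_ext i" "is_ext j" for i j
  proof -
    consider "i = v" "j = v" | "i = v" "j \<in> seen p" "j \<noteq> v" | "j = v" "i \<in> seen p" "i \<noteq> v"
      | "i \<in> seen p" "j \<in> seen p" "i \<noteq> v" "j \<noteq> v"
      using ij(1,2) unfolding s by blast
    then show ?thesis
    proof cases
      case 1
      then show ?thesis by simp
    next
      case 2
      have "is_ext v" "num j = num v" using ij(3,4) unfolding 2(1) by simp_all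
      then have "col j = col u \<longleftrightarrow> mate v = j" using colv[OF _ 2(2)] ij(5) by blast
      then show ?thesis using mne[OF 2(2)] 2 by auto
    next
      case 3
      have "is_ext v" "num i = num v" using ij(3,5) unfolding 3(1) by simp_all
      then have "col i = col u \<longleftrightarrow> mate v = i" using colv[OF _ 3(2)] ij(4) by blast
      then show ?thesis using mne[OF 3(2)] 3 by auto
    next
      case 4
      then show ?thesis using C(6)[of i j] ij by simp
    qed
  qed
  have 7: "zc l = card {j \<in> seen (Suc p). num j = l \<and> is_ext j \<and> mate j = 0}" for l
  proof -
    have "\<not> (is_ext v \<and> mate v = 0)" using u by auto
    then have "{j \<in> seen (Suc p). num j = l \<and> is_ext j \<and> mate j = 0} =
        {j \<in> seen p. num j = l \<and> is_ext j \<and> mate j = 0}"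
      unfolding s by auto
    then show ?thesis using C(7)[of l] by simp
  qed
  have 9: "nc l \<le> zc l" if "\<And>j. j \<in> seen (Suc p) \<Longrightarrow> num j = l \<Longrightarrow> is_ext j" for l
    using C(9)[of l] that unfolding s by blast
  show ?thesis by (rule color_invI[OF 1 2 3 4 5 6 7 C(8) 9])
qed

definition colmap :: "(nat \<Rightarrow> nat) \<Rightarrow> nat \<Rightarrow> nat \<rightharpoonup> nat" where
  "colmap col l j = (if j \<in> batch I l then Some (col j) else None)"

lemma color_inv_final:
  assumes inv: "color_inv (Suc (ndel I)) col tail nc zc" and l: "l \<in> nums"
  shows "zc l = zval I l (mates l mate)" "valid_coloring l (mates l mate) (colmap col l)"
proof -
  note C = color_invD[OF inv, unfolded seen_all]
  have "{j \<in> dels I. num j = l \<and> is_ext j \<and> mate j = 0} = ext I l - fst ` mates l mate"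
  proof (rule set_eqI)
    fix j
    have "j \<in> fst ` mates l mate \<longleftrightarrow> j \<in> lefts I l \<and> mate j \<noteq> 0" by (auto simp: mates_def image_iff)
    moreover have "j \<in> lefts I l" if "mate j \<noteq> 0" "num j = l" using mate_left[OF that(1)] that(2) by simp
    ultimately show "j \<in> {j \<in> dels I. num j = l \<and> is_ext j \<and> mate j = 0} \<longleftrightarrow> j \<in> ext I l - fst ` mates l mate"
      using mem_ext[OF l, of j] by (cases "num j = l") auto
  qed
  then show z: "zc l = zval I l (mates l mate)" using C(7)[of l] zval_eq[OF mates_matching[OF l]] by simp
  have k: "nc l \<le> ncolors I l (mates l mate)"
  proof (cases "l \<le> nsta I")
    case True
    then show ?thesis using C(8)[of l] z by (simp add: ncolors_def)
  next
    case False
    \<comment> \<open>The last batch has no \<open>ext\<close>, so its bound reduces to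
      \<open>omega I\<close>, the number of colors granted there.\<close>
    then have "zc l = 0" using z ext_empty[of l] by (simp add: zval_def)
    then show ?thesis using C(8)[of l] False by (simp add: ncolors_def)
  qed
  have b: "j \<in> dels I" "num j = l" if "j \<in> batch I l" for j using mem_batch[OF l, of j] that by simp_all
  have "proper_coloring I l (ncolors I l (mates l mate)) (colmap col l)"
    unfolding proper_coloring_def
  proof (intro conjI ballI impI)
    show "dom (colmap col l) = batch I l" by (auto simp: colmap_def split: if_splits)
    have "c \<in> {1..ncolors I l (mates l mate)}" if "colmap col l j = Some c" for j c
    proof -
      have "j \<in> batch I l" "c = col j" using that by (auto simp: colmap_def split: if_splits)
      then show ?thesis using C(1)[OF b(1), of j] b(2)[of j] k by simp
    qed
    then show "ran (colmap col l) \<subseteq> {1..ncolors I l (mates l mate)}" unfolding ran_def by blast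
    show "colmap col l i \<noteq> colmap col l j" if "i \<in> batch I l" "j \<in> batch I l" "adj I i j" for i j
      using C(5)[OF b(1)[OF that(1)] b(1)[OF that(2)]] b(2)[OF that(1)] b(2)[OF that(2)] that
      by (auto simp: colmap_def)
  qed
  moreover have "colmap col l i = colmap col l j \<longleftrightarrow>
      i = j \<or> (i, j) \<in> mates l mate \<or> (j, i) \<in> mates l mate"
    if ij: "i \<in> ext I l" "j \<in> ext I l" for i j
  proof -
    have i: "i \<in> dels I" "num i = l" "is_ext i" and j: "j \<in> dels I" "num j = l" "is_ext j"
      using ij mem_ext[OF l, of i] mem_ext[OF l, of j] by blast+
    have m: "(x, y) \<in> mates l mate \<longleftrightarrow> mate x = y" if "x \<in> dels I" "num x = l" "y \<in> dels I" for x y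
    proof -
      have "y \<noteq> 0" using that(3) by auto
      moreover have "x \<in> lefts I l" if "mate x \<noteq> 0"
        using mate_left[OF that] \<open>num x = l\<close> by simp
      ultimately show ?thesis unfolding mem_mates by metis
    qed
    have "i \<in> batch I l" "j \<in> batch I l" using ij ext_subset by blast+
    then have "colmap col l i = colmap col l j \<longleftrightarrow> col i = col j" by (simp add: colmap_def)
    also have "\<dots> \<longleftrightarrow> i = j \<or> mate i = j \<or> mate j = i" using C(6)[of i j] i j by simp
    finally show ?thesis using m[OF i(1,2) j(1)] m[OF j(1,2) i(1)] by simp
  qed
  ultimately show "valid_coloring l (mates l mate) (colmap col l)"
    unfolding valid_coloring_def by blast
qed

end

section \<open>Greedy packing\<close>

text \<open>An outsider in one of the first two places would be followed by \<open>u\<close> or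
  \<open>v\<close>, whose larger value contradicts the order. It is used with the ends of
  deliveries, to see that a matched pair heads its color class.\<close>

lemma take_2_of_largest:
  fixes f :: "'a \<Rightarrow> 'b :: linorder"
  assumes xs: "sorted_wrt (\<lambda>x y. f y \<le> f x) xs" "distinct xs"
    and uv: "u \<in> set xs" "v \<in> set xs" "u \<noteq> v"
    and larger: "\<And>x. x \<in> set xs \<Longrightarrow> x \<noteq> u \<Longrightarrow> x \<noteq> v \<Longrightarrow> f x < f u \<and> f x < f v"
  shows "set (take 2 xs) = {u, v}"
proof -
  obtain a ys where a: "xs = a # ys" using uv(1) by (cases xs) auto
  have "ys \<noteq> []" using a uv by auto
  then obtain b zs where b: "ys = b # zs" by (cases ys) auto
  have au: "a = u \<or> a = v"
  proof (rule ccontr)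
    assume n: "\<not> (a = u \<or> a = v)"
    then have "f a < f u" using larger[of a] a by simp
    moreover have "u \<in> set ys" using uv(1) a n by auto
    then have "f u \<le> f a" using xs(1) a by simp
    ultimately show False by simp
  qed
  have bu: "b = u \<or> b = v"
  proof (rule ccontr)
    assume n: "\<not> (b = u \<or> b = v)"
    define w where "w = (if a = u then v else u)"
    have w: "w \<noteq> a" "w \<noteq> b" "w \<in> set xs" using au n uv by (auto simp: w_def)
    have "f b < f w" using larger[of b] n a b by (simp add: w_def)
    moreover have "w \<in> set zs" using w a b by simp
    then have "f w \<le> f b" using xs(1) a b by simp
    ultimately show False by simp
  qed
  have "a \<noteq> b" using xs(2) a b by simp
  then show ?thesis using au bu uv(3) a b by auto
qed

section \<open>Packing all color classes in one interleaved pass\<close>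

locale ddp_col = ddp_mate +
  fixes col :: "nat \<Rightarrow> nat"
  assumes col_valid: "l \<in> nums \<Longrightarrow> valid_coloring l (mates l mate) (colmap col l)"
begin

text \<open>A block is named by its founding delivery, a fixed point of \<open>blk\<close>; no
  separate numbering of blocks is needed.\<close>

definition block :: "nat \<Rightarrow> (nat \<Rightarrow> nat) \<Rightarrow> nat \<Rightarrow> nat set" where
  "block p blk i = {j \<in> seen p. blk j = i}"

definition reps :: "nat \<Rightarrow> (nat \<Rightarrow> nat) \<Rightarrow> nat \<Rightarrow> nat \<Rightarrow> nat set" where
  "reps p blk l c = {i \<in> seen p. blk i = i \<and> num i = l \<and> col i = c}"

definition class_list :: "nat \<Rightarrow> nat \<Rightarrow> nat \<Rightarrow> nat list" where
  "class_list p l c = filter (\<lambda>j. num j = l \<and> col j = c) (map Q [1..<p])"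

text \<open>The pass interleaves classes and batches; the last clause projects it to each class,
  where the blocks are an outcome of \<open>pack\<close> on the members in the order seen. Founders
  come first and hence end last, so whether a block meets \<open>ext\<close> can be read off its
  founder. \<open>rem\<close> is meaningful at founders only.\<close>

definition pack_inv :: "nat \<Rightarrow> (nat \<Rightarrow> nat) \<Rightarrow> (nat \<Rightarrow> real) \<Rightarrow> (nat \<Rightarrow> nat) \<Rightarrow> bool" where
  "pack_inv p blk rem nb \<longleftrightarrow>
     (\<forall>j. blk j \<noteq> 0 \<longrightarrow> j \<in> seen p) \<and>
     (\<forall>j\<in>seen p. blk j \<in> seen p \<and> blk (blk j) = blk j \<and> num (blk j) = num j \<and> col (blk j) = col j \<and>
        (is_ext j \<longrightarrow> is_ext (blk j))) \<and>
     (\<forall>i\<in>seen p. blk i = i \<longrightarrow> rem i = cap I - load (block p blk i)) \<and>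
     (\<forall>l. nb l = card {i \<in> seen p. blk i = i \<and> num i = l}) \<and>
     (\<forall>l c. Some (block p blk ` reps p blk l c) \<in> for_each (class_list p l c) (pack I) {})"

lemma pack_invD:
  assumes "pack_inv p blk rem nb"
  shows "\<And>j. blk j \<noteq> 0 \<Longrightarrow> j \<in> seen p"
    and "\<And>j. j \<in> seen p \<Longrightarrow> blk j \<in> seen p \<and> blk (blk j) = blk j \<and> num (blk j) = num j \<and>
      col (blk j) = col j \<and> (is_ext j \<longrightarrow> is_ext (blk j))"
    and "\<And>i. i \<in> seen p \<Longrightarrow> blk i = i \<Longrightarrow> rem i = cap I - load (block p blk i)"
    and "\<And>l. nb l = card {i \<in> seen p. blk i = i \<and> num i = l}"
    and "\<And>l c. Some (block p blk ` reps p blk l c) \<in> for_each (class_list p l c) (pack I) {}"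
proof -
  note c = assms[unfolded pack_inv_def]
  show "\<And>j. blk j \<noteq> 0 \<Longrightarrow> j \<in> seen p" using c[THEN conjunct1] by blast
  show "\<And>j. j \<in> seen p \<Longrightarrow> blk j \<in> seen p \<and> blk (blk j) = blk j \<and> num (blk j) = num j \<and>
      col (blk j) = col j \<and> (is_ext j \<longrightarrow> is_ext (blk j))"
    using c[THEN conjunct2, THEN conjunct1] by (rule bspec)
  show "\<And>i. i \<in> seen p \<Longrightarrow> blk i = i \<Longrightarrow> rem i = cap I - load (block p blk i)"
    using c[THEN conjunct2, THEN conjunct2, THEN conjunct1] by blast
  show "\<And>l. nb l = card {i \<in> seen p. blk i = i \<and> num i = l}"
    using c[THEN conjunct2, THEN conjunct2, THEN conjunct2, THEN conjunct1] by blast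
  show "\<And>l c. Some (block p blk ` reps p blk l c) \<in> for_each (class_list p l c) (pack I) {}"
    using c[THEN conjunct2, THEN conjunct2, THEN conjunct2, THEN conjunct2] by blast
qed

lemma pack_inv_init: "pack_inv 1 (\<lambda>_. 0) rem (\<lambda>_. 0)"
  by (simp add: pack_inv_def reps_def class_list_def)

lemma class_list_Suc:
  "1 \<le> p \<Longrightarrow> class_list (Suc p) l c =
    class_list p l c @ (if num (Q p) = l \<and> col (Q p) = c then [Q p] else [])"
  by (simp add: class_list_def)

lemma pack_inv_new:
  assumes p: "1 \<le> p" "p \<le> ndel I" and inv: "pack_inv p blk rem nb" and v: "v = Q p"
    and none: "\<And>i. i \<in> dels I \<Longrightarrow> blk i = i \<Longrightarrow> num i = num v \<Longrightarrow> col i = col v \<Longrightarrow> \<not> cost I v \<le> rem i"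
  shows "pack_inv (Suc p) (blk(v := v)) (rem(v := cap I - cost I v)) (nb(num v := Suc (nb (num v))))"
    (is "pack_inv _ ?blk ?rem ?nb")
proof -
  note C = pack_invD[OF inv]
  have s: "seen (Suc p) = insert v (seen p)" using seen_Suc[OF p(1)] v by simp
  have vs: "v \<notin> seen p" using Q_not_seen[OF p] v by simp
  have sd: "seen p \<subseteq> dels I" using seen_subset p by simp
  have ne: "i \<noteq> v" if "i \<in> seen p" for i using that vs by blast
  have bne: "blk j \<noteq> v" if "j \<in> seen p" for j using C(2)[OF that] vs by auto
  have blk_old: "block (Suc p) ?blk i = block p blk i" if "i \<in> seen p" for i
    using ne[OF that] vs unfolding block_def s by (auto dest: ne)
  have blk_new: "block (Suc p) ?blk v = {v}"
    using bne unfolding block_def s by (auto dest: ne split: if_splits)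
  have reps: "reps (Suc p) ?blk l c = (if num v = l \<and> col v = c then insert v (reps p blk l c) else reps p blk l c)"
    for l c
    using vs unfolding reps_def s by (auto dest: ne)
  have reps_seen: "reps p blk l c \<subseteq> seen p" for l c by (auto simp: reps_def)
  have images: "block (Suc p) ?blk ` reps p blk l c = block p blk ` reps p blk l c" for l c
    by (intro image_cong refl blk_old) (rule subsetD[OF reps_seen])
  have 1: "\<forall>j. ?blk j \<noteq> 0 \<longrightarrow> j \<in> seen (Suc p)"
    using C(1) unfolding s by auto
  have 2: "\<forall>j\<in>seen (Suc p). ?blk j \<in> seen (Suc p) \<and> ?blk (?blk j) = ?blk j \<and> num (?blk j) = num j \<and>
      col (?blk j) = col j \<and> (is_ext j \<longrightarrow> is_ext (?blk j))"
  proof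
    fix j assume j: "j \<in> seen (Suc p)"
    show "?blk j \<in> seen (Suc p) \<and> ?blk (?blk j) = ?blk j \<and> num (?blk j) = num j \<and>
      col (?blk j) = col j \<and> (is_ext j \<longrightarrow> is_ext (?blk j))"
    proof (cases "j = v")
      case True
      then show ?thesis unfolding s by simp
    next
      case False
      then have js: "j \<in> seen p" using j unfolding s by simp
      have "?blk j = blk j" "?blk (blk j) = blk (blk j)" using False bne[OF js] by simp_all
      then show ?thesis using C(2)[OF js] unfolding s by auto
    qed
  qed
  have 3: "\<forall>i\<in>seen (Suc p). ?blk i = i \<longrightarrow> ?rem i = cap I - load (block (Suc p) ?blk i)"
  proof (intro ballI impI)
    fix i assume i: "i \<in> seen (Suc p)" "?blk i = i"
    show "?rem i = cap I - load (block (Suc p) ?blk i)"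
    proof (cases "i = v")
      case True
      then show ?thesis using blk_new by simp
    next
      case False
      then show ?thesis using C(3)[of i] blk_old[of i] i unfolding s by simp
    qed
  qed
  have 4: "\<forall>l. ?nb l = card {i \<in> seen (Suc p). ?blk i = i \<and> num i = l}"
  proof
    fix l
    have "{i \<in> seen (Suc p). ?blk i = i \<and> num i = l} =
        (if num v = l then insert v {i \<in> seen p. blk i = i \<and> num i = l} else {i \<in> seen p. blk i = i \<and> num i = l})"
      using vs unfolding s by (auto dest: ne)
    then show "?nb l = card {i \<in> seen (Suc p). ?blk i = i \<and> num i = l}"
      using C(4)[of l] vs by (auto simp: card_insert_if)
  qed
  have 5: "\<forall>l c. Some (block (Suc p) ?blk ` reps (Suc p) ?blk l c) \<in> for_each (class_list (Suc p) l c) (pack I) {}"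
  proof (intro allI)
    fix l c
    show "Some (block (Suc p) ?blk ` reps (Suc p) ?blk l c) \<in> for_each (class_list (Suc p) l c) (pack I) {}"
    proof (cases "num v = l \<and> col v = c")
      case False
      then show ?thesis
        using C(5)[of l c] images[of l c] reps[of l c] class_list_Suc[OF p(1), of l c] v by auto
    next
      case True
      have "\<not> cost I v \<le> cap I - load X" if X: "X \<in> block p blk ` reps p blk l c" for X
      proof -
        obtain i where i: "i \<in> seen p" "blk i = i" "num i = l" "col i = c" "X = block p blk i"
          using X unfolding reps_def by blast
        then show ?thesis using none[of i] C(3)[of i] sd True by auto
      qed
      then have "Some (insert {v} (block p blk ` reps p blk l c)) \<in> pack I v (block p blk ` reps p blk l c)"
        unfolding pack_def by simp
      from Some_in_for_each_snoc[OF C(5)[of l c] this]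
      have "Some (insert {v} (block p blk ` reps p blk l c)) \<in> for_each (class_list (Suc p) l c) (pack I) {}"
        using True v class_list_Suc[OF p(1), of l c] by simp
      moreover have "block (Suc p) ?blk ` reps (Suc p) ?blk l c = insert {v} (block p blk ` reps p blk l c)"
        using True reps[of l c] images[of l c] blk_new by simp
      ultimately show ?thesis by simp
    qed
  qed
  show ?thesis unfolding pack_inv_def using 1 2 3 4 5 by (intro conjI)
qed

text \<open>The founder was processed before \<open>v\<close> and so ends no earlier; this is what
  carries membership in \<open>ext\<close> from \<open>v\<close> to the founder.\<close>

lemma pack_inv_join:
  assumes p: "1 \<le> p" "p \<le> ndel I" and inv: "pack_inv p blk rem nb" and v: "v = Q p"
    and i: "i \<in> dels I" "blk i = i" "num i = num v" "col i = col v" "cost I v \<le> rem i"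
  shows "pack_inv (Suc p) (blk(v := i)) (rem(i := rem i - cost I v)) nb"
    (is "pack_inv _ ?blk ?rem _")
proof -
  note C = pack_invD[OF inv]
  have s: "seen (Suc p) = insert v (seen p)" using seen_Suc[OF p(1)] v by simp
  have vs: "v \<notin> seen p" using Q_not_seen[OF p] v by simp
  have vd: "v \<in> dels I" using Q_dels[OF p] v by simp
  have iseen: "i \<in> seen p" using C(1)[of i] i(1,2) by auto
  have ne: "k \<noteq> v" if "k \<in> seen p" for k using that vs by blast
  have bne: "blk j \<noteq> v" if "j \<in> seen p" for j using C(2)[OF that] vs by auto
  have blk_old: "block (Suc p) ?blk k = block p blk k" if "k \<noteq> i" for k
    using that vs unfolding block_def s by (auto dest: ne)
  have blk_new: "block (Suc p) ?blk i = insert v (block p blk i)"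
    using vs unfolding block_def s by (auto dest: ne)
  have reps: "reps (Suc p) ?blk l c = reps p blk l c" for l c
    using ne[OF iseen] vs unfolding reps_def s by (auto dest: ne)
  have 1: "\<forall>j. ?blk j \<noteq> 0 \<longrightarrow> j \<in> seen (Suc p)"
    using C(1) unfolding s by auto
  have 2: "\<forall>j\<in>seen (Suc p). ?blk j \<in> seen (Suc p) \<and> ?blk (?blk j) = ?blk j \<and> num (?blk j) = num j \<and>
      col (?blk j) = col j \<and> (is_ext j \<longrightarrow> is_ext (?blk j))"
  proof
    fix j assume j: "j \<in> seen (Suc p)"
    show "?blk j \<in> seen (Suc p) \<and> ?blk (?blk j) = ?blk j \<and> num (?blk j) = num j \<and>
      col (?blk j) = col j \<and> (is_ext j \<longrightarrow> is_ext (?blk j))"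
    proof (cases "j = v")
      case True
      have "is_ext v \<longrightarrow> is_ext i"
        using ext_of_later[OF i(1) vd i(3)] seen_early[OF iseen p(2)] v by blast
      then show ?thesis using True iseen i ne[OF iseen] unfolding s by simp
    next
      case False
      then have js: "j \<in> seen p" using j unfolding s by simp
      have "?blk j = blk j" "?blk (blk j) = blk (blk j)" using False bne[OF js] by simp_all
      then show ?thesis using C(2)[OF js] unfolding s by auto
    qed
  qed
  have fin: "finite (block p blk i)" "v \<notin> block p blk i" using vs by (auto simp: block_def)
  have 3: "\<forall>k\<in>seen (Suc p). ?blk k = k \<longrightarrow> ?rem k = cap I - load (block (Suc p) ?blk k)"
  proof (intro ballI impI)
    fix k assume k: "k \<in> seen (Suc p)" "?blk k = k"
    have "k \<noteq> v" using k ne[OF iseen] by auto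
    then have k': "k \<in> seen p" "blk k = k" using k unfolding s by auto
    show "?rem k = cap I - load (block (Suc p) ?blk k)"
    proof (cases "k = i")
      case True
      then show ?thesis using blk_new C(3)[OF k'] fin by simp
    next
      case False
      then show ?thesis using C(3)[OF k'] blk_old[OF False] by simp
    qed
  qed
  have 4: "\<forall>l. nb l = card {i \<in> seen (Suc p). ?blk i = i \<and> num i = l}"
  proof
    fix l
    have "{i \<in> seen (Suc p). ?blk i = i \<and> num i = l} = {i \<in> seen p. blk i = i \<and> num i = l}"
      using vs ne[OF iseen] unfolding s by (auto dest: ne)
    then show "nb l = card {i \<in> seen (Suc p). ?blk i = i \<and> num i = l}"
      using C(4)[of l] by simp
  qed
  have 5: "\<forall>l c. Some (block (Suc p) ?blk ` reps (Suc p) ?blk l c) \<in> for_each (class_list (Suc p) l c) (pack I) {}"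
  proof (intro allI)
    fix l c
    show "Some (block (Suc p) ?blk ` reps (Suc p) ?blk l c) \<in> for_each (class_list (Suc p) l c) (pack I) {}"
    proof (cases "num v = l \<and> col v = c")
      case False
      then have "i \<notin> reps p blk l c" using i by (auto simp: reps_def)
      then have "block (Suc p) ?blk ` reps (Suc p) ?blk l c = block p blk ` reps p blk l c"
        unfolding reps by (intro image_cong refl blk_old) blast
      then show ?thesis using C(5)[of l c] class_list_Suc[OF p(1), of l c] v False by auto
    next
      case True
      have ir: "i \<in> reps p blk l c" using True iseen i by (simp add: reps_def)
      \<comment> \<open>A founder lies in the block it names and in no other, so removing the old
        block from the image removes exactly the founder \<open>i\<close>.\<close>
      have distinct: "block p blk k \<noteq> block p blk i" if "k \<noteq> i" for k
      proof -
        have "i \<in> block p blk i" "i \<notin> block p blk k" using iseen i(2) that by (auto simp: block_def)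
        then show ?thesis by blast
      qed
      have "cost I v \<le> cap I - load (block p blk i)" using i(5) C(3)[OF iseen i(2)] by simp
      then have "Some (insert (insert v (block p blk i)) (block p blk ` reps p blk l c - {block p blk i}))
          \<in> pack I v (block p blk ` reps p blk l c)"
        using ir unfolding pack_def by (auto simp: Some_in_bind)
      from Some_in_for_each_snoc[OF C(5)[of l c] this]
      have "Some (insert (insert v (block p blk i)) (block p blk ` reps p blk l c - {block p blk i}))
          \<in> for_each (class_list (Suc p) l c) (pack I) {}"
        using True v class_list_Suc[OF p(1), of l c] by simp
      moreover have "block (Suc p) ?blk ` reps (Suc p) ?blk l c =
          insert (insert v (block p blk i)) (block p blk ` reps p blk l c - {block p blk i})"
      proof -
        have "reps p blk l c = insert i (reps p blk l c - {i})" using ir by blast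
        then have "block (Suc p) ?blk ` reps (Suc p) ?blk l c =
            insert (insert v (block p blk i)) (block (Suc p) ?blk ` (reps p blk l c - {i}))"
          unfolding reps using blk_new by (metis image_insert)
        also have "block (Suc p) ?blk ` (reps p blk l c - {i}) = block p blk ` (reps p blk l c - {i})"
          by (intro image_cong refl blk_old) blast
        also have "\<dots> = block p blk ` reps p blk l c - {block p blk i}"
          using distinct by blast
        finally show ?thesis .
      qed
      ultimately show ?thesis by simp
    qed
  qed
  show ?thesis unfolding pack_inv_def using 1 2 3 4 5 by (intro conjI)
qed

definition all_blocks :: "(nat \<Rightarrow> nat) \<Rightarrow> nat \<Rightarrow> nat set set" where
  "all_blocks blk l = (\<lambda>i. {j \<in> dels I. blk j = i}) ` {i \<in> dels I. blk i = i \<and> num i = l}"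

text \<open>In a class with a matched pair no third member belongs to \<open>ext\<close>. The pair
  reaches \<open>tA I l\<close> and the other members end before it, so sorting by end puts the pair
  first.\<close>

lemma class_list_order:
  assumes l: "l \<in> nums"
  shows "pack_order (mates l mate) {j \<in> batch I l. colmap col l j = Some c} (class_list (Suc (ndel I)) l c)"
proof -
  let ?xs = "class_list (Suc (ndel I)) l c" and ?C = "{j \<in> batch I l. colmap col l j = Some c}"
  let ?M = "mates l mate"
  have set_upt: "set [1..<Suc (ndel I)] = {1..ndel I}" by auto
  have "distinct (map Q [1..<Suc (ndel I)])"
    using Q_bij unfolding distinct_map set_upt bij_betw_def by simp
  then have dist: "distinct ?xs" unfolding class_list_def by (rule distinct_filter)
  have C: "j \<in> ?C \<longleftrightarrow> j \<in> dels I \<and> num j = l \<and> col j = c" for j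
    using mem_batch[OF l, of j] by (auto simp: colmap_def)
  have "set (map Q [1..<Suc (ndel I)]) = dels I"
    using Q_bij unfolding set_map set_upt bij_betw_def by simp
  then have "set ?xs = {j \<in> dels I. num j = l \<and> col j = c}"
    unfolding class_list_def set_filter by blast
  then have set: "set ?xs = ?C" using C by blast
  have "sorted_wrt (\<lambda>p q. tR I (Q q) \<le> tR I (Q p)) [1..<Suc (ndel I)]"
    by (rule sorted_wrt_mono_rel[OF _ sorted_wrt_upt]) (use Q_order in auto)
  then have sorted: "sorted_wrt (\<lambda>x y. tR I y \<le> tR I x) ?xs"
    unfolding class_list_def by (intro sorted_wrt_filter) (simp only: sorted_wrt_map)
  note M = mates_matching[OF l]
  have val: "colmap col l i = colmap col l j \<longleftrightarrow> i = j \<or> (i, j) \<in> ?M \<or> (j, i) \<in> ?M"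
    if "i \<in> ext I l" "j \<in> ext I l" for i j
    using col_valid[OF l] that unfolding valid_coloring_def by blast
  have "set (take 2 ?xs) = {u, v}" if uv: "(u, v) \<in> ?M" "u \<in> ?C" for u v
  proof (rule take_2_of_largest[OF sorted dist])
    have ul: "u \<in> lefts I l" and vr: "v \<in> rights I l" using matching_mem[OF M uv(1)] by simp_all
    then have ue: "u \<in> ext I l" "v \<in> ext I l" by simp_all
    then have "colmap col l u = colmap col l v" using val uv(1) by blast
    then have vC: "v \<in> ?C" using uv(2) ue ext_subset by auto
    show "u \<in> set ?xs" "v \<in> set ?xs" unfolding set by (rule uv(2), rule vC)
    show "u \<noteq> v" using ul vr lefts_rights_disjoint by blast
    fix x assume x: "x \<in> set ?xs" "x \<noteq> u" "x \<noteq> v"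
    then have xC: "x \<in> ?C" using set by simp
    have "x \<notin> ext I l"
    proof
      assume xe: "x \<in> ext I l"
      have "colmap col l x = colmap col l u" using xC uv(2) by simp
      then have "(x, u) \<in> ?M \<or> (u, x) \<in> ?M" using val[OF xe ue(1)] x(2) by blast
      moreover have "(x, u) \<notin> ?M" using matching_mem[OF M, of x u] ul lefts_rights_disjoint by blast
      ultimately show False using matching_fst[OF M uv(1)] x(3) by blast
    qed
    moreover have l1: "1 \<le> l" "l \<le> nsta I" using l ul by (auto simp: lefts_iff)
    ultimately have "tR I x < tA I l" using ext_iff[OF l1(1), of x] xC by auto
    moreover have "tA I l \<le> tR I u" "tA I l \<le> tR I v" using ext_iff[OF l1(1)] ue by blast+
    ultimately show "tR I x < tR I u \<and> tR I x < tR I v" by simp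
  qed
  then show ?thesis unfolding pack_order_def using dist set by blast
qed

text \<open>The projections of the interleaved pass are glued together color by color, in the order
  that \<open>pack_batch\<close> prescribes; colors without deliveries contribute no blocks.\<close>

lemma pack_inv_final:
  assumes inv: "pack_inv (Suc (ndel I)) blk rem nb" and l: "l \<in> nums"
  shows "Some (all_blocks blk l, zval I l (mates l mate)) \<in> process_batch I l"
proof -
  note C = pack_invD[OF inv]
  let ?M = "mates l mate" and ?n = "Suc (ndel I)"
  define g where "g cs = (\<Union>c\<in>set cs. block ?n blk ` reps ?n blk l c)" for cs
  have "Some (g [1..<ncolors I l ?M + 1]) \<in> pack_batch I l ?M (colmap col l)"
  proof -
    have "Some (g [1..<ncolors I l ?M + 1]) \<in> for_each [1..<ncolors I l ?M + 1]
       (\<lambda>c Bs. pick (pack_order ?M {j \<in> batch I l. colmap col l j = Some c}) \<triangleright>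
               (\<lambda>xs. for_each xs (pack I) {}) \<triangleright>
               (\<lambda>Bs'. ret (Bs \<union> Bs'))) (g [])"
    proof (rule Some_in_for_each)
      fix cs c ds
      have "g (cs @ [c]) = g cs \<union> block ?n blk ` reps ?n blk l c" by (auto simp: g_def)
      then show "Some (g (cs @ [c])) \<in> pick (pack_order ?M {j \<in> batch I l. colmap col l j = Some c}) \<triangleright>
               (\<lambda>xs. for_each xs (pack I) {}) \<triangleright> (\<lambda>Bs'. ret (g cs \<union> Bs'))"
        using C(5)[of l c] class_list_order[OF l, of c]
        unfolding Some_in_bind Some_in_pick Some_in_ret by blast
    qed
    then show ?thesis by (simp add: pack_batch_def g_def)
  qed
  moreover have "g [1..<ncolors I l ?M + 1] = all_blocks blk l"
  proof -
    have set: "set [1..<ncolors I l ?M + 1] = {1..ncolors I l ?M}" by auto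
    have "col i \<in> {1..ncolors I l ?M}" if "i \<in> dels I" "num i = l" for i
    proof -
      have "colmap col l i = Some (col i)" using mem_batch[OF l, of i] that by (simp add: colmap_def)
      then show ?thesis
        using col_valid[OF l] unfolding valid_coloring_def proper_coloring_def ran_def by blast
    qed
    then have "(\<Union>c\<in>{1..ncolors I l ?M}. reps ?n blk l c) = {i \<in> dels I. blk i = i \<and> num i = l}"
      unfolding reps_def seen_all by blast
    moreover have "block ?n blk = (\<lambda>i. {j \<in> dels I. blk j = i})"
      unfolding block_def seen_all ..
    ultimately show ?thesis unfolding g_def set all_blocks_def by (metis image_UN)
  qed
  moreover have "Some (colmap col l) \<in> color_batch I l ?M"
    by (rule color_batch_complete[OF mates_matching[OF l] col_valid[OF l]])
  ultimately show ?thesis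
    unfolding process_batch_def Some_in_bind Some_in_pick Some_in_ret using mates_max[OF l] by auto
qed

end

section \<open>Greedy choice of the drones\<close>

locale ddp_packed = ddp_col +
  fixes blk :: "nat \<Rightarrow> nat" and nb zc :: "nat \<Rightarrow> nat"
  assumes blk: "j \<in> dels I \<Longrightarrow> blk j \<in> dels I \<and> blk (blk j) = blk j \<and> num (blk j) = num j \<and>
      (is_ext j \<longrightarrow> is_ext (blk j))"
    and nb: "nb l = card {i \<in> dels I. blk i = i \<and> num i = l}"
    and processed: "l \<in> nums \<Longrightarrow> Some (all_blocks blk l, zc l) \<in> process_batch I l"
begin

definition m :: nat where "m = Max (nb ` nums) + Max (zc ` nums)"

definition members :: "nat \<Rightarrow> nat set" where "members i = {j \<in> dels I. blk j = i}"

lemma all_blocks_eq: "all_blocks blk l = members ` {i \<in> dels I. blk i = i \<and> num i = l}"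
  unfolding all_blocks_def members_def ..

lemma members_inj: "inj_on members {i \<in> dels I. blk i = i \<and> P i}"
proof (rule inj_onI)
  fix x y assume x: "x \<in> {i \<in> dels I. blk i = i \<and> P i}" and eq: "members x = members y"
  have "x \<in> members x" using x by (simp add: members_def)
  then have "blk x = y" unfolding eq by (simp add: members_def)
  then show "x = y" using x by simp
qed

lemma card_all_blocks: "card (all_blocks blk l) = nb l"
  unfolding all_blocks_eq nb by (rule card_image[OF members_inj])

lemma blocks_locale: "ddp_blocks I (all_blocks blk) zc m"
proof
  show "good_blocks l (all_blocks blk l) (zc l)" if "l \<in> nums" for l
    using always_process_batch[OF that] processed[OF that] unfolding always_def by fastforce
  show "card (all_blocks blk l) + zc k \<le> m" if "l \<in> nums" "k \<in> nums" for l k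
    unfolding m_def card_all_blocks using that by (intro add_mono Max_ge) auto
qed

sublocale ddp_blocks I "all_blocks blk" zc m by (rule blocks_locale)

lemma members_ext: "l \<in> nums \<Longrightarrow> i \<in> dels I \<Longrightarrow> blk i = i \<Longrightarrow> num i = l \<Longrightarrow>
    members i \<inter> ext I l \<noteq> {} \<longleftrightarrow> is_ext i"
proof
  assume l: "l \<in> nums" and i: "i \<in> dels I" "blk i = i" "num i = l"
  show "is_ext i" if "members i \<inter> ext I l \<noteq> {}"
  proof -
    from that obtain j where j: "j \<in> dels I" "blk j = i" "j \<in> ext I l" unfolding members_def by blast
    then have "is_ext j" using mem_ext[OF l, of j] by blast
    then show ?thesis using blk[OF j(1)] unfolding j(2) by blast
  qed
  show "members i \<inter> ext I l \<noteq> {}" if "is_ext i"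
    using that i unfolding members_def by blast
qed

lemma card_ext_reps:
  assumes l: "l \<in> nums"
  shows "card {i \<in> dels I. blk i = i \<and> num i = l \<and> is_ext i} \<le> zc l"
proof -
  have "card {i \<in> dels I. blk i = i \<and> num i = l \<and> is_ext i} =
      card (members ` {i \<in> dels I. blk i = i \<and> num i = l \<and> is_ext i})"
    by (rule card_image[OF members_inj, symmetric])
  also have "\<dots> \<le> card {X \<in> all_blocks blk l. X \<inter> ext I l \<noteq> {}}"
  proof (rule card_mono)
    show "finite {X \<in> all_blocks blk l. X \<inter> ext I l \<noteq> {}}" using finite_blocks[OF l] by simp
    show "members ` {i \<in> dels I. blk i = i \<and> num i = l \<and> is_ext i} \<subseteq> {X \<in> all_blocks blk l. X \<inter> ext I l \<noteq> {}}"
      using members_ext[OF l] unfolding all_blocks_eq by blast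
  qed
  also have "\<dots> \<le> zc l" using good[OF l] unfolding good_blocks_def by blast
  finally show ?thesis .
qed

text \<open>\<open>R\<close> contains the founders served so far. \<open>dl d\<close> is the last
  batch in which drone \<open>d\<close> is used, and \<open>dx d\<close> is the batch after the last
  one in which it serves \<open>ext\<close>, that is, the batch it must sit out; 0 means
  never.\<close>

definition drone_inv :: "nat set \<Rightarrow> (nat \<Rightarrow> nat) \<Rightarrow> (nat \<Rightarrow> nat) \<Rightarrow> (nat \<Rightarrow> nat) \<Rightarrow> bool" where
  "drone_inv R dr dl dx \<longleftrightarrow>
     (\<forall>i\<in>R. dr i \<in> {1..m}) \<and>
     (\<forall>i\<in>R. \<forall>k\<in>R. i \<noteq> k \<longrightarrow> num i = num k \<longrightarrow> dr i \<noteq> dr k) \<and>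
     (\<forall>i\<in>R. \<forall>k\<in>R. is_ext k \<longrightarrow> num i = Suc (num k) \<longrightarrow> dr i \<noteq> dr k) \<and>
     (\<forall>d. dl d \<noteq> 0 \<longrightarrow> (\<exists>i\<in>R. dr i = d \<and> num i = dl d)) \<and>
     (\<forall>i\<in>R. num i \<le> dl (dr i)) \<and>
     (\<forall>d. dx d \<noteq> 0 \<longrightarrow> (\<exists>i\<in>R. is_ext i \<and> dr i = d \<and> Suc (num i) = dx d)) \<and>
     (\<forall>i\<in>R. is_ext i \<longrightarrow> Suc (num i) \<le> dx (dr i))"

lemma drone_invD:
  assumes "drone_inv R dr dl dx"
  shows "\<And>i. i \<in> R \<Longrightarrow> dr i \<in> {1..m}"
    and "\<And>i k. i \<in> R \<Longrightarrow> k \<in> R \<Longrightarrow> i \<noteq> k \<Longrightarrow> num i = num k \<Longrightarrow> dr i \<noteq> dr k"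
    and "\<And>i k. i \<in> R \<Longrightarrow> k \<in> R \<Longrightarrow> is_ext k \<Longrightarrow> num i = Suc (num k) \<Longrightarrow> dr i \<noteq> dr k"
    and "\<And>d. dl d \<noteq> 0 \<Longrightarrow> \<exists>i\<in>R. dr i = d \<and> num i = dl d"
    and "\<And>i. i \<in> R \<Longrightarrow> num i \<le> dl (dr i)"
    and "\<And>d. dx d \<noteq> 0 \<Longrightarrow> \<exists>i\<in>R. is_ext i \<and> dr i = d \<and> Suc (num i) = dx d"
    and "\<And>i. i \<in> R \<Longrightarrow> is_ext i \<Longrightarrow> Suc (num i) \<le> dx (dr i)"
proof -
  note c = assms[unfolded drone_inv_def]
  show "\<And>i. i \<in> R \<Longrightarrow> dr i \<in> {1..m}" using c[THEN conjunct1] by blast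
  show "\<And>i k. i \<in> R \<Longrightarrow> k \<in> R \<Longrightarrow> i \<noteq> k \<Longrightarrow> num i = num k \<Longrightarrow> dr i \<noteq> dr k"
    using c[THEN conjunct2, THEN conjunct1] by blast
  show "\<And>i k. i \<in> R \<Longrightarrow> k \<in> R \<Longrightarrow> is_ext k \<Longrightarrow> num i = Suc (num k) \<Longrightarrow> dr i \<noteq> dr k"
    using c[THEN conjunct2, THEN conjunct2, THEN conjunct1] by blast
  show "\<And>d. dl d \<noteq> 0 \<Longrightarrow> \<exists>i\<in>R. dr i = d \<and> num i = dl d"
    using c[THEN conjunct2, THEN conjunct2, THEN conjunct2, THEN conjunct1] by blast
  show "\<And>i. i \<in> R \<Longrightarrow> num i \<le> dl (dr i)"
    using c[THEN conjunct2, THEN conjunct2, THEN conjunct2, THEN conjunct2, THEN conjunct1] by blast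
  show "\<And>d. dx d \<noteq> 0 \<Longrightarrow> \<exists>i\<in>R. is_ext i \<and> dr i = d \<and> Suc (num i) = dx d"
    using c[THEN conjunct2, THEN conjunct2, THEN conjunct2, THEN conjunct2, THEN conjunct2, THEN conjunct1] by blast
  show "\<And>i. i \<in> R \<Longrightarrow> is_ext i \<Longrightarrow> Suc (num i) \<le> dx (dr i)"
    using c[THEN conjunct2, THEN conjunct2, THEN conjunct2, THEN conjunct2, THEN conjunct2, THEN conjunct2] by blast
qed

lemma drone_inv_init: "drone_inv {} dr (\<lambda>_. 0) (\<lambda>_. 0)"
  by (simp add: drone_inv_def)

text \<open>The excluded drones serve other blocks of the same batch, fewer than \<open>nb\<close>
  because \<open>v\<close> is still waiting, or \<open>ext\<close> blocks of the preceding batch, at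
  most \<open>zc\<close> many. Together these are fewer than \<open>m\<close>, so the search
  succeeds.\<close>

lemma drone_inv_step:
  assumes inv: "drone_inv R dr dl dx"
    and R: "R \<subseteq> {i \<in> dels I. blk i = i}" "\<And>i. i \<in> R \<Longrightarrow> num i \<le> num v"
    and v: "v \<in> dels I" "blk v = v" "v \<notin> R"
    and d: "best (\<lambda>d. dl d \<noteq> num v \<and> dx d \<noteq> num v) K m d"
  shows "drone_inv (insert v R) (dr(v := d)) (dl(d := num v)) (if is_ext v then dx(d := Suc (num v)) else dx)"
    (is "drone_inv _ ?dr ?dl ?dx")
proof -
  note C = drone_invD[OF inv]
  have l: "num v \<in> nums" using num[OF v(1)] by simp
  have "d \<noteq> 0"
  proof
    assume "d = 0"
    then have full: "dl d = num v \<or> dx d = num v" if "d \<in> {1..m}" for d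
      using d that unfolding best_def by auto
    define A where "A = {i \<in> R. num i = num v}"
    define E where "E = {i \<in> R. is_ext i \<and> Suc (num i) = num v}"
    have "R \<subseteq> dels I" using R(1) by blast
    then have finR: "finite R" by (rule finite_subset) simp
    have "{1..m} \<subseteq> dr ` A \<union> dr ` E"
    proof
      fix d assume "d \<in> {1..m}"
      from full[OF this] show "d \<in> dr ` A \<union> dr ` E"
      proof
        assume "dl d = num v"
        then show ?thesis using C(4)[of d] l unfolding A_def by auto
      next
        assume "dx d = num v"
        then show ?thesis using C(6)[of d] l unfolding E_def by auto
      qed
    qed
    then have "card {1..m} \<le> card (dr ` A \<union> dr ` E)"
      using finR by (intro card_mono) (auto simp: A_def E_def)
    also have "\<dots> \<le> card (dr ` A) + card (dr ` E)" by (rule card_Un_le)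
    also have "\<dots> \<le> card A + card E"
      using finR by (intro add_mono card_image_le) (auto simp: A_def E_def)
    finally have le: "m \<le> card A + card E" by simp
    have "A \<subseteq> {i \<in> dels I. blk i = i \<and> num i = num v} - {v}"
      using R(1) v(3) unfolding A_def by blast
    then have "card A \<le> card ({i \<in> dels I. blk i = i \<and> num i = num v} - {v})"
      by (intro card_mono) auto
    also have "\<dots> < nb (num v)"
      unfolding nb using v by (intro card_Diff1_less) auto
    finally have A: "card A < nb (num v)" .
    show False
    proof (cases "num v = 1")
      case True
      have "num i \<noteq> 0" if "i \<in> R" for i
      proof -
        have "i \<in> dels I" using that R(1) by blast
        from num(1)[OF this] show ?thesis by simp
      qed
      then have E: "E = {}" using True unfolding E_def by auto
      have "nb (num v) \<le> m" using enough[OF l l] card_all_blocks by simp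
      then show False using A le unfolding E by simp
    next
      case False
      then have l': "num v - 1 \<in> nums" using l by auto
      have "E \<subseteq> {i \<in> dels I. blk i = i \<and> num i = num v - 1 \<and> is_ext i}"
        using R(1) unfolding E_def by auto
      then have "card E \<le> card {i \<in> dels I. blk i = i \<and> num i = num v - 1 \<and> is_ext i}"
        by (intro card_mono) auto
      also have "\<dots> \<le> zc (num v - 1)" by (rule card_ext_reps[OF l'])
      finally show False using A le enough[OF l l'] card_all_blocks by simp
    qed
  qed
  then have dm: "d \<in> {1..m}" and dl: "dl d \<noteq> num v" and dx: "dx d \<noteq> num v"
    using d unfolding best_def by auto
  have ne: "i \<noteq> v" if "i \<in> R" for i using that v(3) by blast
  \<comment> \<open>Blocks arrive by non-decreasing batch number, so a mark that is at least
    \<open>num v\<close> equals \<open>num v\<close>; therefore the program's test for equality is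
    enough.\<close>
  have free1: "dr i \<noteq> d" if i: "i \<in> R" "num i = num v" for i
  proof
    assume "dr i = d"
    then have ge: "num v \<le> dl d" using C(5)[OF i(1)] i(2) by simp
    then have "dl d \<noteq> 0" using l by auto
    then obtain k where "k \<in> R" "num k = dl d" using C(4) by blast
    then show False using R(2)[of k] ge dl by simp
  qed
  have free2: "dr i \<noteq> d" if i: "i \<in> R" "is_ext i" "num v = Suc (num i)" for i
  proof
    assume "dr i = d"
    then have ge: "num v \<le> dx d" using C(7)[OF i(1,2)] i(3) by simp
    then have "dx d \<noteq> 0" using l by auto
    then obtain k where k: "k \<in> R" "dr k = d" "Suc (num k) = dx d" using C(6) by blast
    then have "num k = num v" using R(2)[of k] ge dx by simp
    then show False using free1 k by blast
  qed
  have 1: "\<forall>i\<in>insert v R. ?dr i \<in> {1..m}" using dm C(1) by auto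
  have 2: "\<forall>i\<in>insert v R. \<forall>k\<in>insert v R. i \<noteq> k \<longrightarrow> num i = num k \<longrightarrow> ?dr i \<noteq> ?dr k"
  proof (intro ballI impI)
    fix i k assume ik: "i \<in> insert v R" "k \<in> insert v R" "i \<noteq> k" "num i = num k"
    then consider "i = v" "k \<in> R" | "k = v" "i \<in> R" | "i \<in> R" "k \<in> R" by blast
    then show "?dr i \<noteq> ?dr k"
    proof cases
      case 1
      then show ?thesis using free1[OF 1(2)] ik ne[OF 1(2)] by simp
    next
      case 2
      then show ?thesis using free1[OF 2(2)] ik ne[OF 2(2)] by simp
    next
      case 3
      then show ?thesis using C(2)[OF 3] ik ne[OF 3(1)] ne[OF 3(2)] by simp
    qed
  qed
  have 3: "\<forall>i\<in>insert v R. \<forall>k\<in>insert v R. is_ext k \<longrightarrow> num i = Suc (num k) \<longrightarrow> ?dr i \<noteq> ?dr k"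
  proof (intro ballI impI)
    fix i k assume ik: "i \<in> insert v R" "k \<in> insert v R" "is_ext k" "num i = Suc (num k)"
    then consider "i = v" "k \<in> R" | "k = v" "i \<in> R" | "i \<in> R" "k \<in> R" by auto
    then show "?dr i \<noteq> ?dr k"
    proof cases
      case 1
      have "num v = Suc (num k)" using ik(4) 1(1) by simp
      then show ?thesis using free2[OF 1(2) ik(3)] ne[OF 1(2)] 1(1) by simp
    next
      case 2
      then show ?thesis using R(2)[OF 2(2)] ik(4) by simp
    next
      case 3
      then show ?thesis using C(3)[OF 3 ik(3,4)] ne[OF 3(1)] ne[OF 3(2)] by simp
    qed
  qed
  have 4: "\<forall>d'. ?dl d' \<noteq> 0 \<longrightarrow> (\<exists>i\<in>insert v R. ?dr i = d' \<and> num i = ?dl d')"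
  proof (intro allI impI)
    fix d' assume a: "?dl d' \<noteq> 0"
    show "\<exists>i\<in>insert v R. ?dr i = d' \<and> num i = ?dl d'"
    proof (cases "d' = d")
      case False
      then obtain i where "i \<in> R" "dr i = d'" "num i = dl d'" using C(4)[of d'] a by auto
      then show ?thesis using ne[of i] False by (intro bexI[of _ i]) auto
    qed simp
  qed
  have 5: "\<forall>i\<in>insert v R. num i \<le> ?dl (?dr i)"
  proof
    fix i assume "i \<in> insert v R"
    then show "num i \<le> ?dl (?dr i)" using C(5)[of i] R(2)[of i] ne[of i] by (cases "i = v") auto
  qed
  have 6: "\<forall>d'. ?dx d' \<noteq> 0 \<longrightarrow> (\<exists>i\<in>insert v R. is_ext i \<and> ?dr i = d' \<and> Suc (num i) = ?dx d')"
  proof (intro allI impI)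
    fix d' assume a: "?dx d' \<noteq> 0"
    show "\<exists>i\<in>insert v R. is_ext i \<and> ?dr i = d' \<and> Suc (num i) = ?dx d'"
    proof (cases "is_ext v \<and> d' = d")
      case True
      then show ?thesis by (intro bexI[of _ v]) auto
    next
      case False
      then have eq: "?dx d' = dx d'" by auto
      then have "dx d' \<noteq> 0" using a by simp
      then obtain i where i: "i \<in> R" "is_ext i" "dr i = d'" "Suc (num i) = dx d'" using C(6) by blast
      show ?thesis using i ne[OF i(1)] unfolding eq by (intro bexI[of _ i]) simp_all
    qed
  qed
  have 7: "\<forall>i\<in>insert v R. is_ext i \<longrightarrow> Suc (num i) \<le> ?dx (?dr i)"
  proof (intro ballI impI)
    fix i assume i: "i \<in> insert v R" "is_ext i"
    show "Suc (num i) \<le> ?dx (?dr i)"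
    proof (cases "i = v")
      case True
      then show ?thesis using i(2) by simp
    next
      case False
      then have iR: "i \<in> R" using i(1) by simp
      have "Suc (num i) \<le> dx (dr i)" "num i \<le> num v" using C(7)[OF iR i(2)] R(2)[OF iR] by simp_all
      then show ?thesis using False by simp
    qed
  qed
  show ?thesis unfolding drone_inv_def using 1 2 3 4 5 6 7 by (intro conjI)
qed

text \<open>A drone omits the swap at \<open>l\<close> exactly if it serves a delivery of
  \<open>ext I l\<close>, and exactly these deliveries carry \<open>skip = l\<close>. The
  complementary encoding of swaps in the output thus decodes to \<open>assignment\<close>, and the
  batch results and drone choices combine to one run of \<open>mod_alg\<close>.\<close>

lemma drone_inv_final:
  assumes inv: "drone_inv {i \<in> dels I. blk i = i} dr dl dx"
    and drone: "\<And>j. j \<in> dels I \<Longrightarrow> drone j = dr (blk j)"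
    and skip: "\<And>j. j \<in> dels I \<Longrightarrow> skip j = (if is_ext j then num j else 0)"
  shows "Some (m, \<lambda>d. if d \<in> {1..m}
              then Del ` {j \<in> dels I. drone j = d} \<union>
                   Swap ` {l \<in> stas I. \<forall>j\<in>dels I. drone j = d \<longrightarrow> skip j \<noteq> l}
              else {}) \<in> mod_alg I" (is "Some (m, ?A) \<in> _")
proof -
  note C = drone_invD[OF inv]
  let ?ls = "[1..<nsta I + 2]"
  have nums: "set ?ls = nums" by auto
  \<comment> \<open>All members of a block have the same drone, so the arbitrary member taken here
    does not matter.\<close>
  define f where "f l X = drone (SOME j. j \<in> X)" for l :: nat and X
  have f: "f l (members i) = dr i" if "i \<in> dels I" "blk i = i" for l i
  proof -
    have "i \<in> members i" using that by (simp add: members_def)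
    then have "(SOME j. j \<in> members i) \<in> members i" by (rule someI)
    then show ?thesis using drone unfolding f_def members_def by simp
  qed
  have ext: "d \<in> ext_drones f l \<longleftrightarrow> (\<exists>i\<in>dels I. blk i = i \<and> num i = l \<and> is_ext i \<and> dr i = d)"
    if l: "l \<in> nums" for l d
  proof -
    have "{X \<in> all_blocks blk l. X \<inter> ext I l \<noteq> {}} = members ` {i \<in> dels I. blk i = i \<and> num i = l \<and> is_ext i}"
      using members_ext[OF l] unfolding all_blocks_eq by blast
    then have "ext_drones f l = f l ` members ` {i \<in> dels I. blk i = i \<and> num i = l \<and> is_ext i}"
      using l by (simp add: ext_drones_def)
    then show ?thesis using f by (auto simp: image_iff)
  qed
  have adm: "admissible f l" if l: "l \<in> nums" for l
    unfolding admissible_def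
  proof
    show "inj_on (f l) (all_blocks blk l)"
    proof (rule inj_onI)
      fix X Y assume XY: "X \<in> all_blocks blk l" "Y \<in> all_blocks blk l" "f l X = f l Y"
      obtain i where i: "i \<in> dels I" "blk i = i" "num i = l" "X = members i" using XY(1) unfolding all_blocks_eq by blast
      obtain k where k: "k \<in> dels I" "blk k = k" "num k = l" "Y = members k" using XY(2) unfolding all_blocks_eq by blast
      have "dr i = dr k" using f i k XY(3) by metis
      then have "i = k" using C(2)[of i k] i k by auto
      then show "X = Y" using i k by simp
    qed
    show "f l ` all_blocks blk l \<subseteq> {1..m} - ext_drones f (l - 1)"
    proof
      fix d assume "d \<in> f l ` all_blocks blk l"
      then obtain i where i: "i \<in> dels I" "blk i = i" "num i = l" "d = dr i"
        unfolding all_blocks_eq using f by auto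
      have "d \<notin> ext_drones f (l - 1)"
      proof (cases "l = 1")
        case True
        then show ?thesis by (simp add: ext_drones_def)
      next
        case False
        then have l': "l - 1 \<in> nums" using l by auto
        show ?thesis
        proof
          assume "d \<in> ext_drones f (l - 1)"
          then obtain k where k: "k \<in> dels I" "blk k = k" "num k = l - 1" "is_ext k" "dr k = d"
            using ext[OF l'] by blast
          have "num i = Suc (num k)" using i(3) k(3) l False by simp
          then have "dr i \<noteq> dr k" using C(3)[of i k] i k by simp
          then show False using i(4) k(5) by simp
        qed
      qed
      then show "d \<in> {1..m} - ext_drones f (l - 1)" using C(1)[of i] i by simp
    qed
  qed
  have dr_m: "drone j \<in> {1..m}" if "j \<in> dels I" for j
    using C(1)[of "blk j"] blk[OF that] drone[OF that] by simp
  have dels: "Del j \<in> assignment f ?ls d \<longleftrightarrow> j \<in> dels I \<and> drone j = d" for j d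
  proof
    assume "Del j \<in> assignment f ?ls d"
    then obtain l X where lX: "l \<in> nums" "X \<in> all_blocks blk l" "f l X = d" "j \<in> X"
      unfolding Del_mem_assignment nums by blast
    then obtain i where i: "i \<in> dels I" "blk i = i" "X = members i" unfolding all_blocks_eq by blast
    then have "j \<in> dels I" "blk j = i" using lX(4) by (simp_all add: members_def)
    then show "j \<in> dels I \<and> drone j = d" using drone[of j] f[OF i(1,2), of l] i lX(3) by simp
  next
    assume j: "j \<in> dels I \<and> drone j = d"
    then have b: "blk j \<in> dels I" "blk (blk j) = blk j" using blk by blast+
    have "members (blk j) \<in> all_blocks blk (num (blk j))" using b unfolding all_blocks_eq by blast
    moreover have "f (num (blk j)) (members (blk j)) = d" using f[OF b] drone[of j] j by metis
    moreover have "j \<in> members (blk j)" using j by (simp add: members_def)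
    moreover have "num (blk j) \<in> nums" using num(1)[OF b(1)] .
    ultimately show "Del j \<in> assignment f ?ls d" unfolding Del_mem_assignment nums by blast
  qed
  have swaps: "Swap l \<in> assignment f ?ls d \<longleftrightarrow> l \<in> stas I \<and> d \<in> {1..m} \<and> (\<forall>j\<in>dels I. drone j = d \<longrightarrow> skip j \<noteq> l)"
    for l d
  proof -
    have "Swap l \<in> assignment f ?ls d \<longleftrightarrow> l \<in> stas I \<and> d \<in> {1..m} \<and> d \<notin> ext_drones f l"
      unfolding assignment_def nums by auto
    moreover have "d \<in> ext_drones f l \<longleftrightarrow> (\<exists>j\<in>dels I. drone j = d \<and> skip j = l)" if l: "l \<in> stas I"
    proof
      have ln: "l \<in> nums" using l by simp
      show "\<exists>j\<in>dels I. drone j = d \<and> skip j = l" if "d \<in> ext_drones f l"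
      proof -
        from that obtain i where i: "i \<in> dels I" "blk i = i" "num i = l" "is_ext i" "dr i = d"
          using ext[OF ln] by blast
        have "drone i = d" "skip i = l" using drone[OF i(1)] skip[OF i(1)] i(2,5) i(3,4) by simp_all
        then show ?thesis using i(1) by blast
      qed
      show "d \<in> ext_drones f l" if "\<exists>j\<in>dels I. drone j = d \<and> skip j = l"
      proof -
        from that obtain j where j: "j \<in> dels I" "drone j = d" "skip j = l" by blast
        then have e: "is_ext j" "num j = l" using skip[OF j(1)] l by (auto split: if_splits)
        then show ?thesis using ext[OF ln, of d] blk[OF j(1)] drone[OF j(1)] j(2) by auto
      qed
    qed
    ultimately show ?thesis by blast
  qed
  have A: "assignment f ?ls = ?A"
  proof (intro HOL.ext set_eqI)
    fix d e
    show "e \<in> assignment f ?ls d \<longleftrightarrow> e \<in> ?A d"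
    proof (cases e)
      case (Del j)
      then show ?thesis using dels[of j d] dr_m[of j] by auto
    next
      case (Swap l)
      then show ?thesis using swaps[of l d] by auto
    qed
  qed
  obtain D where D: "Some (assignment f ?ls, D) \<in> for_each ?ls (assign_batch I m (all_blocks blk)) (\<lambda>_. {}, {})"
    using admissible_complete[OF adm] by blast
  define g where "g ys = (\<lambda>l. if l \<in> set ys then (all_blocks blk l, zc l) else ({}, 0))" for ys :: "nat list"
  have g: "Some (g ?ls) \<in> for_each ?ls (\<lambda>l P. process_batch I l \<triangleright> (\<lambda>q. ret (P(l := q)))) (g [])"
  proof (rule Some_in_for_each)
    fix ys l zs assume "?ls = ys @ l # zs"
    note l = upt_eq_append_Cons[OF this]
    then have "l \<in> nums" by simp
    moreover have "g (ys @ [l]) = (g ys)(l := (all_blocks blk l, zc l))" by (auto simp: g_def)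
    ultimately show "Some (g (ys @ [l])) \<in> process_batch I l \<triangleright> (\<lambda>q. ret ((g ys)(l := q)))"
      using processed unfolding Some_in_bind Some_in_ret by blast
  qed
  have fst_g: "(\<lambda>l. fst (g ?ls l)) = all_blocks blk"
  proof
    fix l
    have "all_blocks blk l = {}" if "l \<notin> nums" using num(1) that unfolding all_blocks_eq by blast
    then show "fst (g ?ls l) = all_blocks blk l" unfolding g_def nums by simp
  qed
  have m_eq: "Max ((\<lambda>l. card (fst (g ?ls l))) ` nums) + Max ((\<lambda>l. snd (g ?ls l)) ` nums) = m"
  proof -
    have "(\<lambda>l. snd (g ?ls l)) ` nums = zc ` nums"
      by (intro image_cong) (simp_all only: g_def nums if_True snd_conv)
    moreover have "(\<lambda>l. card (fst (g ?ls l))) ` nums = nb ` nums"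
      using fst_g card_all_blocks by (metis (no_types, lifting) image_cong)
    ultimately show ?thesis by (simp only: m_def)
  qed
  have g0: "g [] = (\<lambda>_. ({}, 0))" by (simp add: g_def)
  show ?thesis
    unfolding mod_alg_def Some_in_bind Let_def
  proof (intro exI conjI)
    show "Some (g ?ls) \<in> for_each ?ls (\<lambda>l P. process_batch I l \<triangleright> (\<lambda>q. ret (P(l := q)))) (\<lambda>_. ({}, 0))"
      using g unfolding g0 .
    show "Some (assignment f ?ls, D) \<in> for_each ?ls
        (assign_batch I (Max ((\<lambda>l. card (fst (g ?ls l))) ` nums) + Max ((\<lambda>l. snd (g ?ls l)) ` nums))
          (\<lambda>l. fst (g ?ls l))) (\<lambda>_. {}, {})"
      unfolding m_eq fst_g by (rule D)
    show "Some (m, ?A) \<in> (case (assignment f ?ls, D) of (A, D) \<Rightarrow>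
        ret (Max ((\<lambda>l. card (fst (g ?ls l))) ` nums) + Max ((\<lambda>l. snd (g ?ls l)) ` nums), A))"
      unfolding m_eq A by simp
  qed
qed

end

section \<open>Programs\<close>

text \<open>Total correctness with cost: a terminating execution exists, and the postcondition also
  receives its number of steps.\<close>

definition wp :: "com \<Rightarrow> (nat \<Rightarrow> state \<Rightarrow> bool) \<Rightarrow> state \<Rightarrow> bool" where
  "wp c Q s \<longleftrightarrow> (\<exists>t s'. exec c s t s' \<and> Q t s')"

inductive_cases exec_SkipE: "exec Skip s t s'"
inductive_cases exec_NAssignE: "exec (NAssign x e) s t s'"
inductive_cases exec_NStoreE: "exec (NStore a i e) s t s'"
inductive_cases exec_RStoreE: "exec (RStore a i e) s t s'"
inductive_cases exec_SeqE: "exec (Seq c c') s t s'"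
inductive_cases exec_CondE: "exec (Cond b c c') s t s'"

lemma wp_Skip: "wp Skip Q s \<longleftrightarrow> Q 1 s"
  unfolding wp_def by (metis exec.Skip exec_SkipE)

lemma wp_NAssign: "wp (NAssign x e) Q s \<longleftrightarrow> Q 1 (s\<lparr>nvar := (nvar s)(x := nval e s)\<rparr>)"
  unfolding wp_def by (metis exec.NAssign exec_NAssignE)

lemma wp_NStore: "wp (NStore a i e) Q s \<longleftrightarrow>
    Q 1 (s\<lparr>narr := (narr s)(a := (narr s a)(nval i s := nval e s))\<rparr>)"
  unfolding wp_def by (metis exec.NStore exec_NStoreE)

lemma wp_RStore: "wp (RStore a i e) Q s \<longleftrightarrow>
    Q 1 (s\<lparr>rarr := (rarr s)(a := (rarr s a)(nval i s := rval e s))\<rparr>)"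
  unfolding wp_def by (metis exec.RStore exec_RStoreE)

lemma wp_Seq: "wp (Seq c c') Q s \<longleftrightarrow> wp c (\<lambda>t. wp c' (\<lambda>t'. Q (t + t'))) s"
proof
  assume "wp (Seq c c') Q s"
  then obtain t s' where e: "exec (Seq c c') s t s'" "Q t s'" unfolding wp_def by blast
  from e(1) show "wp c (\<lambda>t. wp c' (\<lambda>t'. Q (t + t'))) s"
    by (rule exec_SeqE) (use e(2) in \<open>unfold wp_def, blast\<close>)
next
  assume "wp c (\<lambda>t. wp c' (\<lambda>t'. Q (t + t'))) s"
  then obtain t s' t' s'' where e: "exec c s t s'" "exec c' s' t' s''" "Q (t + t') s''"
    unfolding wp_def by blast
  from exec.Seq[OF e(1,2)] e(3) show "wp (Seq c c') Q s" unfolding wp_def by blast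
qed

lemma wp_Cond: "wp (Cond b c c') Q s \<longleftrightarrow>
    (bval b s \<longrightarrow> wp c (\<lambda>t. Q (1 + t)) s) \<and> (\<not> bval b s \<longrightarrow> wp c' (\<lambda>t. Q (1 + t)) s)"
proof
  assume "wp (Cond b c c') Q s"
  then obtain t s' where e: "exec (Cond b c c') s t s'" "Q t s'" unfolding wp_def by blast
  from e(1) show "(bval b s \<longrightarrow> wp c (\<lambda>t. Q (1 + t)) s) \<and> (\<not> bval b s \<longrightarrow> wp c' (\<lambda>t. Q (1 + t)) s)"
    by (rule exec_CondE) (use e(2) in \<open>auto simp: wp_def\<close>)
next
  assume h: "(bval b s \<longrightarrow> wp c (\<lambda>t. Q (1 + t)) s) \<and> (\<not> bval b s \<longrightarrow> wp c' (\<lambda>t. Q (1 + t)) s)"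
  show "wp (Cond b c c') Q s"
  proof (cases "bval b s")
    case True
    then obtain t s' where e: "exec c s t s'" "Q (1 + t) s'" using h unfolding wp_def by auto
    from exec.CondTrue[OF True e(1), of c'] e(2) show ?thesis unfolding wp_def by (intro exI conjI)
  next
    case False
    then obtain t s' where e: "exec c' s t s'" "Q (1 + t) s'" using h unfolding wp_def by auto
    from exec.CondFalse[OF False e(1), of c] e(2) show ?thesis unfolding wp_def by (intro exI conjI)
  qed
qed

lemmas wp_simps = wp_Skip wp_NAssign wp_NStore wp_RStore wp_Seq wp_Cond

lemma wp_mono: "wp c P s \<Longrightarrow> (\<And>t s'. P t s' \<Longrightarrow> Q t s') \<Longrightarrow> wp c Q s"
  unfolding wp_def by blast

lemma wp_SeqI: "wp c P s \<Longrightarrow> (\<And>t s'. P t s' \<Longrightarrow> wp c' (\<lambda>t'. Q (t + t')) s') \<Longrightarrow> wp (Seq c c') Q s"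
  unfolding wp_Seq by (rule wp_mono)

section \<open>Counting loops, search for a maximiser and selection sort\<close>

definition For :: "vname \<Rightarrow> nexp \<Rightarrow> com \<Rightarrow> com" where
  "For x e c = Seq (NAssign x (NConst 1))
     (While (NLe (NVar x) e) (Seq c (NAssign x (NAdd (NVar x) (NConst 1)))))"

text \<open>A round costs at most \<open>T\<close> for the body, one step for the guard and one for
  the increment; the initial assignment and the failing guard are the additional 2. The body must
  leave the loop variable unchanged.\<close>

lemma wp_For:
  assumes init: "Inv 1 (s\<lparr>nvar := (nvar s)(x := 1)\<rparr>)"
    and bound: "\<And>i s. Inv i s \<Longrightarrow> nval e s = N"
    and step: "\<And>i s. 1 \<le> i \<Longrightarrow> i \<le> N \<Longrightarrow> Inv i s \<Longrightarrow> nvar s x = i \<Longrightarrow>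
      wp c (\<lambda>t s'. t \<le> T \<and> nvar s' x = i \<and> Inv (Suc i) (s'\<lparr>nvar := (nvar s')(x := Suc i)\<rparr>)) s"
    and final: "\<And>t s'. Inv (Suc N) s' \<Longrightarrow> t \<le> 2 + N * (T + 2) \<Longrightarrow> Q t s'"
  shows "wp (For x e c) Q s"
proof -
  let ?body = "Seq c (NAssign x (NAdd (NVar x) (NConst 1)))"
  have loop: "\<exists>t s'. exec (While (NLe (NVar x) e) ?body) s t s' \<and> t \<le> 1 + (Suc N - i) * (T + 2) \<and> Inv (Suc N) s'"
    if "1 \<le> i" "i \<le> Suc N" "Inv i s" "nvar s x = i" for i s
    using that
  proof (induction "Suc N - i" arbitrary: i s)
    case 0
    then have "\<not> bval (NLe (NVar x) e) s" using bound[of i s] by simp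
    from exec.WhileFalse[OF this] 0 show ?case by (intro exI[of _ 1] exI[of _ s]) auto
  next
    case (Suc k)
    then have i: "i \<le> N" by simp
    obtain t s' where c: "exec c s t s'" "t \<le> T" "nvar s' x = i" "Inv (Suc i) (s'\<lparr>nvar := (nvar s')(x := Suc i)\<rparr>)"
      using step[OF Suc.prems(1) i Suc.prems(3,4)] unfolding wp_def by blast
    let ?s = "s'\<lparr>nvar := (nvar s')(x := Suc i)\<rparr>"
    have "exec (NAssign x (NAdd (NVar x) (NConst 1))) s' 1 ?s"
      using exec.NAssign[of x "NAdd (NVar x) (NConst 1)" s'] c(3) by simp
    then have b: "exec ?body s (t + 1) ?s" using c(1) by (rule exec.Seq[rotated])
    have "\<exists>t' s''. exec (While (NLe (NVar x) e) ?body) ?s t' s'' \<and>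
      t' \<le> 1 + (Suc N - Suc i) * (T + 2) \<and> Inv (Suc N) s''"
    proof (rule Suc.hyps(1))
      show "k = Suc N - Suc i" using Suc.hyps(2) by simp
      show "Inv (Suc i) ?s" by (rule c(4))
    qed (use i in simp_all)
    then obtain t' s'' where r: "exec (While (NLe (NVar x) e) ?body) ?s t' s''"
      "t' \<le> 1 + (Suc N - Suc i) * (T + 2)" "Inv (Suc N) s''" by blast
    have "bval (NLe (NVar x) e) s" using bound[OF Suc.prems(3)] Suc.prems(4) i by simp
    from exec.WhileTrue[OF this b r(1)]
    have "exec (While (NLe (NVar x) e) ?body) s (1 + (t + 1) + t') s''" .
    moreover have "1 + (t + 1) + t' \<le> 1 + (Suc N - i) * (T + 2)"
    proof -
      have "Suc N - i = Suc (Suc N - Suc i)" using i by simp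
      then have "(Suc N - i) * (T + 2) = (T + 2) + (Suc N - Suc i) * (T + 2)" by simp
      then show ?thesis using r(2) c(2) by linarith
    qed
    ultimately show ?case using r(3) by blast
  qed
  let ?s = "s\<lparr>nvar := (nvar s)(x := 1)\<rparr>"
  obtain t s' where w: "exec (While (NLe (NVar x) e) ?body) ?s t s'" "t \<le> 1 + N * (T + 2)" "Inv (Suc N) s'"
    using loop[of 1 ?s] init by auto
  have "exec (NAssign x (NConst 1)) s 1 ?s" using exec.NAssign[of x "NConst 1" s] by simp
  from exec.Seq[OF this w(1)] have "exec (For x e c) s (1 + t) s'" unfolding For_def .
  then show ?thesis using final[OF w(3), of "1 + t"] w(2) unfolding wp_def by auto
qed

text \<open>With no disjunction in \<open>bexp\<close>, the test that \<open>b\<close> is 0 or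
  beaten by the new index is a negated conjunction. Ties go to the later index; the comparison
  \<open>Truth\<close> accepts any candidate.\<close>

definition Best :: "nexp \<Rightarrow> bexp \<Rightarrow> bexp \<Rightarrow> com" where
  "Best e cond le = Seq (NAssign ''b'' (NConst 0))
     (For ''j'' e (Cond (BAnd cond (BNot (BAnd (NLe (NConst 1) (NVar ''b'')) (BNot le))))
       (NAssign ''b'' (NVar ''j'')) Skip))"

lemma best_0: "best P K 0 0"
  by (simp add: best_def)

lemma best_Suc:
  assumes "best P K i b"
  shows "best P K (Suc i) (if P (Suc i) \<and> (b = 0 \<or> K b \<le> K (Suc i)) then Suc i else b)"
proof -
  have set: "{1..Suc i} = insert (Suc i) {1..i}" by auto
  show ?thesis
    using assms unfolding best_def set by (auto intro: order_trans)
qed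

text \<open>A round takes four steps: guard, test, assignment or \<open>Skip\<close>, and increment.
  Initialising \<open>b\<close>, initialising the loop and the last guard are the other
  three.\<close>

lemma wp_Best:
  assumes bound: "\<And>i b. nval e (s\<lparr>nvar := (nvar s)(''j'' := i, ''b'' := b)\<rparr>) = N"
    and cond: "\<And>i b. 1 \<le> i \<Longrightarrow> i \<le> N \<Longrightarrow>
      bval cond (s\<lparr>nvar := (nvar s)(''j'' := i, ''b'' := b)\<rparr>) \<longleftrightarrow> P i"
    and le: "\<And>i b. 1 \<le> i \<Longrightarrow> i \<le> N \<Longrightarrow> 1 \<le> b \<Longrightarrow> b \<le> N \<Longrightarrow>
      bval le (s\<lparr>nvar := (nvar s)(''j'' := i, ''b'' := b)\<rparr>) \<longleftrightarrow> K b \<le> K i"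
    and final: "\<And>t b. best P K N b \<Longrightarrow> t \<le> 3 + 4 * N \<Longrightarrow>
      Q t (s\<lparr>nvar := (nvar s)(''j'' := Suc N, ''b'' := b)\<rparr>)"
  shows "wp (Best e cond le) Q s"
proof -
  let ?S = "\<lambda>i b. s\<lparr>nvar := (nvar s)(''j'' := i, ''b'' := b)\<rparr>"
  define Inv where "Inv i s' \<longleftrightarrow> (\<exists>b. s' = ?S i b \<and> best P K (i - 1) b)" for i s'
  have "wp (For ''j'' e (Cond (BAnd cond (BNot (BAnd (NLe (NConst 1) (NVar ''b'')) (BNot le))))
       (NAssign ''b'' (NVar ''j'')) Skip)) (\<lambda>t. Q (1 + t)) (s\<lparr>nvar := (nvar s)(''b'' := 0)\<rparr>)"
  proof (rule wp_For[where Inv = Inv and N = N and T = 2])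
    show "Inv 1 (s\<lparr>nvar := (nvar s)(''b'' := 0)\<rparr>
        \<lparr>nvar := (nvar (s\<lparr>nvar := (nvar s)(''b'' := 0)\<rparr>))(''j'' := 1)\<rparr>)"
      using best_0 unfolding Inv_def by (intro exI[of _ 0]) (simp add: fun_upd_twist)
    show "nval e s' = N" if "Inv i s'" for i s' using that bound unfolding Inv_def by blast
  next
    fix i s' assume i: "1 \<le> i" "i \<le> N" "Inv i s'" and "nvar s' ''j'' = i"
    then obtain b where s': "s' = ?S i b" and b: "best P K (i - 1) b" unfolding Inv_def by blast
    have b': "best P K i (if P i \<and> (b = 0 \<or> K b \<le> K i) then i else b)"
      using best_Suc[of P K "i - 1" b] b i(1) by (cases i) auto
    have "b = 0 \<or> 1 \<le> b \<and> b \<le> N" using b i unfolding best_def by auto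
    then have test: "bval (BAnd cond (BNot (BAnd (NLe (NConst 1) (NVar ''b'')) (BNot le)))) s' \<longleftrightarrow>
        P i \<and> (b = 0 \<or> K b \<le> K i)"
      using cond[OF i(1,2), of b] le[OF i(1,2), of b] unfolding s' by auto
    show "wp (Cond (BAnd cond (BNot (BAnd (NLe (NConst 1) (NVar ''b'')) (BNot le))))
       (NAssign ''b'' (NVar ''j'')) Skip)
       (\<lambda>t s''. t \<le> 2 \<and> nvar s'' ''j'' = i \<and> Inv (Suc i) (s''\<lparr>nvar := (nvar s'')(''j'' := Suc i)\<rparr>)) s'"
    proof (cases "P i \<and> (b = 0 \<or> K b \<le> K i)")
      case True
      have "Inv (Suc i) (?S (Suc i) i)" using b' True unfolding Inv_def by auto
      then show ?thesis using test True
        unfolding wp_Cond wp_NAssign wp_Skip by (simp add: s' fun_upd_twist)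
    next
      case False
      then have "Inv (Suc i) (?S (Suc i) b)" using b' unfolding Inv_def by auto
      moreover have "\<not> bval (BAnd cond (BNot (BAnd (NLe (NConst 1) (NVar ''b'')) (BNot le)))) s'"
        using test False by blast
      ultimately show ?thesis
        unfolding wp_Cond wp_NAssign wp_Skip by (auto simp: s' fun_upd_twist)
    qed
  next
    fix t s' assume "Inv (Suc N) s'" "t \<le> 2 + N * (2 + 2)"
    then show "Q (1 + t) s'" using final unfolding Inv_def by auto
  qed
  then show ?thesis unfolding Best_def wp_Seq wp_NAssign by simp
qed

abbreviation NEq :: "nexp \<Rightarrow> nexp \<Rightarrow> bexp" where "NEq e e' \<equiv> BAnd (NLe e e') (NLe e' e)"
abbreviation Pos :: "nexp \<Rightarrow> bexp" where "Pos e \<equiv> NLe (NConst 1) e"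
abbreviation RLess :: "rexp \<Rightarrow> rexp \<Rightarrow> bexp" where "RLess e e' \<equiv> BNot (RLe e' e)"
abbreviation At :: "vname \<Rightarrow> vname \<Rightarrow> nexp" where "At a x \<equiv> NArr a (NVar x)"
abbreviation RAt :: "vname \<Rightarrow> vname \<Rightarrow> rexp" where "RAt a x \<equiv> RArr a (NVar x)"

definition Sort :: "vname \<Rightarrow> vname \<Rightarrow> bexp \<Rightarrow> com" where
  "Sort z d le = For ''p'' (NVar ''n'') (Seq (Best (NVar ''n'') (BNot (Pos (At d ''j''))) le)
     (Seq (NStore z (NVar ''p'') (NVar ''b'')) (NStore d (NVar ''b'') (NConst 1))))"

definition sort_inv :: "(nat \<Rightarrow> real) \<Rightarrow> nat \<Rightarrow> nat \<Rightarrow> (nat \<Rightarrow> nat) \<Rightarrow> (nat \<Rightarrow> nat) \<Rightarrow> bool" where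
  "sort_inv K N p z d \<longleftrightarrow> (\<forall>j\<in>{1..N}. d j = 0 \<longleftrightarrow> j \<notin> z ` {1..<p}) \<and> inj_on z {1..<p} \<and>
     z ` {1..<p} \<subseteq> {1..N} \<and> (\<forall>i j. 1 \<le> i \<longrightarrow> i \<le> j \<longrightarrow> j < p \<longrightarrow> K (z j) \<le> K (z i)) \<and>
     (\<forall>i j. 1 \<le> i \<longrightarrow> i < p \<longrightarrow> j \<in> {1..N} - z ` {1..<p} \<longrightarrow> K j \<le> K (z i))"

lemma sort_inv_step:
  assumes inv: "sort_inv K N p z d" and p: "1 \<le> p" "p \<le> N"
    and b: "best (\<lambda>j. d j = 0) K N b"
  shows "sort_inv K N (Suc p) (z(p := b)) (d(b := 1))"
proof -
  have c: "\<And>j. j \<in> {1..N} \<Longrightarrow> d j = 0 \<longleftrightarrow> j \<notin> z ` {1..<p}" "inj_on z {1..<p}"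
    "z ` {1..<p} \<subseteq> {1..N}" "\<And>i j. 1 \<le> i \<Longrightarrow> i \<le> j \<Longrightarrow> j < p \<Longrightarrow> K (z j) \<le> K (z i)"
    "\<And>i j. 1 \<le> i \<Longrightarrow> i < p \<Longrightarrow> j \<in> {1..N} - z ` {1..<p} \<Longrightarrow> K j \<le> K (z i)"
    using inv unfolding sort_inv_def by blast+
  \<comment> \<open>Fewer than \<open>N\<close> indices have been placed, so an unplaced one remains
    and the search cannot return 0.\<close>
  have "\<not> {1..N} \<subseteq> z ` {1..<p}"
  proof
    assume "{1..N} \<subseteq> z ` {1..<p}"
    then have "card {1..N} \<le> card (z ` {1..<p})" by (intro card_mono) auto
    also have "\<dots> \<le> p - 1" using card_image_le[of "{1..<p}" z] by simp
    finally show False using p by simp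
  qed
  then obtain j where "j \<in> {1..N}" "d j = 0" using c(1) by blast
  then have bN: "b \<in> {1..N}" "d b = 0" and bmax: "\<And>j. j \<in> {1..N} \<Longrightarrow> d j = 0 \<Longrightarrow> K j \<le> K b"
    using b unfolding best_def by blast+
  then have bz: "b \<notin> z ` {1..<p}" using c(1) by blast
  have set: "{1..<Suc p} = insert p {1..<p}" using p by auto
  have image: "(z(p := b)) ` {1..<Suc p} = insert b (z ` {1..<p})"
    unfolding set by auto
  show ?thesis
    unfolding sort_inv_def image
  proof (intro conjI allI impI ballI)
    show "(d(b := 1)) j = 0 \<longleftrightarrow> j \<notin> insert b (z ` {1..<p})" if "j \<in> {1..N}" for j
      using c(1)[OF that] by simp
    show "inj_on (z(p := b)) {1..<Suc p}"
    proof -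
      have "inj_on (z(p := b)) {1..<p}" using c(2) unfolding inj_on_def by simp
      then show ?thesis using bz unfolding set by auto
    qed
    show "insert b (z ` {1..<p}) \<subseteq> {1..N}" using c(3) bN by simp
    show "K ((z(p := b)) j) \<le> K ((z(p := b)) i)" if "1 \<le> i" "i \<le> j" "j < Suc p" for i j
    proof (cases "j = p")
      case True
      then show ?thesis using c(5)[of i b] that bN bz by (cases "i = p") auto
    next
      case False
      then show ?thesis using c(4)[of i j] that by simp
    qed
    show "K j \<le> K ((z(p := b)) i)" if "1 \<le> i" "i < Suc p" "j \<in> {1..N} - insert b (z ` {1..<p})" for i j
    proof (cases "i = p")
      case True
      have "d j = 0" using c(1)[of j] that(3) by blast
      then show ?thesis using True bmax[of j] that(3) by simp
    next
      case False
      then show ?thesis using c(5)[of i j] that by simp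
    qed
  qed
qed

lemma sort_inv_final:
  assumes "sort_inv K N (Suc N) z d"
  shows "bij_betw z {1..N} {1..N}" "\<And>p q. 1 \<le> p \<Longrightarrow> p \<le> q \<Longrightarrow> q \<le> N \<Longrightarrow> K (z q) \<le> K (z p)"
proof -
  have "{1..<Suc N} = {1..N}" by auto
  then have "inj_on z {1..N}" "z ` {1..N} \<subseteq> {1..N}" using assms unfolding sort_inv_def by simp_all
  then show "bij_betw z {1..N} {1..N}" unfolding bij_betw_def
    by (simp add: card_subset_eq card_image)
  show "\<And>p q. 1 \<le> p \<Longrightarrow> p \<le> q \<Longrightarrow> q \<le> N \<Longrightarrow> K (z q) \<le> K (z p)"
    using assms unfolding sort_inv_def by simp
qed

text \<open>Only arrays of naturals are framed: the input is protected by \<open>mem\<close>,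
  scalars other than \<open>m\<close> are scratch, and \<open>rem\<close> is the one real array that
  is written.\<close>

definition frame :: "vname set \<Rightarrow> state \<Rightarrow> state \<Rightarrow> bool" where
  "frame W s s' \<longleftrightarrow> (\<forall>a. a \<notin> W \<longrightarrow> narr s' a = narr s a)"

lemma frame_refl: "frame W s s"
  by (simp add: frame_def)

lemma frameD: "frame W s s' \<Longrightarrow> a \<notin> W \<Longrightarrow> narr s' a = narr s a"
  by (simp add: frame_def)

lemma frame_update [simp]:
  "frame W s (s'\<lparr>nvar := v\<rparr>) = frame W s s'"
  "frame W s (s'\<lparr>rarr := u\<rparr>) = frame W s s'"
  by (simp_all add: frame_def)

context ddp
begin

definition mem :: "state \<Rightarrow> bool" where
  "mem s \<longleftrightarrow> nvar s ''n'' = ndel I \<and> nvar s ''r'' = nsta I \<and> rvar s ''B'' = cap I \<and>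
     (\<forall>j\<in>dels I. rarr s ''tL'' j = tL I j \<and> rarr s ''tR'' j = tR I j \<and> rarr s ''cost'' j = cost I j) \<and>
     (\<forall>l\<in>stas I. rarr s ''tA'' l = tA I l \<and> rarr s ''tD'' l = tD I l)"

lemma mem_update [simp]:
  "mem (s\<lparr>narr := f\<rparr>) = mem s"
  "x \<noteq> ''n'' \<Longrightarrow> x \<noteq> ''r'' \<Longrightarrow> mem (s\<lparr>nvar := (nvar s)(x := k)\<rparr>) = mem s"
  "mem (s\<lparr>rarr := (rarr s)(''rem'' := g)\<rparr>) = mem s"
  by (simp_all add: mem_def)

lemma mem_nvar: "mem s \<Longrightarrow> v ''n'' = nvar s ''n'' \<Longrightarrow> v ''r'' = nvar s ''r'' \<Longrightarrow> mem (s\<lparr>nvar := v\<rparr>)"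
  by (simp add: mem_def)

lemma memD:
  assumes "mem s"
  shows "nvar s ''n'' = ndel I" "nvar s ''r'' = nsta I" "rvar s ''B'' = cap I"
    and "\<And>j. 1 \<le> j \<Longrightarrow> j \<le> ndel I \<Longrightarrow> rarr s ''tL'' j = tL I j"
    and "\<And>j. 1 \<le> j \<Longrightarrow> j \<le> ndel I \<Longrightarrow> rarr s ''tR'' j = tR I j"
    and "\<And>j. 1 \<le> j \<Longrightarrow> j \<le> ndel I \<Longrightarrow> rarr s ''cost'' j = cost I j"
    and "\<And>l. 1 \<le> l \<Longrightarrow> l \<le> nsta I \<Longrightarrow> rarr s ''tA'' l = tA I l"
    and "\<And>l. 1 \<le> l \<Longrightarrow> l \<le> nsta I \<Longrightarrow> rarr s ''tD'' l = tD I l"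
  using assms by (simp_all add: mem_def)

lemma wp_Sort:
  fixes K :: "nat \<Rightarrow> real"
  assumes s: "mem s" "narr s z = (\<lambda>_. 0)" "narr s d = (\<lambda>_. 0)" "z \<noteq> d"
    and le: "\<And>s' i b. mem s' \<Longrightarrow> frame {z, d} s s' \<Longrightarrow> 1 \<le> i \<Longrightarrow> i \<le> ndel I \<Longrightarrow> 1 \<le> b \<Longrightarrow> b \<le> ndel I \<Longrightarrow>
      bval le (s'\<lparr>nvar := (nvar s')(''j'' := i, ''b'' := b)\<rparr>) \<longleftrightarrow> K b \<le> K i"
  shows "wp (Sort z d le) (\<lambda>t s'. t \<le> 2 + ndel I * (7 + 4 * ndel I) \<and> mem s' \<and> frame {z, d} s s' \<and>
    bij_betw (narr s' z) {1..ndel I} {1..ndel I} \<and>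
    (\<forall>p q. 1 \<le> p \<longrightarrow> p \<le> q \<longrightarrow> q \<le> ndel I \<longrightarrow> K (narr s' z q) \<le> K (narr s' z p))) s"
  unfolding Sort_def
\<comment> \<open>The body takes at most \<open>3 + 4 * ndel I\<close> steps for the search and two
  for the stores.\<close>
proof (rule wp_For[where Inv = "\<lambda>p s'. mem s' \<and> frame {z, d} s s' \<and> sort_inv K (ndel I) p (narr s' z) (narr s' d)"
      and N = "ndel I" and T = "5 + 4 * ndel I"])
  show "mem (s\<lparr>nvar := (nvar s)(''p'' := 1)\<rparr>) \<and> frame {z, d} s (s\<lparr>nvar := (nvar s)(''p'' := 1)\<rparr>) \<and>
    sort_inv K (ndel I) 1 (narr (s\<lparr>nvar := (nvar s)(''p'' := 1)\<rparr>) z) (narr (s\<lparr>nvar := (nvar s)(''p'' := 1)\<rparr>) d)"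
    using s by (simp add: frame_refl sort_inv_def)
next
  fix p s' assume p: "1 \<le> p" "p \<le> ndel I" "nvar s' ''p'' = p"
    and inv: "mem s' \<and> frame {z, d} s s' \<and> sort_inv K (ndel I) p (narr s' z) (narr s' d)"
  show "wp (Seq (Best (NVar ''n'') (BNot (Pos (At d ''j''))) le)
     (Seq (NStore z (NVar ''p'') (NVar ''b'')) (NStore d (NVar ''b'') (NConst 1))))
     (\<lambda>t s'. t \<le> 5 + 4 * ndel I \<and> nvar s' ''p'' = p \<and> mem (s'\<lparr>nvar := (nvar s')(''p'' := Suc p)\<rparr>) \<and>
       frame {z, d} s (s'\<lparr>nvar := (nvar s')(''p'' := Suc p)\<rparr>) \<and>
       sort_inv K (ndel I) (Suc p) (narr (s'\<lparr>nvar := (nvar s')(''p'' := Suc p)\<rparr>) z)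
         (narr (s'\<lparr>nvar := (nvar s')(''p'' := Suc p)\<rparr>) d)) s'"
    unfolding wp_Seq
  proof (rule wp_Best[where N = "ndel I" and P = "\<lambda>j. narr s' d j = 0" and K = K])
    fix t b assume b: "best (\<lambda>j. narr s' d j = 0) K (ndel I) b" and t: "t \<le> 3 + 4 * ndel I"
    have "sort_inv K (ndel I) (Suc p) ((narr s' z)(p := b)) ((narr s' d)(b := 1))"
      using sort_inv_step[OF _ p(1,2) b] inv by blast
    then show "wp (NStore z (NVar ''p'') (NVar ''b'')) (\<lambda>ta. wp (NStore d (NVar ''b'') (NConst 1))
        (\<lambda>t' s'. t + (ta + t') \<le> 5 + 4 * ndel I \<and> nvar s' ''p'' = p \<and> mem (s'\<lparr>nvar := (nvar s')(''p'' := Suc p)\<rparr>) \<and>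
       frame {z, d} s (s'\<lparr>nvar := (nvar s')(''p'' := Suc p)\<rparr>) \<and>
       sort_inv K (ndel I) (Suc p) (narr (s'\<lparr>nvar := (nvar s')(''p'' := Suc p)\<rparr>) z)
         (narr (s'\<lparr>nvar := (nvar s')(''p'' := Suc p)\<rparr>) d)))
      (s'\<lparr>nvar := (nvar s')(''j'' := Suc (ndel I), ''b'' := b)\<rparr>)"
      using inv t p s(4) by (simp add: wp_NStore mem_nvar frame_def)
  next
    fix i b assume "1 \<le> i" "i \<le> ndel I" "1 \<le> b" "b \<le> ndel I"
    then show "bval le (s'\<lparr>nvar := (nvar s')(''j'' := i, ''b'' := b)\<rparr>) \<longleftrightarrow> K b \<le> K i"
      using le inv by blast
  qed (use inv in \<open>auto simp: memD(1)\<close>)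
next
  fix t s' assume "mem s' \<and> frame {z, d} s s' \<and> sort_inv K (ndel I) (Suc (ndel I)) (narr s' z) (narr s' d)"
    and "t \<le> 2 + ndel I * (5 + 4 * ndel I + 2)"
  then show "t \<le> 2 + ndel I * (7 + 4 * ndel I) \<and> mem s' \<and> frame {z, d} s s' \<and>
    bij_betw (narr s' z) {1..ndel I} {1..ndel I} \<and>
    (\<forall>p q. 1 \<le> p \<longrightarrow> p \<le> q \<longrightarrow> q \<le> ndel I \<longrightarrow> K (narr s' z q) \<le> K (narr s' z p))"
    using sort_inv_final[of K "ndel I" "narr s' z" "narr s' d"] by (simp add: algebra_simps)
qed (auto simp: memD(1))

end

section \<open>The phases of the program\<close>

lemma best_cong_key:
  assumes "\<And>i. i \<in> {1..N} \<Longrightarrow> P i \<longleftrightarrow> P' i" "\<And>i. i \<in> {1..N} \<Longrightarrow> K i = K' i"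
  shows "best P K N b \<longleftrightarrow> best P' K' N b"
  using assms unfolding best_def by auto

abbreviation Truth :: bexp where "Truth \<equiv> NLe (NConst 0) (NConst 0)"

text \<open>A merge of deliveries by falling end with stations by falling number. Each round either
  lowers \<open>l\<close> or settles one delivery, so \<open>ndel + nsta\<close> rounds suffice and
  no product of the two arises. Where the descent stops, only the batches \<open>l\<close> and
  \<open>l - 1\<close> remain possible.\<close>

definition prog_bat :: com where
  "prog_bat = Seq (NAssign ''p'' (NConst 1)) (Seq (NAssign ''l'' (NAdd (NVar ''r'') (NConst 1)))
     (For ''i'' (NAdd (NVar ''n'') (NVar ''r''))
       (Cond (NLe (NVar ''p'') (NVar ''n''))
         (Seq (NAssign ''u'' (At ''Q'' ''p''))
           (Cond (BAnd (NLe (NConst 2) (NVar ''l''))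
               (RLess (RAt ''tR'' ''u'') (RArr ''tA'' (NSub (NVar ''l'') (NConst 1)))))
             (NAssign ''l'' (NSub (NVar ''l'') (NConst 1)))
             (Seq (Cond (BAnd (NLe (NConst 2) (NVar ''l''))
                 (RLe (RAt ''tL'' ''u'') (RArr ''tD'' (NSub (NVar ''l'') (NConst 1)))))
               (NStore ''bat'' (NVar ''u'') (NSub (NVar ''l'') (NConst 1)))
               (NStore ''bat'' (NVar ''u'') (NVar ''l'')))
             (NAssign ''p'' (NAdd (NVar ''p'') (NConst 1))))))
         Skip)))"

text \<open>\<open>skip\<close> has two uses: it belongs to the output, and being nonzero it serves
  all later phases as the test for \<open>ext\<close>.\<close>

definition prog_labels :: com where
  "prog_labels = For ''u'' (NVar ''n'') (Seq (NAssign ''l'' (At ''bat'' ''u''))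
     (Cond (NLe (NVar ''l'') (NVar ''r''))
       (Seq (Cond (RLe (RAt ''tA'' ''l'') (RAt ''tR'' ''u''))
           (NStore ''skip'' (NVar ''u'') (NVar ''l'')) Skip)
         (Cond (BAnd (RLe (RAt ''tL'' ''u'') (RAt ''tA'' ''l'')) (RLe (RAt ''tA'' ''l'') (RAt ''tR'' ''u'')))
           (NStore ''lf'' (NVar ''u'') (NConst 1)) Skip))
       Skip))"

definition prog_mate :: com where
  "prog_mate = For ''p'' (NVar ''n'') (Seq (NAssign ''u'' (At ''Q'' ''p''))
     (Cond (Pos (At ''lf'' ''u''))
       (Seq (Best (NVar ''n'')
           (BAnd (NEq (At ''bat'' ''j'') (At ''bat'' ''u'')) (BAnd (Pos (At ''skip'' ''j''))
             (BAnd (BNot (Pos (At ''lf'' ''j''))) (BAnd (BNot (Pos (At ''tk'' ''j'')))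
               (BAnd (RLess (RAt ''tR'' ''u'') (RAt ''tL'' ''j''))
                 (RLe (RAdd (RAt ''cost'' ''u'') (RAt ''cost'' ''j'')) (RVar ''B'')))))))
           (RLe (RAt ''cost'' ''b'') (RAt ''cost'' ''j'')))
         (Seq (NStore ''mate'' (NVar ''u'') (NVar ''b'')) (NStore ''tk'' (NVar ''b'') (NConst 1))))
       Skip))"

definition prog_color :: com where
  "prog_color = For ''p'' (NVar ''n'') (Seq (NAssign ''u'' (At ''Q'' ''p''))
     (Seq (Cond (Pos (At ''skip'' ''u''))
         (NAssign ''b'' (At ''mate'' ''u''))
         (Best (NVar ''n'')
           (BAnd (NEq (At ''bat'' ''j'') (At ''bat'' ''u'')) (BAnd (Pos (At ''tail'' ''j''))
             (RLess (RAt ''tR'' ''u'') (RAt ''tL'' ''j''))))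
           Truth))
     (Seq (Cond (Pos (NVar ''b''))
         (Seq (NStore ''col'' (NVar ''u'') (At ''col'' ''b'')) (NStore ''tail'' (NVar ''b'') (NConst 0)))
         (Seq (NStore ''nc'' (At ''bat'' ''u'') (NAdd (NArr ''nc'' (At ''bat'' ''u'')) (NConst 1)))
         (Seq (NStore ''col'' (NVar ''u'') (NArr ''nc'' (At ''bat'' ''u'')))
           (Cond (Pos (At ''skip'' ''u''))
             (NStore ''zc'' (At ''bat'' ''u'') (NAdd (NArr ''zc'' (At ''bat'' ''u'')) (NConst 1))) Skip))))
       (NStore ''tail'' (NVar ''u'') (NConst 1)))))"

definition prog_pack :: com where
  "prog_pack = For ''p'' (NVar ''n'') (Seq (NAssign ''u'' (At ''Q'' ''p''))
     (Seq (Best (NVar ''n'')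
         (BAnd (NEq (At ''blk'' ''j'') (NVar ''j'')) (BAnd (NEq (At ''bat'' ''j'') (At ''bat'' ''u''))
           (BAnd (NEq (At ''col'' ''j'') (At ''col'' ''u'')) (RLe (RAt ''cost'' ''u'') (RAt ''rem'' ''j'')))))
         Truth)
       (Cond (Pos (NVar ''b''))
         (Seq (NStore ''blk'' (NVar ''u'') (NVar ''b''))
           (RStore ''rem'' (NVar ''b'') (RSub (RAt ''rem'' ''b'') (RAt ''cost'' ''u''))))
         (Seq (NStore ''blk'' (NVar ''u'') (NVar ''u''))
         (Seq (RStore ''rem'' (NVar ''u'') (RSub (RVar ''B'') (RAt ''cost'' ''u'')))
           (NStore ''nb'' (At ''bat'' ''u'') (NAdd (NArr ''nb'' (At ''bat'' ''u'')) (NConst 1))))))))"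

definition prog_m :: com where
  "prog_m = Seq (Best (NAdd (NVar ''r'') (NConst 1)) Truth (NLe (At ''nb'' ''b'') (At ''nb'' ''j'')))
     (Seq (NAssign ''m'' (At ''nb'' ''b''))
     (Seq (Best (NAdd (NVar ''r'') (NConst 1)) Truth (NLe (At ''zc'' ''b'') (At ''zc'' ''j'')))
       (NAssign ''m'' (NAdd (NVar ''m'') (At ''zc'' ''b'')))))"

definition prog_drones :: com where
  "prog_drones = For ''p'' (NVar ''n'') (Seq (NAssign ''u'' (At ''Z'' ''p''))
     (Cond (NEq (At ''blk'' ''u'') (NVar ''u''))
       (Seq (Best (NVar ''m'')
           (BAnd (BNot (NEq (At ''dl'' ''j'') (At ''bat'' ''u''))) (BNot (NEq (At ''dx'' ''j'') (At ''bat'' ''u''))))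
           Truth)
       (Seq (NStore ''dr'' (NVar ''u'') (NVar ''b''))
       (Seq (NStore ''dl'' (NVar ''b'') (At ''bat'' ''u''))
         (Cond (Pos (At ''skip'' ''u''))
           (NStore ''dx'' (NVar ''b'') (NAdd (At ''bat'' ''u'') (NConst 1))) Skip))))
       Skip))"

definition prog_out :: com where
  "prog_out = For ''p'' (NVar ''n'') (NStore ''drone'' (NVar ''p'') (NArr ''dr'' (At ''blk'' ''p'')))"

section \<open>Labels of the deliveries\<close>

context ddp
begin

lemma frame_upd:
  "a \<in> W \<Longrightarrow> frame W s (t\<lparr>narr := g(a := x)\<rparr>) \<longleftrightarrow> frame W s (t\<lparr>narr := g\<rparr>)"
  "frame W s (t\<lparr>narr := narr s'\<rparr>) \<longleftrightarrow> frame W s s'"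
  by (auto simp: frame_def)

lemma mem_cong:
  assumes "mem s" "nvar s' ''n'' = nvar s ''n''" "nvar s' ''r'' = nvar s ''r''" "rvar s' = rvar s"
    and "\<And>a. a \<noteq> ''rem'' \<Longrightarrow> rarr s' a = rarr s a"
  shows "mem s'"
  using assms by (simp add: mem_def)

definition labels :: "state \<Rightarrow> bool" where
  "labels s \<longleftrightarrow> (\<forall>j\<in>dels I. narr s ''bat'' j = num j \<and> (narr s ''lf'' j \<noteq> 0 \<longleftrightarrow> is_left j) \<and>
     narr s ''skip'' j = (if is_ext j then num j else 0))"

lemma labelsD:
  assumes "labels s" "j \<in> dels I"
  shows "narr s ''bat'' j = num j" "narr s ''lf'' j \<noteq> 0 \<longleftrightarrow> is_left j"
    "narr s ''skip'' j \<noteq> 0 \<longleftrightarrow> is_ext j" "narr s ''skip'' j = (if is_ext j then num j else 0)"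
proof -
  have l: "narr s ''bat'' j = num j \<and> (narr s ''lf'' j \<noteq> 0 \<longleftrightarrow> is_left j) \<and>
     narr s ''skip'' j = (if is_ext j then num j else 0)" using assms unfolding labels_def by blast
  then show "narr s ''bat'' j = num j" "narr s ''lf'' j \<noteq> 0 \<longleftrightarrow> is_left j"
    "narr s ''skip'' j = (if is_ext j then num j else 0)" by blast+
  have "num j \<noteq> 0" using num(1)[OF assms(2)] by simp
  then show "narr s ''skip'' j \<noteq> 0 \<longleftrightarrow> is_ext j" using l by (cases "is_ext j") simp_all
qed

lemma labels_frame: "labels s \<Longrightarrow> frame W s s' \<Longrightarrow> W \<inter> {''bat'', ''lf'', ''skip''} = {} \<Longrightarrow> labels s'"
  unfolding labels_def frame_def by (metis disjoint_insert(2))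

definition label_inv :: "nat \<Rightarrow> (nat \<Rightarrow> nat) \<Rightarrow> (nat \<Rightarrow> nat) \<Rightarrow> bool" where
  "label_inv u lf sk \<longleftrightarrow> (\<forall>j\<in>{1..<u}. (lf j \<noteq> 0 \<longleftrightarrow> is_left j) \<and> sk j = (if is_ext j then num j else 0)) \<and>
     (\<forall>j\<ge>u. lf j = 0 \<and> sk j = 0)"

lemma label_inv_step:
  assumes inv: "label_inv u lf sk"
    and new: "lf' u \<noteq> 0 \<longleftrightarrow> is_left u" "sk' u = (if is_ext u then num u else 0)"
    and old: "\<And>j. j \<noteq> u \<Longrightarrow> lf' j = lf j \<and> sk' j = sk j"
  shows "label_inv (Suc u) lf' sk'"
  unfolding label_inv_def
proof (intro conjI ballI allI impI)
  fix j assume j: "j \<in> {1..<Suc u}"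
  have "(lf' j \<noteq> 0 \<longleftrightarrow> is_left j) \<and> sk' j = (if is_ext j then num j else 0)"
  proof (cases "j = u")
    case True
    then show ?thesis using new by blast
  next
    case False
    then have "j \<in> {1..<u}" using j by auto
    then show ?thesis using inv old[OF False] unfolding label_inv_def by metis
  qed
  then show "lf' j \<noteq> 0 \<longleftrightarrow> is_left j" "sk' j = (if is_ext j then num j else 0)" by blast+
next
  fix j assume "Suc u \<le> j"
  then show "lf' j = 0" "sk' j = 0" using inv old[of j] unfolding label_inv_def by simp_all
qed

lemma wp_labels:
  assumes s: "mem s" "narr s ''lf'' = (\<lambda>_. 0)" "narr s ''skip'' = (\<lambda>_. 0)"
    and bat: "\<And>j. j \<in> dels I \<Longrightarrow> narr s ''bat'' j = num j"
  shows "wp prog_labels (\<lambda>t s'. t \<le> 2 + ndel I * 8 \<and> mem s' \<and> frame {''lf'', ''skip''} s s' \<and> labels s') s"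
  unfolding prog_labels_def
proof (rule wp_For[where N = "ndel I" and T = 6 and Inv = "\<lambda>u s'. mem s' \<and> frame {''lf'', ''skip''} s s' \<and>
    label_inv u (narr s' ''lf'') (narr s' ''skip'')"], goal_cases)
  case 1
  then show ?case using s by (simp add: mem_nvar frame_refl label_inv_def)
next
  case (2 u s')
  then show ?case by (simp add: memD(1))
next
  case (3 u s')
  then have u: "1 \<le> u" "u \<le> ndel I" "nvar s' ''u'' = u" and m: "mem s'" and f: "frame {''lf'', ''skip''} s s'"
    and inv: "label_inv u (narr s' ''lf'') (narr s' ''skip'')" by simp_all
  have ud: "u \<in> dels I" using u by simp
  have b: "narr s' ''bat'' u = num u" using bat[OF ud] f by (simp add: frameD)
  have z: "narr s' ''lf'' u = 0" "narr s' ''skip'' u = 0" using inv unfolding label_inv_def by simp_all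
  define k L E where "k = num u" and "L = is_left u" and "E = is_ext u"
  have L: "L \<longleftrightarrow> k \<le> nsta I \<and> tL I u \<le> tA I k \<and> tA I k \<le> tR I u"
    using num(2)[OF ud] lefts_iff[of u "num u"] unfolding k_def L_def by blast
  have l: "1 \<le> k" using num(1)[OF ud] by (simp add: k_def)
  have E: "E \<longleftrightarrow> k \<le> nsta I \<and> tA I k \<le> tR I u"
    using num(2)[OF ud] ext_iff[of k u] l unfolding k_def E_def by blast
  have tl: "rarr s' ''tL'' u = tL I u" "rarr s' ''tR'' u = tR I u" using memD(4,5)[OF m] u by simp_all
  have ta: "k \<le> nsta I \<Longrightarrow> rarr s' ''tA'' k = tA I k" using memD(7)[OF m] l by simp
  have step: "label_inv (Suc u) lf' sk'" if "lf' u \<noteq> 0 \<longleftrightarrow> L" "sk' u = (if E then k else 0)"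
    "\<And>j. j \<noteq> u \<Longrightarrow> lf' j = narr s' ''lf'' j \<and> sk' j = narr s' ''skip'' j" for lf' sk'
    using label_inv_step[OF inv, of lf' sk'] that unfolding k_def L_def E_def by blast
  have steps: "E \<Longrightarrow> L \<Longrightarrow> label_inv (Suc u) ((narr s' ''lf'')(u := 1)) ((narr s' ''skip'')(u := k))"
    "E \<Longrightarrow> \<not> L \<Longrightarrow> label_inv (Suc u) (narr s' ''lf'') ((narr s' ''skip'')(u := k))"
    "\<not> E \<Longrightarrow> label_inv (Suc u) (narr s' ''lf'') (narr s' ''skip'')"
    by (rule step; use z L E in auto)+
  show ?case
    unfolding wp_simps
    using u m f b tl ta memD(2)[OF m] L E steps by (auto simp: mem_nvar frame_def k_def[symmetric])
next
  case (4 t s')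
  have "labels s'"
    unfolding labels_def
  proof
    fix j assume j: "j \<in> dels I"
    then have "narr s' ''bat'' j = num j" "j \<in> {1..<Suc (ndel I)}" using bat 4(1) by (auto simp: frameD)
    then show "narr s' ''bat'' j = num j \<and> (narr s' ''lf'' j \<noteq> 0 \<longleftrightarrow> is_left j) \<and>
     narr s' ''skip'' j = (if is_ext j then num j else 0)" using 4(1) unfolding label_inv_def by blast
  qed
  then show ?case using 4 by simp
qed

end

section \<open>Batch numbers by merging, and the matching phase\<close>

context ddp_order
begin

text \<open>The equation is the progress measure: each round raises \<open>i\<close> and either
  lowers \<open>l\<close> or raises \<open>p\<close>. The last clause says that all deliveries still
  to come end before station \<open>l\<close> opens.\<close>

definition bat_inv :: "nat \<Rightarrow> nat \<Rightarrow> nat \<Rightarrow> (nat \<Rightarrow> nat) \<Rightarrow> bool" where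
  "bat_inv i p l bat \<longleftrightarrow> 1 \<le> p \<and> p \<le> Suc (ndel I) \<and> 1 \<le> l \<and> l \<le> Suc (nsta I) \<and>
     (p \<le> ndel I \<longrightarrow> i + l = p + nsta I + 1) \<and> (\<forall>j\<in>seen p. bat j = num j) \<and>
     (\<forall>q. p \<le> q \<longrightarrow> q \<le> ndel I \<longrightarrow> l \<le> nsta I \<longrightarrow> tR I (Q q) < tA I l)"

lemma bat_inv_down:
  assumes "bat_inv i p l bat" "p \<le> ndel I" "2 \<le> l" "tR I (Q p) < tA I (l - 1)"
  shows "bat_inv (Suc i) p (l - 1) bat"
  using assms Q_order[of p] unfolding bat_inv_def by (auto intro: le_less_trans)

text \<open>\<open>Q p\<close> ends before \<open>tA I l\<close> but, if \<open>2 <= l\<close>, not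
  before \<open>tA I (l - 1)\<close>. Starting by \<open>tD I (l - 1)\<close>, it meets that
  station, so it cannot reach back to an earlier one and belongs to batch \<open>l - 1\<close>;
  otherwise it belongs to \<open>l\<close>.\<close>

lemma bat_inv_stop:
  assumes inv: "bat_inv i p l bat" and p: "p \<le> ndel I" and l: "\<not> (2 \<le> l \<and> tR I (Q p) < tA I (l - 1))"
  shows "bat_inv (Suc i) (Suc p) l (bat(Q p := (if 2 \<le> l \<and> tL I (Q p) \<le> tD I (l - 1) then l - 1 else l)))"
proof -
  have c: "1 \<le> p" "1 \<le> l" "l \<le> Suc (nsta I)" "i + l = p + nsta I + 1" "\<And>j. j \<in> seen p \<Longrightarrow> bat j = num j"
    "\<And>q. p \<le> q \<Longrightarrow> q \<le> ndel I \<Longrightarrow> l \<le> nsta I \<Longrightarrow> tR I (Q q) < tA I l"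
    using inv p unfolding bat_inv_def by blast+
  let ?u = "Q p"
  have u: "?u \<in> dels I" "tL I ?u \<le> tR I ?u" using Q_dels[OF c(1) p] tL_le_tR by blast+
  have "num ?u = (if 2 \<le> l \<and> tL I ?u \<le> tD I (l - 1) then l - 1 else l)"
  proof (cases "2 \<le> l \<and> tL I ?u \<le> tD I (l - 1)")
    case True
    have tA: "tA I (l - 1) \<le> tR I ?u" using l True by simp
    have "tD I (l - 2) < tL I ?u" if "3 \<le> l"
    proof (rule ccontr)
      assume n: "\<not> tD I (l - 2) < tL I ?u"
      have "tA I (l - 2) < tD I (l - 2)" "tD I (l - 2) < tA I (l - 1)"
      proof -
        have "1 \<le> l - 2" "l - 2 < l - 1" "l - 1 \<le> nsta I" "l - 2 \<in> stas I" using that c(3) by auto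
        then show "tA I (l - 2) < tD I (l - 2)" "tD I (l - 2) < tA I (l - 1)"
          using tA_less_tD station_less by blast+
      qed
      then have "l - 2 = l - 1"
        using n tA True u that c(3) by (intro one_station[of ?u]) auto
      then show False using that by simp
    qed
    moreover have "l - 1 - 1 = l - 2" by simp
    ultimately have "?u \<in> batch I (l - 1)" using True u(1) by (simp add: batch_def)
    moreover have "l - 1 \<in> nums" using True c(3) by auto
    ultimately show ?thesis using num_eq[of ?u "l - 1"] True by simp
  next
    case False
    have "tL I ?u \<le> tD I l" if "l \<le> nsta I"
      using c(6)[of p] p that tA_less_tD[of l] c(2) u(2) by simp
    then have "?u \<in> batch I l" using False u(1) by (auto simp: batch_def)
    then show ?thesis using num_eq[of ?u l] False c(2,3) by auto
  qed
  then show ?thesis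
    using c p unfolding bat_inv_def seen_Suc[OF c(1)] by auto
qed

lemma wp_bat:
  assumes s: "mem s" "narr s ''Q'' = Q"
  shows "wp prog_bat (\<lambda>t s'. t \<le> 4 + (ndel I + nsta I) * 8 \<and> mem s' \<and> frame {''bat''} s s' \<and>
    (\<forall>j\<in>dels I. narr s' ''bat'' j = num j)) s"
  unfolding prog_bat_def wp_Seq[of "NAssign _ _"] wp_NAssign
proof (rule wp_For[where N = "ndel I + nsta I" and T = 6 and
      Inv = "\<lambda>i s'. mem s' \<and> frame {''bat''} s s' \<and> bat_inv i (nvar s' ''p'') (nvar s' ''l'') (narr s' ''bat'')"],
    goal_cases)
  case 1
  then show ?case using s memD(2)[OF s(1)] by (simp add: mem_nvar frame_refl bat_inv_def)
next
  case (2 i s')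
  then show ?case by (simp add: memD(1,2))
next
  case (3 i s')
  then have i: "nvar s' ''i'' = i" and m: "mem s'" and f: "frame {''bat''} s s'" by simp_all
  have q: "narr s' ''Q'' = Q" using f s by (simp add: frameD)
  define p l u where "p = nvar s' ''p''" and "l = nvar s' ''l''" and "u = Q p"
  have b: "bat_inv i p l (narr s' ''bat'')" using 3 by (simp add: p_def l_def)
  then have pl: "1 \<le> p" "p \<le> Suc (ndel I)" "1 \<le> l" "l \<le> Suc (nsta I)" unfolding bat_inv_def by blast+
  have tu: "p \<le> ndel I \<Longrightarrow> rarr s' ''tR'' u = tR I u \<and> rarr s' ''tL'' u = tL I u"
    using Q_dels[of p] pl(1) memD(4,5)[OF m] by (simp add: u_def)
  have tl: "2 \<le> l \<Longrightarrow> rarr s' ''tA'' (l - 1) = tA I (l - 1) \<and> rarr s' ''tD'' (l - 1) = tD I (l - 1)"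
    using memD(7,8)[OF m] pl(4) by simp
  have idle: "\<not> p \<le> ndel I \<Longrightarrow> bat_inv (Suc i) p l (narr s' ''bat'')" using b unfolding bat_inv_def by auto
  have down: "p \<le> ndel I \<Longrightarrow> 2 \<le> l \<Longrightarrow> tR I u < tA I (l - 1) \<Longrightarrow> bat_inv (Suc i) p (l - 1) (narr s' ''bat'')"
    using bat_inv_down[OF b] by (simp add: u_def)
  have stop1: "p \<le> ndel I \<Longrightarrow> \<not> (2 \<le> l \<and> tR I u < tA I (l - 1)) \<Longrightarrow> 2 \<le> l \<and> tL I u \<le> tD I (l - 1) \<Longrightarrow>
      bat_inv (Suc i) (Suc p) l ((narr s' ''bat'')(u := l - 1))"
    and stop2: "p \<le> ndel I \<Longrightarrow> \<not> (2 \<le> l \<and> tR I u < tA I (l - 1)) \<Longrightarrow> \<not> (2 \<le> l \<and> tL I u \<le> tD I (l - 1)) \<Longrightarrow>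
      bat_inv (Suc i) (Suc p) l ((narr s' ''bat'')(u := l))"
    using bat_inv_stop[OF b] unfolding u_def by presburger+
  show ?case
  proof (cases "2 \<le> l")
    case True
    then show ?thesis
      unfolding wp_simps
      using m f i memD(1,2)[OF m] q tu tl[OF True] idle down stop1 stop2
      by (auto simp: mem_nvar frame_def p_def[symmetric] l_def[symmetric] u_def[symmetric] not_le)
  next
    case False
    then show ?thesis
      unfolding wp_simps
      using m f i memD(1,2)[OF m] q tu idle stop2
      by (auto simp: mem_nvar frame_def p_def[symmetric] l_def[symmetric] u_def[symmetric] not_le)
  qed
next
  case (4 t s')
  then have b: "bat_inv (Suc (ndel I + nsta I)) (nvar s' ''p'') (nvar s' ''l'') (narr s' ''bat'')" by blast
  \<comment> \<open>If a delivery were left after \<open>ndel I + nsta I\<close> rounds, the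
    progress equation would give \<open>l + ndel I = p\<close>, contradicting \<open>1 <= l\<close>
    and \<open>p <= ndel I\<close>.\<close>
  have "nvar s' ''p'' = Suc (ndel I)"
  proof (rule ccontr)
    assume "nvar s' ''p'' \<noteq> Suc (ndel I)"
    then show False using b unfolding bat_inv_def by auto
  qed
  then have "\<forall>j\<in>dels I. narr s' ''bat'' j = num j" using b unfolding bat_inv_def by (metis seen_all)
  then show ?case using 4 by simp
qed

lemma wp_mate:
  assumes s: "mem s" "labels s" "narr s ''Q'' = Q" "narr s ''mate'' = (\<lambda>_. 0)" "narr s ''tk'' = (\<lambda>_. 0)"
  shows "wp prog_mate (\<lambda>t s'. t \<le> 2 + ndel I * (9 + 4 * ndel I) \<and> mem s' \<and> frame {''mate'', ''tk''} s s' \<and>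
    ddp_mate I Q (narr s' ''mate'')) s"
  unfolding prog_mate_def
proof (rule wp_For[where N = "ndel I" and T = "7 + 4 * ndel I" and Inv = "\<lambda>p s'. mem s' \<and>
    frame {''mate'', ''tk''} s s' \<and> mate_inv p (narr s' ''mate'') (narr s' ''tk'')"], goal_cases)
  case 1
  then show ?case using s mate_inv_init by (simp add: mem_nvar frame_refl)
next
  case (2 p s')
  then show ?case by (simp add: memD(1))
next
  case (3 p s')
  then have p: "1 \<le> p" "p \<le> ndel I" "nvar s' ''p'' = p" and m: "mem s'" and f: "frame {''mate'', ''tk''} s s'"
    and inv: "mate_inv p (narr s' ''mate'') (narr s' ''tk'')" by simp_all
  define u where "u = Q p"
  have ud: "u \<in> dels I" using Q_dels[OF p(1,2)] by (simp add: u_def)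
  have q: "narr s' ''Q'' p = u" using f s by (simp add: frameD u_def)
  have lab: "labels s'" using labels_frame[OF s(2) f] by simp
  note md = memD[OF m]
  let ?P = "\<lambda>j. narr s' ''bat'' j = narr s' ''bat'' u \<and> narr s' ''skip'' j \<noteq> 0 \<and> narr s' ''lf'' j = 0 \<and>
    narr s' ''tk'' j = 0 \<and> rarr s' ''tR'' u < rarr s' ''tL'' j \<and> rarr s' ''cost'' u + rarr s' ''cost'' j \<le> cap I"
  have step: "mate_inv (Suc p) ((narr s' ''mate'')(u := b)) ((narr s' ''tk'')(b := 1))"
    if "narr s' ''lf'' u \<noteq> 0" "best ?P (rarr s' ''cost'') (ndel I) b" for b
  proof (rule mate_inv_step[OF p(1,2) inv u_def])
    show "is_left u" using labelsD(2)[OF lab ud] that by blast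
    show "best (\<lambda>v. num v = num u \<and> is_ext v \<and> \<not> is_left v \<and> narr s' ''tk'' v = 0 \<and> tR I u < tL I v \<and>
      cost I u + cost I v \<le> cap I) (cost I) (ndel I) b"
    proof (rule iffD1[OF best_cong_key that(2)])
      fix j assume j: "j \<in> {1..ndel I}"
      have "rarr s' ''tL'' j = tL I j" "rarr s' ''cost'' j = cost I j" "rarr s' ''tR'' u = tR I u"
        "rarr s' ''cost'' u = cost I u"
        using md(4,5,6) j ud by simp_all
      then show "?P j \<longleftrightarrow> num j = num u \<and> is_ext j \<and> \<not> is_left j \<and> narr s' ''tk'' j = 0 \<and> tR I u < tL I j \<and>
        cost I u + cost I j \<le> cap I"
        using labelsD(1)[OF lab j] labelsD(1)[OF lab ud] labelsD(2,3)[OF lab j] by metis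
    qed (use md(6) in simp)
  qed
  have skip: "narr s' ''lf'' u = 0 \<Longrightarrow> mate_inv (Suc p) (narr s' ''mate'') (narr s' ''tk'')"
    using mate_inv_skip[OF p(1,2) inv] labelsD(2)[OF lab ud] unfolding u_def by blast
  have nq: "nval (At ''Q'' ''p'') s' = u" using p q by simp
  show ?case
    unfolding wp_Seq[of "NAssign _ _"] wp_NAssign wp_Cond wp_Skip nq
  proof (intro conjI impI, goal_cases)
    case 1
    then have lf: "narr s' ''lf'' u \<noteq> 0" by simp
    show ?case
      unfolding wp_Seq[of "Best _ _ _"]
    proof (rule wp_Best[where N = "ndel I" and P = ?P and K = "rarr s' ''cost''"], goal_cases)
      case (4 t b)
      then show ?case using step[OF lf 4(1)] m f p by (simp add: wp_simps mem_nvar frame_def)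
    qed (use md(1,3) in auto)
  qed (use skip m f p in \<open>simp_all add: mem_nvar\<close>)
next
  case (4 t s')
  then have inv: "mate_inv (Suc (ndel I)) (narr s' ''mate'') (narr s' ''tk'')" by blast
  have "ddp_mate I Q (narr s' ''mate'')"
  proof
    show "max_matching I l (mates l (narr s' ''mate''))" if "l \<in> nums" for l
      by (rule mate_inv_final[OF inv that])
    show "u \<in> dels I \<and> is_left u" if "narr s' ''mate'' u \<noteq> 0" for u
      using inv that unfolding mate_inv_def seen_all by blast
  qed
  then show ?case using 4 by (simp add: algebra_simps)
qed

end

section \<open>The coloring phase\<close>

context ddp_mate
begin

lemma wp_color:
  assumes s: "mem s" "labels s" "narr s ''Q'' = Q" "narr s ''mate'' = mate"
    and z: "narr s ''col'' = (\<lambda>_. 0)" "narr s ''tail'' = (\<lambda>_. 0)" "narr s ''nc'' = (\<lambda>_. 0)" "narr s ''zc'' = (\<lambda>_. 0)"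
  shows "wp prog_color (\<lambda>t s'. t \<le> 2 + ndel I * (16 + 4 * ndel I) \<and> mem s' \<and>
    frame {''col'', ''tail'', ''nc'', ''zc''} s s' \<and>
    color_inv (Suc (ndel I)) (narr s' ''col'') (narr s' ''tail'') (narr s' ''nc'') (narr s' ''zc'')) s"
  unfolding prog_color_def
proof (rule wp_For[where N = "ndel I" and T = "14 + 4 * ndel I" and Inv = "\<lambda>p s'. mem s' \<and>
    frame {''col'', ''tail'', ''nc'', ''zc''} s s' \<and>
    color_inv p (narr s' ''col'') (narr s' ''tail'') (narr s' ''nc'') (narr s' ''zc'')"], goal_cases)
  case 1
  then show ?case using s z color_inv_init by (simp add: mem_nvar frame_refl)
next
  case (2 p s')
  then show ?case by (simp add: memD(1))
next
  case (3 p s')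
  then have p: "1 \<le> p" "p \<le> ndel I" "nvar s' ''p'' = p" and m: "mem s'"
    and f: "frame {''col'', ''tail'', ''nc'', ''zc''} s s'"
    and inv: "color_inv p (narr s' ''col'') (narr s' ''tail'') (narr s' ''nc'') (narr s' ''zc'')" by simp_all
  define u where "u = Q p"
  have ud: "u \<in> dels I" using Q_dels[OF p(1,2)] by (simp add: u_def)
  have q: "narr s' ''Q'' p = u" "narr s' ''mate'' u = mate u" using f s by (simp_all add: frameD u_def)
  have lab: "labels s'" using labels_frame[OF s(2) f] by simp
  note md = memD[OF m] and lu = labelsD[OF lab ud]
  let ?P = "\<lambda>j. narr s' ''bat'' j = narr s' ''bat'' u \<and> narr s' ''tail'' j \<noteq> 0 \<and> rarr s' ''tR'' u < rarr s' ''tL'' j"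
  define E where "E = (narr s' ''skip'' u \<noteq> 0)"
  have E: "E \<longleftrightarrow> is_ext u" unfolding E_def by (rule lu(3))
  \<comment> \<open>Covers both ways to find a class to join: the prescribed mate for
    \<open>ext\<close>, any compatible tail otherwise. In either case \<open>b = 0\<close> asks for
    a new color.\<close>
  define ok where "ok b \<longleftrightarrow> (if E then b = mate u else best ?P (\<lambda>_. 0) (ndel I) b)" for b
  have P: "?P j \<longleftrightarrow> num j = num u \<and> tail \<noteq> 0 \<and> tR I u < tL I j"
    if "j \<in> dels I" "tail = narr s' ''tail'' j" for j tail
    using labelsD(1)[OF lab that(1)] lu(1) md(4)[of j] md(5)[of u] that ud by auto
  have join: "color_inv (Suc p) ((narr s' ''col'')(u := narr s' ''col'' b)) ((narr s' ''tail'')(b := 0, u := 1))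
      (narr s' ''nc'') (narr s' ''zc'')" if "ok b" "b \<noteq> 0" for b
  proof (rule color_inv_join[OF p(1,2) inv u_def that(2)])
    show "if is_ext u then b = mate u else narr s' ''tail'' b \<noteq> 0 \<and> num b = num u \<and> tR I u < tL I b"
    proof (cases "is_ext u")
      case True
      then show ?thesis using that(1) E unfolding ok_def by simp
    next
      case False
      then have "b \<in> dels I" "?P b" using that E unfolding ok_def best_def by auto
      then show ?thesis using P[of b] False by simp
    qed
  qed
  have new: "color_inv (Suc p) ((narr s' ''col'')(u := Suc (narr s' ''nc'' (num u)))) ((narr s' ''tail'')(u := 1))
      ((narr s' ''nc'')(num u := Suc (narr s' ''nc'' (num u))))
      (if is_ext u then (narr s' ''zc'')(num u := Suc (narr s' ''zc'' (num u))) else narr s' ''zc'')" if "ok 0"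
  proof (rule color_inv_new[OF p(1,2) inv u_def])
    show "mate u = 0" if "is_ext u" using \<open>ok 0\<close> that E unfolding ok_def by simp
    show "tL I i \<le> tR I u" if "\<not> is_ext u" "i \<in> dels I" "num i = num u" "narr s' ''tail'' i \<noteq> 0" for i
    proof -
      have "\<not> ?P i" using \<open>ok 0\<close> that(1,2) E unfolding ok_def best_def by auto
      then show ?thesis using P[of i] that by auto
    qed
  qed
  have new1: "ok 0 \<Longrightarrow> E \<Longrightarrow> color_inv (Suc p) ((narr s' ''col'')(u := Suc (narr s' ''nc'' (num u)))) ((narr s' ''tail'')(u := 1))
      ((narr s' ''nc'')(num u := Suc (narr s' ''nc'' (num u)))) ((narr s' ''zc'')(num u := Suc (narr s' ''zc'' (num u))))"
    and new2: "ok 0 \<Longrightarrow> \<not> E \<Longrightarrow> color_inv (Suc p) ((narr s' ''col'')(u := Suc (narr s' ''nc'' (num u)))) ((narr s' ''tail'')(u := 1))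
      ((narr s' ''nc'')(num u := Suc (narr s' ''nc'' (num u)))) (narr s' ''zc'')"
    using new E by presburger+
  have E': "E \<longleftrightarrow> 0 < narr s' ''skip'' u" by (simp add: E_def)
  have nq: "nval (At ''Q'' ''p'') s' = u" using p q by simp
  define s1 where "s1 = s'\<lparr>nvar := (nvar s')(''u'' := u)\<rparr>"
  show ?case
    unfolding wp_Seq[of "NAssign _ _"] wp_NAssign nq s1_def[symmetric]
  \<comment> \<open>The two branches are merged into one description of the state, so that the
    updates need to be verified only once. The bound is the guard plus a search.\<close>
  proof (rule wp_SeqI[where P = "\<lambda>t s2. t \<le> 4 + 4 * ndel I \<and>
      (\<exists>j b. s2 = s'\<lparr>nvar := (nvar s')(''u'' := u, ''j'' := j, ''b'' := b)\<rparr> \<and> ok b)"], goal_cases)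
    case 1
    show ?case
      unfolding wp_Cond
    proof (intro conjI impI, goal_cases)
      case 1
      then have "ok (mate u)" unfolding ok_def s1_def E' by simp
      have "(nvar s')(''u'' := u, ''b'' := mate u) = (nvar s')(''u'' := u, ''j'' := nvar s' ''j'', ''b'' := mate u)"
        by (simp add: fun_eq_iff)
      then have "\<exists>j b. s1\<lparr>nvar := (nvar s1)(''b'' := nval (At ''mate'' ''u'') s1)\<rparr> =
          s'\<lparr>nvar := (nvar s')(''u'' := u, ''j'' := j, ''b'' := b)\<rparr> \<and> ok b"
        using \<open>ok (mate u)\<close> q(2)
        by - (rule exI[where x = "nvar s' ''j''"], rule exI[where x = "mate u"], simp add: s1_def)
      then show ?case unfolding wp_NAssign by simp
    next
      case 2
      then have nE: "\<not> E" unfolding s1_def E' by simp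
      show ?case
      proof (rule wp_Best[where N = "ndel I" and P = ?P and K = "\<lambda>_. 0"], goal_cases)
        case (4 t b)
        then have "ok b" using nE unfolding ok_def by simp
        then show ?case using 4(2) unfolding s1_def by auto
      qed (use md(1) in \<open>auto simp: s1_def\<close>)
    qed
  next
    case (2 t s2)
    then obtain j b where t: "t \<le> 4 + 4 * ndel I"
      and s2: "s2 = s'\<lparr>nvar := (nvar s')(''u'' := u, ''j'' := j, ''b'' := b)\<rparr>" and ok: "ok b" by blast
    show ?case
    proof (cases "b = 0")
      case False
      then show ?thesis
        unfolding s2 using t p(3) lu(1) join[OF ok False] by (simp add: wp_simps mem_cong[OF m] frame_upd f)
    next
      case True
      then have ok0: "ok 0" using ok by simp
      show ?thesis
      proof (cases E)
        case e: True
        then show ?thesis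
          unfolding s2 using t p(3) lu(1) True new1[OF ok0 e] E' by (simp add: wp_simps mem_cong[OF m] frame_upd f)
      next
        case e: False
        then show ?thesis
          unfolding s2 using t p(3) lu(1) True new2[OF ok0 e] E' by (simp add: wp_simps mem_cong[OF m] frame_upd f)
      qed
    qed
  qed
next
  case (4 t s')
  then show ?case by (simp add: algebra_simps)
qed

lemma color_inv_locale:
  "color_inv (Suc (ndel I)) col tail nc zc \<Longrightarrow> ddp_col I Q mate col"
  by unfold_locales (rule color_inv_final(2))

end

context ddp_col
begin

lemma wp_pack:
  assumes s: "mem s" "labels s" "narr s ''Q'' = Q" "narr s ''col'' = col"
    and z: "narr s ''blk'' = (\<lambda>_. 0)" "narr s ''nb'' = (\<lambda>_. 0)"
  shows "wp prog_pack (\<lambda>t s'. t \<le> 2 + ndel I * (12 + 4 * ndel I) \<and> mem s' \<and>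
    frame {''blk'', ''nb''} s s' \<and>
    pack_inv (Suc (ndel I)) (narr s' ''blk'') (rarr s' ''rem'') (narr s' ''nb'')) s"
  unfolding prog_pack_def
proof (rule wp_For[where N = "ndel I" and T = "10 + 4 * ndel I" and Inv = "\<lambda>p s'. mem s' \<and>
    frame {''blk'', ''nb''} s s' \<and> pack_inv p (narr s' ''blk'') (rarr s' ''rem'') (narr s' ''nb'')"], goal_cases)
  case 1
  then show ?case using s z pack_inv_init by (simp add: mem_nvar frame_refl)
next
  case (2 p s')
  then show ?case by (simp add: memD(1))
next
  case (3 p s')
  then have p: "1 \<le> p" "p \<le> ndel I" "nvar s' ''p'' = p" and m: "mem s'"
    and f: "frame {''blk'', ''nb''} s s'"
    and inv: "pack_inv p (narr s' ''blk'') (rarr s' ''rem'') (narr s' ''nb'')" by simp_all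
  define u where "u = Q p"
  have ud: "u \<in> dels I" using Q_dels[OF p(1,2)] by (simp add: u_def)
  have q: "narr s' ''Q'' p = u" "narr s' ''col'' = col" using f s by (simp_all add: frameD u_def)
  have lab: "labels s'" using labels_frame[OF s(2) f] by simp
  note md = memD[OF m] and lu = labelsD(1)[OF lab ud]
  have cu: "rarr s' ''cost'' u = cost I u" using md(6) ud by simp
  let ?P = "\<lambda>j. narr s' ''blk'' j = j \<and> narr s' ''bat'' j = narr s' ''bat'' u \<and> narr s' ''col'' j = narr s' ''col'' u \<and>
    rarr s' ''cost'' u \<le> rarr s' ''rem'' j"
  have P: "?P j \<longleftrightarrow> narr s' ''blk'' j = j \<and> num j = num u \<and> col j = col u \<and> cost I u \<le> rarr s' ''rem'' j"
    if "j \<in> dels I" for j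
    using labelsD(1)[OF lab that] lu cu q(2) by simp
  have join: "pack_inv (Suc p) ((narr s' ''blk'')(u := b)) ((rarr s' ''rem'')(b := rarr s' ''rem'' b - cost I u))
      (narr s' ''nb'')" if "best ?P (\<lambda>_. 0) (ndel I) b" "b \<noteq> 0" for b
  proof -
    have "b \<in> dels I" "?P b" using that unfolding best_def by auto
    then show ?thesis using P[of b] by (intro pack_inv_join[OF p(1,2) inv u_def]) simp_all
  qed
  have new: "pack_inv (Suc p) ((narr s' ''blk'')(u := u)) ((rarr s' ''rem'')(u := cap I - cost I u))
      ((narr s' ''nb'')(num u := Suc (narr s' ''nb'' (num u))))" if "best ?P (\<lambda>_. 0) (ndel I) 0"
  proof (rule pack_inv_new[OF p(1,2) inv u_def])
    fix i assume i: "i \<in> dels I" "narr s' ''blk'' i = i" "num i = num u" "col i = col u"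
    have "\<not> ?P i" using that i(1) unfolding best_def by auto
    then show "\<not> cost I u \<le> rarr s' ''rem'' i" using P[OF i(1)] i(2-4) by blast
  qed
  have nq: "nval (At ''Q'' ''p'') s' = u" using p q by simp
  show ?case
    unfolding wp_Seq[of "NAssign _ _"] wp_NAssign nq wp_Seq[of "Best _ _ _"]
  proof (rule wp_Best[where N = "ndel I" and P = ?P and K = "\<lambda>_. 0"], goal_cases)
    case (4 t b)
    show ?case
    proof (cases "b = 0")
      case True
      then have "best ?P (\<lambda>_. 0) (ndel I) 0" using 4(1) by simp
      then show ?thesis
        using True 4(2) p(3) lu cu md(3) new
        by (simp add: wp_simps mem_cong[OF m] frame_upd f)
    next
      case False
      then show ?thesis
        using 4(2) p(3) cu join[OF 4(1) False]
        by (simp add: wp_simps mem_cong[OF m] frame_upd f)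
    qed
  qed (use md(1) in auto)
next
  case (4 t s')
  then show ?case by (simp add: algebra_simps)
qed

lemma pack_inv_locale:
  assumes c: "color_inv (Suc (ndel I)) col' tail nc zc" and p: "pack_inv (Suc (ndel I)) blk rem nb"
  shows "ddp_packed I Q mate col blk nb zc"
proof
  show "blk j \<in> dels I \<and> blk (blk j) = blk j \<and> num (blk j) = num j \<and> (is_ext j \<longrightarrow> is_ext (blk j))"
    if "j \<in> dels I" for j
    using pack_invD(2)[OF p, of j] that unfolding seen_all by blast
  show "nb l = card {i \<in> dels I. blk i = i \<and> num i = l}" for l
    using pack_invD(4)[OF p, of l] unfolding seen_all .
  show "Some (all_blocks blk l, zc l) \<in> process_batch I l" if "l \<in> nums" for l
    using pack_inv_final[OF p that] color_inv_final(1)[OF c that] by simp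
qed

end

lemma best_Max:
  assumes "best (\<lambda>_. True) (\<lambda>l. real (f l)) (Suc N) b"
  shows "f b = Max (f ` {1..N + 1})"
proof -
  have b: "b \<in> {1..N + 1}" "\<And>l. l \<in> {1..N + 1} \<Longrightarrow> f l \<le> f b" using assms unfolding best_def by auto
  show ?thesis by (rule sym, rule Max_eqI) (use b in auto)
qed

context ddp_packed
begin

text \<open>Two searches over \<open>nsta I + 1\<close> batches take \<open>7 + 4 * nsta I\<close>
  steps each, and there are two assignments. Apart from the merge this is the only phase whose time
  depends on the number of stations.\<close>

lemma wp_m:
  assumes s: "mem s" "narr s ''nb'' = nb" "narr s ''zc'' = zc"
  shows "wp prog_m (\<lambda>t s'. t \<le> 16 + 8 * nsta I \<and> mem s' \<and> narr s' = narr s \<and> nvar s' ''m'' = m) s"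
  unfolding prog_m_def wp_Seq wp_NAssign
proof (rule wp_Best[where N = "Suc (nsta I)" and P = "\<lambda>_. True" and K = "\<lambda>l. real (nb l)"], goal_cases)
  case (4 t b)
  then have nb: "nb b = Max (nb ` nums)" by (intro best_Max)
  show ?case
  proof (rule wp_Best[where N = "Suc (nsta I)" and P = "\<lambda>_. True" and K = "\<lambda>l. real (zc l)"], goal_cases)
    case (4 t' b')
    then have zc: "zc b' = Max (zc ` nums)" by (intro best_Max)
    have "nb b + zc b' = m" unfolding nb zc m_def ..
    then show ?case using 4(2) \<open>t \<le> 3 + 4 * Suc (nsta I)\<close> s by (simp add: mem_cong[OF s(1)])
  qed (use s memD(2)[OF s(1)] in auto)
qed (use s memD(2)[OF s(1)] in auto)

text \<open>\<open>Z\<close> lists the deliveries by batch number, the order in which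
  \<open>drone_inv_step\<close> can be applied; a delivery that founds no block is passed
  over.\<close>

lemma wp_drones:
  assumes s: "mem s" "labels s" "nvar s ''m'' = m" "narr s ''blk'' = blk"
    and Z: "bij_betw (narr s ''Z'') {1..ndel I} (dels I)"
      "\<And>p q. 1 \<le> p \<Longrightarrow> p \<le> q \<Longrightarrow> q \<le> ndel I \<Longrightarrow> num (narr s ''Z'' p) \<le> num (narr s ''Z'' q)"
    and z: "narr s ''dr'' = (\<lambda>_. 0)" "narr s ''dl'' = (\<lambda>_. 0)" "narr s ''dx'' = (\<lambda>_. 0)"
  shows "wp prog_drones (\<lambda>t s'. t \<le> 2 + ndel I * (12 + 4 * m) \<and> mem s' \<and> frame {''dr'', ''dl'', ''dx''} s s' \<and>
    nvar s' ''m'' = m \<and> drone_inv {i \<in> dels I. blk i = i} (narr s' ''dr'') (narr s' ''dl'') (narr s' ''dx'')) s"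
  unfolding prog_drones_def
proof (rule wp_For[where N = "ndel I" and T = "10 + 4 * m" and Inv = "\<lambda>p s'. mem s' \<and>
    frame {''dr'', ''dl'', ''dx''} s s' \<and> nvar s' ''m'' = m \<and>
    drone_inv {i \<in> narr s ''Z'' ` {1..<p}. blk i = i} (narr s' ''dr'') (narr s' ''dl'') (narr s' ''dx'')"], goal_cases)
  case 1
  then show ?case using s z drone_inv_init by (simp add: mem_nvar frame_refl)
next
  case (2 p s')
  then show ?case by (simp add: memD(1))
next
  case (3 p s')
  let ?R = "\<lambda>p. {i \<in> narr s ''Z'' ` {1..<p}. blk i = i}"
  from 3 have p: "1 \<le> p" "p \<le> ndel I" "nvar s' ''p'' = p" and m: "mem s'"
    and f: "frame {''dr'', ''dl'', ''dx''} s s'" and mm: "nvar s' ''m'' = m"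
    and inv: "drone_inv (?R p) (narr s' ''dr'') (narr s' ''dl'') (narr s' ''dx'')" by simp_all
  define u where "u = narr s ''Z'' p"
  have ud: "u \<in> dels I" using bij_betwE[OF Z(1)] p by (simp add: u_def)
  have q: "narr s' ''Z'' p = u" "narr s' ''blk'' = blk" using f s by (simp_all add: frameD u_def)
  have lab: "labels s'" using labels_frame[OF s(2) f] by simp
  note lu = labelsD[OF lab ud]
  have image: "narr s ''Z'' ` {1..<Suc p} = insert u (narr s ''Z'' ` {1..<p})"
    using p(1) by (auto simp: u_def less_Suc_eq)
  have notin: "u \<notin> narr s ''Z'' ` {1..<p}"
  proof
    assume "u \<in> narr s ''Z'' ` {1..<p}"
    then obtain k where k: "1 \<le> k" "k < p" "narr s ''Z'' p = narr s ''Z'' k" unfolding u_def by auto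
    have "inj_on (narr s ''Z'') {1..ndel I}" using Z(1) by (simp add: bij_betw_def)
    from inj_onD[OF this k(3)] show False using k p by simp
  qed
  have idle: "blk u \<noteq> u \<Longrightarrow> drone_inv (?R (Suc p)) (narr s' ''dr'') (narr s' ''dl'') (narr s' ''dx'')"
  proof -
    assume "blk u \<noteq> u"
    then have "?R (Suc p) = ?R p" unfolding image by blast
    then show ?thesis using inv by simp
  qed
  define E where "E = (narr s' ''skip'' u \<noteq> 0)"
  have E: "E \<longleftrightarrow> is_ext u" unfolding E_def by (rule lu(3))
  let ?P = "\<lambda>d. narr s' ''dl'' d \<noteq> num u \<and> narr s' ''dx'' d \<noteq> num u"
  have step: "drone_inv (?R (Suc p)) ((narr s' ''dr'')(u := d)) ((narr s' ''dl'')(d := num u))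
      (if E then (narr s' ''dx'')(d := Suc (num u)) else narr s' ''dx'')"
    if "blk u = u" "best ?P (\<lambda>_. 0) m d" for d
  proof -
    have R: "?R (Suc p) = insert u (?R p)" unfolding image using that(1) by blast
    have sub: "?R p \<subseteq> {i \<in> dels I. blk i = i}" using bij_betwE[OF Z(1)] p by auto
    have le: "num i \<le> num u" if "i \<in> ?R p" for i using that Z(2)[of _ p] p unfolding u_def by auto
    show ?thesis unfolding R E
      by (rule drone_inv_step[OF inv sub le ud that(1) _ that(2)]) (use notin in auto)
  qed
  have nq: "nval (At ''Z'' ''p'') s' = u" using p q by simp
  show ?case
    unfolding wp_Seq[of "NAssign _ _"] wp_NAssign wp_Cond wp_Skip nq
  proof (intro conjI impI, goal_cases)
    case 1
    then have bu: "blk u = u" using q by simp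
    show ?case
      unfolding wp_Seq[of "Best _ _ _"]
    proof (rule wp_Best[where N = m and P = ?P and K = "\<lambda>_. 0"], goal_cases)
      case (4 t d)
      note st = step[OF bu 4(1)]
      show ?case
      proof (cases E)
        case True
        then show ?thesis using st 4(2) p(3) mm lu(1) E_def
          by (simp add: wp_simps mem_cong[OF m] frame_upd f)
      next
        case False
        then show ?thesis using st 4(2) p(3) mm lu(1) E_def
          by (simp add: wp_simps mem_cong[OF m] frame_upd f)
      qed
    qed (use mm lu(1) in auto)
  qed (use m f p mm idle q in \<open>auto simp: mem_nvar\<close>)
next
  case (4 t s')
  have set: "{1..<Suc (ndel I)} = {1..ndel I}" by auto
  have "narr s ''Z'' ` {1..<Suc (ndel I)} = dels I" using Z(1) unfolding set bij_betw_def by blast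
  then show ?case using 4 by (simp add: algebra_simps)
qed

lemma wp_out:
  assumes s: "mem s" "narr s ''blk'' = blk" "nvar s ''m'' = m"
  shows "wp prog_out (\<lambda>t s'. t \<le> 2 + ndel I * 3 \<and> frame {''drone''} s s' \<and> nvar s' ''m'' = m \<and>
    (\<forall>j\<in>dels I. narr s' ''drone'' j = narr s ''dr'' (blk j))) s"
  unfolding prog_out_def
proof (rule wp_For[where N = "ndel I" and T = 1 and Inv = "\<lambda>p s'. mem s' \<and> frame {''drone''} s s' \<and>
    nvar s' ''m'' = m \<and> (\<forall>j\<in>{1..<p}. narr s' ''drone'' j = narr s ''dr'' (blk j))"], goal_cases)
  case 1
  then show ?case using s by (simp add: mem_nvar frame_refl)
next
  case (2 p s')
  then show ?case by (simp add: memD(1))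
next
  case (3 p s')
  then have p: "nvar s' ''p'' = p" and m: "mem s'" and f: "frame {''drone''} s s'" and mm: "nvar s' ''m'' = m"
    and inv: "\<forall>j\<in>{1..<p}. narr s' ''drone'' j = narr s ''dr'' (blk j)" by simp_all
  have q: "narr s' ''blk'' = blk" "narr s' ''dr'' = narr s ''dr''" using f s by (simp_all add: frameD)
  show ?case using p mm q inv by (auto simp: wp_simps mem_cong[OF m] frame_upd f less_Suc_eq)
next
  case (4 t s')
  then show ?case by auto
qed

text \<open>The search for a free drone runs over all \<open>m\<close> drones, so a bound linear in
  the number of deliveries is needed for quadratic time.\<close>

lemma m_le:
  assumes "\<And>l. l \<in> nums \<Longrightarrow> zc l \<le> ndel I"
  shows "m \<le> 2 * ndel I"
proof -
  have "nb l \<le> ndel I" for l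
  proof -
    have "nb l \<le> card (dels I)" unfolding nb by (intro card_mono) auto
    then show ?thesis by simp
  qed
  then have "Max (nb ` nums) \<le> ndel I" by (intro Max.boundedI) auto
  moreover have "Max (zc ` nums) \<le> ndel I" using assms by (intro Max.boundedI) auto
  ultimately show ?thesis unfolding m_def by linarith
qed

end

section \<open>The whole program and its step count\<close>

definition main :: com where
  "main = Seq (Sort ''Q'' ''dn'' (RLe (RAt ''tR'' ''b'') (RAt ''tR'' ''j'')))
     (Seq prog_bat (Seq prog_labels (Seq prog_mate (Seq prog_color (Seq prog_pack
     (Seq (Sort ''Z'' ''dz'' (NLe (At ''bat'' ''j'') (At ''bat'' ''b''))) (Seq prog_m (Seq prog_drones prog_out))))))))"

context ddp
begin

lemma mem_initial: "mem (initial I)" and narr_initial: "narr (initial I) a = (\<lambda>_. 0)"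
  by (simp_all add: mem_def initial_def)

text \<open>The locales are interpreted in the arrays actually computed: the postcondition of a
  phase supplies the locale assumptions of the next, and the frames show that arrays not yet written
  are still 0.\<close>

lemma exec_main:
  "\<exists>t s. exec main (initial I) t s \<and> t \<le> 150 * (ndel I * ndel I + nsta I) \<and> Some (solution I s) \<in> mod_alg I"
proof -
  let ?n = "ndel I" and ?s0 = "initial I"
  have "wp (Sort ''Q'' ''dn'' (RLe (RAt ''tR'' ''b'') (RAt ''tR'' ''j'')))
    (\<lambda>t s'. t \<le> 2 + ?n * (7 + 4 * ?n) \<and> mem s' \<and> frame {''Q'', ''dn''} ?s0 s' \<and>
      bij_betw (narr s' ''Q'') {1..?n} {1..?n} \<and>
      (\<forall>p q. 1 \<le> p \<longrightarrow> p \<le> q \<longrightarrow> q \<le> ?n \<longrightarrow> tR I (narr s' ''Q'' q) \<le> tR I (narr s' ''Q'' p))) ?s0"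
    by (rule wp_Sort) (auto simp: mem_initial narr_initial memD(5))
  then obtain t1 s1 where e1: "exec (Sort ''Q'' ''dn'' (RLe (RAt ''tR'' ''b'') (RAt ''tR'' ''j''))) ?s0 t1 s1"
    and t1: "t1 \<le> 2 + ?n * (7 + 4 * ?n)" and m1: "mem s1" and f1: "frame {''Q'', ''dn''} ?s0 s1"
    and Q: "bij_betw (narr s1 ''Q'') {1..?n} {1..?n}"
      "\<And>p q. 1 \<le> p \<Longrightarrow> p \<le> q \<Longrightarrow> q \<le> ?n \<Longrightarrow> tR I (narr s1 ''Q'' q) \<le> tR I (narr s1 ''Q'' p)"
    unfolding wp_def by blast
  note z1 = frameD[OF f1] narr_initial
  interpret ddp_order I "narr s1 ''Q''" by unfold_locales (rule Q)+
  obtain t2 s2 where e2: "exec prog_bat s1 t2 s2" and t2: "t2 \<le> 4 + (?n + nsta I) * 8" and m2: "mem s2"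
    and f2: "frame {''bat''} s1 s2" and b2: "\<forall>j\<in>dels I. narr s2 ''bat'' j = num j"
    using wp_bat[OF m1 refl] unfolding wp_def by blast
  note z2 = frameD[OF f2] z1
  have "wp prog_labels (\<lambda>t s'. t \<le> 2 + ?n * 8 \<and> mem s' \<and> frame {''lf'', ''skip''} s2 s' \<and> labels s') s2"
    by (rule wp_labels[OF m2]) (simp_all add: z2 b2)
  then obtain t3 s3 where e3: "exec prog_labels s2 t3 s3" and t3: "t3 \<le> 2 + ?n * 8" and m3: "mem s3"
    and f3: "frame {''lf'', ''skip''} s2 s3" and l3: "labels s3"
    unfolding wp_def by blast
  have "wp prog_mate (\<lambda>t s'. t \<le> 2 + ?n * (9 + 4 * ?n) \<and> mem s' \<and> frame {''mate'', ''tk''} s3 s' \<and>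
    ddp_mate I (narr s1 ''Q'') (narr s' ''mate'')) s3"
    by (rule wp_mate[OF m3 l3]) (simp_all add: frameD[OF f3] frameD[OF f2] frameD[OF f1] narr_initial)
  then obtain t4 s4 where e4: "exec prog_mate s3 t4 s4" and t4: "t4 \<le> 2 + ?n * (9 + 4 * ?n)" and m4: "mem s4"
    and f4: "frame {''mate'', ''tk''} s3 s4" and L4: "ddp_mate I (narr s1 ''Q'') (narr s4 ''mate'')"
    unfolding wp_def by blast
  interpret M: ddp_mate I "narr s1 ''Q''" "narr s4 ''mate''" by (rule L4)
  have l4: "labels s4" using labels_frame[OF l3 f4] by simp
  have "wp prog_color (\<lambda>t s'. t \<le> 2 + ?n * (16 + 4 * ?n) \<and> mem s' \<and>
    frame {''col'', ''tail'', ''nc'', ''zc''} s4 s' \<and>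
    M.color_inv (Suc ?n) (narr s' ''col'') (narr s' ''tail'') (narr s' ''nc'') (narr s' ''zc'')) s4"
    by (rule M.wp_color[OF m4 l4])
      (simp_all add: frameD[OF f4] frameD[OF f3] frameD[OF f2] frameD[OF f1] narr_initial)
  then obtain t5 s5 where e5: "exec prog_color s4 t5 s5" and t5: "t5 \<le> 2 + ?n * (16 + 4 * ?n)" and m5: "mem s5"
    and f5: "frame {''col'', ''tail'', ''nc'', ''zc''} s4 s5"
    and c5: "M.color_inv (Suc ?n) (narr s5 ''col'') (narr s5 ''tail'') (narr s5 ''nc'') (narr s5 ''zc'')"
    unfolding wp_def by blast
  interpret C: ddp_col I "narr s1 ''Q''" "narr s4 ''mate''" "narr s5 ''col''" by (rule M.color_inv_locale[OF c5])
  have l5: "labels s5" using labels_frame[OF l4 f5] by simp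
  have "wp prog_pack (\<lambda>t s'. t \<le> 2 + ?n * (12 + 4 * ?n) \<and> mem s' \<and>
    frame {''blk'', ''nb''} s5 s' \<and>
    C.pack_inv (Suc ?n) (narr s' ''blk'') (rarr s' ''rem'') (narr s' ''nb'')) s5"
    by (rule C.wp_pack[OF m5 l5])
      (simp_all add: frameD[OF f5] frameD[OF f4] frameD[OF f3] frameD[OF f2] frameD[OF f1] narr_initial)
  then obtain t6 s6 where e6: "exec prog_pack s5 t6 s6" and t6: "t6 \<le> 2 + ?n * (12 + 4 * ?n)" and m6: "mem s6"
    and f6: "frame {''blk'', ''nb''} s5 s6"
    and p6: "C.pack_inv (Suc ?n) (narr s6 ''blk'') (rarr s6 ''rem'') (narr s6 ''nb'')"
    unfolding wp_def by blast
  interpret D: ddp_packed I "narr s1 ''Q''" "narr s4 ''mate''" "narr s5 ''col''" "narr s6 ''blk''" "narr s6 ''nb''" "narr s5 ''zc''"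
    by (rule C.pack_inv_locale[OF c5 p6])
  have l6: "labels s6" using labels_frame[OF l5 f6] by simp
  let ?S = "Sort ''Z'' ''dz'' (NLe (At ''bat'' ''j'') (At ''bat'' ''b''))"
  have "wp ?S
    (\<lambda>t s'. t \<le> 2 + ?n * (7 + 4 * ?n) \<and> mem s' \<and> frame {''Z'', ''dz''} s6 s' \<and>
      bij_betw (narr s' ''Z'') {1..?n} {1..?n} \<and>
      (\<forall>p q. 1 \<le> p \<longrightarrow> p \<le> q \<longrightarrow> q \<le> ?n \<longrightarrow> - real (num (narr s' ''Z'' q)) \<le> - real (num (narr s' ''Z'' p)))) s6"
  proof (rule wp_Sort[OF m6, where K = "\<lambda>j. - real (num j)"])
    fix s' i b
    assume a: "frame {''Z'', ''dz''} s6 s'" "1 \<le> i" "i \<le> ndel I" "1 \<le> b" "b \<le> ndel I"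
    have "labels s'" using labels_frame[OF l6 a(1)] by simp
    then have "narr s' ''bat'' i = num i" "narr s' ''bat'' b = num b" using a labelsD(1) by simp_all
    then show "bval (NLe (At ''bat'' ''j'') (At ''bat'' ''b'')) (s'\<lparr>nvar := (nvar s')(''j'' := i, ''b'' := b)\<rparr>) \<longleftrightarrow>
        - real (num b) \<le> - real (num i)" by simp
  qed (simp_all add: frameD[OF f6] frameD[OF f5] frameD[OF f4] frameD[OF f3] frameD[OF f2] frameD[OF f1] narr_initial)
  then obtain t7 s7 where e7: "exec ?S s6 t7 s7"
    and t7: "t7 \<le> 2 + ?n * (7 + 4 * ?n)" and m7: "mem s7" and f7: "frame {''Z'', ''dz''} s6 s7"
    and Z: "bij_betw (narr s7 ''Z'') {1..?n} (dels I)"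
      "\<And>p q. 1 \<le> p \<Longrightarrow> p \<le> q \<Longrightarrow> q \<le> ?n \<Longrightarrow> - real (num (narr s7 ''Z'' q)) \<le> - real (num (narr s7 ''Z'' p))"
    unfolding wp_def by blast
  have l7: "labels s7" using labels_frame[OF l6 f7] by simp
  have "wp prog_m (\<lambda>t s'. t \<le> 16 + 8 * nsta I \<and> mem s' \<and> narr s' = narr s7 \<and> nvar s' ''m'' = D.m) s7"
    by (rule D.wp_m[OF m7]) (simp_all add: frameD[OF f7] frameD[OF f6])
  then obtain t8 s8 where e8: "exec prog_m s7 t8 s8" and t8: "t8 \<le> 16 + 8 * nsta I" and m8: "mem s8"
    and n8: "narr s8 = narr s7" and mm8: "nvar s8 ''m'' = D.m"
    unfolding wp_def by blast
  have l8: "labels s8" using l7 n8 unfolding labels_def by simp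
  have "wp prog_drones (\<lambda>t s'. t \<le> 2 + ?n * (12 + 4 * D.m) \<and> mem s' \<and> frame {''dr'', ''dl'', ''dx''} s8 s' \<and>
    nvar s' ''m'' = D.m \<and>
    D.drone_inv {i \<in> dels I. narr s6 ''blk'' i = i} (narr s' ''dr'') (narr s' ''dl'') (narr s' ''dx'')) s8"
  proof (rule D.wp_drones[OF m8 l8 mm8 _ Z(1)[folded n8]])
    show "num (narr s8 ''Z'' p) \<le> num (narr s8 ''Z'' q)" if "1 \<le> p" "p \<le> q" "q \<le> ?n" for p q
      using Z(2)[OF that] n8 by simp
  qed (simp_all add: n8 frameD[OF f7] frameD[OF f6] frameD[OF f5] frameD[OF f4] frameD[OF f3] frameD[OF f2] frameD[OF f1] narr_initial)
  then obtain t9 s9 where e9: "exec prog_drones s8 t9 s9" and t9: "t9 \<le> 2 + ?n * (12 + 4 * D.m)" and m9: "mem s9"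
    and f9: "frame {''dr'', ''dl'', ''dx''} s8 s9" and mm9: "nvar s9 ''m'' = D.m"
    and d9: "D.drone_inv {i \<in> dels I. narr s6 ''blk'' i = i} (narr s9 ''dr'') (narr s9 ''dl'') (narr s9 ''dx'')"
    unfolding wp_def by blast
  have l9: "labels s9" using labels_frame[OF l8 f9] by simp
  have "wp prog_out (\<lambda>t s'. t \<le> 2 + ?n * 3 \<and> frame {''drone''} s9 s' \<and> nvar s' ''m'' = D.m \<and>
    (\<forall>j\<in>dels I. narr s' ''drone'' j = narr s9 ''dr'' (narr s6 ''blk'' j))) s9"
    by (rule D.wp_out[OF m9 _ mm9]) (simp add: frameD[OF f9] n8 frameD[OF f7])
  then obtain t10 s10 where e10: "exec prog_out s9 t10 s10" and t10: "t10 \<le> 2 + ?n * 3"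
    and f10: "frame {''drone''} s9 s10" and mm10: "nvar s10 ''m'' = D.m"
    and dr: "\<And>j. j \<in> dels I \<Longrightarrow> narr s10 ''drone'' j = narr s9 ''dr'' (narr s6 ''blk'' j)"
    unfolding wp_def by blast
  have l10: "labels s10" using labels_frame[OF l9 f10] by simp
  have sol: "Some (solution I s10) \<in> mod_alg I"
    using D.drone_inv_final[OF d9 dr labelsD(4)[OF l10]] unfolding solution_def Let_def mm10 by blast
  have ex: "exec main ?s0 (t1 + (t2 + (t3 + (t4 + (t5 + (t6 + (t7 + (t8 + (t9 + t10))))))))) s10"
    unfolding main_def by (rule exec.Seq[OF e1] exec.Seq[OF e2] exec.Seq[OF e3] exec.Seq[OF e4] exec.Seq[OF e5]
      exec.Seq[OF e6] exec.Seq[OF e7] exec.Seq[OF e8] exec.Seq[OF e9 e10])+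
  have "narr s5 ''zc'' l \<le> ?n" for l
  proof -
    have "narr s5 ''zc'' l = card {j \<in> seen (Suc ?n). num j = l \<and> is_ext j \<and> narr s4 ''mate'' j = 0}"
      by (rule M.color_invD(7)[OF c5])
    also have "\<dots> \<le> card (dels I)" unfolding seen_all by (intro card_mono) auto
    finally show ?thesis by simp
  qed
  then have "D.m \<le> 2 * ?n" by (intro D.m_le)
  then have "?n * (12 + 4 * D.m) \<le> ?n * (12 + 8 * ?n)" by (intro mult_le_mono2) simp
  also have "\<dots> = 12 * ?n + 8 * (?n * ?n)" by (simp add: distrib_left)
  finally have t9': "t9 \<le> 2 + 12 * ?n + 8 * (?n * ?n)" using t9 by linarith
  have n: "1 \<le> ?n * ?n" "?n \<le> ?n * ?n" using ndel_pos by simp_all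
  \<comment> \<open>With n = \<open>ndel I\<close> and r = \<open>nsta I\<close> the bounds add up
    to 28 n^2 + 82 n + 36 + 16 r. As n is at least 1, the part without r is at most 146 n^2, and 150
    is a rounded value.\<close>
  have "t1 + (t2 + (t3 + (t4 + (t5 + (t6 + (t7 + (t8 + (t9 + t10)))))))) \<le> 150 * (?n * ?n + nsta I)"
    using t1 t2 t3 t4 t5 t6 t7 t8 t9' t10 n unfolding distrib_left distrib_right by linarith
  then show ?thesis using ex sol by blast
qed

end

theorem theorem5:
  shows
    "(\<exists>(prog :: com) (K :: real). \<forall>I. ddp_sc I \<longrightarrow>
        (\<exists>t s. exec prog (initial I) t s \<and>
               real t \<le> K * (real (ndel I) powr 2.273 + real (nsta I)) \<and>
               Some (solution I s) \<in> mod_alg I)) \<and>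
     (\<forall>I. ddp_sc I \<longrightarrow>
        (\<forall>res \<in> mod_alg I. \<exists>m A. res = Some (m, A) \<and>
           feasible_schedule I m A \<and>
           real m \<le> (3 + (eps_max I - eps_min I) / (1 - eps_max I)) * real (OPT_SC I)))"
proof (intro conjI exI[of _ main] exI[of _ "150 :: real"] allI impI)
  fix I assume "ddp_sc I"
  then interpret ddp I by unfold_locales
  obtain t s where ts: "exec main (initial I) t s" "t \<le> 150 * (ndel I * ndel I + nsta I)"
    "Some (solution I s) \<in> mod_alg I" using exec_main by blast
  \<comment> \<open>The quadratic bound is relaxed to the stated exponent, which is monotone because
    the base is at least 1.\<close>
  have "real (ndel I) * real (ndel I) = real (ndel I) powr 2"
    using ndel_pos by (simp add: power2_eq_square)
  also have "\<dots> \<le> real (ndel I) powr 2.273" using ndel_pos by (intro powr_mono) auto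
  finally have "real (ndel I) * real (ndel I) \<le> real (ndel I) powr 2.273" .
  moreover have "real t \<le> 150 * (real (ndel I) * real (ndel I) + real (nsta I))"
    using ts(2) by (metis (mono_tags) of_nat_add of_nat_le_iff of_nat_mult of_nat_numeral)
  ultimately have "real t \<le> 150 * (real (ndel I) powr 2.273 + real (nsta I))"
    by (smt (verit) mult_left_mono)
  then show "\<exists>t s. exec main (initial I) t s \<and>
               real t \<le> 150 * (real (ndel I) powr 2.273 + real (nsta I)) \<and>
               Some (solution I s) \<in> mod_alg I" using ts by blast
next
  fix I assume "ddp_sc I"
  then interpret ddp I by unfold_locales
  show "\<forall>res \<in> mod_alg I. \<exists>m A. res = Some (m, A) \<and>
           feasible_schedule I m A \<and>
           real m \<le> (3 + (eps_max I - eps_min I) / (1 - eps_max I)) * real (OPT_SC I)"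
    using always_mod_alg unfolding always_def by fastforce
qed

end
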